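(* Let $B_1^*=\{z\in\mathbb{C}: 0<|z|<1\}$ and let $(g,\nabla)$ be a special Kähler structure on $B_1^*$ with $g=w|dz|^2$, whose holomorphic cubic form $\Xi$ has order $N\in\mathbb{Z}$ at the origin. Assume that, as $z\to 0$, either $$w=|z|^{\beta}\bigl(C+o(1)\bigr)\ \text{ with }\ \beta\in\mathbb{R},\ \beta<N+1,\qquad\text{or}\qquad w=-|z|^{N+1}\log|z|\,\bigl(C+o(1)\bigr),$$ where $C>0$ is a constant; in the second case put, by definition, $\beta=N+1$. Let $\mathrm{Hol}(\nabla)$ denote the monodromy of $\nabla$ along a loop that goes once around the origin. Then the following holds: (i) If $\beta\notin\mathbb{Z}$, then $\mathrm{Hol}(\nabla)$ is conjugate to $\begin{pmatrix}\cos\pi\beta & -\sin\pi\beta\\ \sin\pi\beta & \cos\pi\beta\end{pmatrix}$. (ii) If $\beta\in 2\mathbb{Z}$, then $\mathrm{Hol}(\nabla)$ is trivial or conjugate to $\begin{pmatrix}1&1\\0&1\end{pmatrix}$. (iii) If $\beta\in 2\mathbb{Z}+1$, then $\mathrm{Hol}(\nabla)$ is $-\mathrm{id}$ or conjugate to $\begin{pmatrix}-1&1\\0&-1\end{pmatrix}$.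
   Context: A special Kähler structure (always meaning an affine special Kähler structure) on a Kähler manifold $(M,g,I,\omega)$, with $\omega(\cdot,\cdot)=g(I\cdot,\cdot)$, is a flat, torsion-free, symplectic (i.e. $\nabla\omega=0$) connection $\nabla$ on $TM$ such that $(\nabla_XI)Y=(\nabla_YI)X$ for all vector fields $X,Y$. On a domain of $\mathbb{C}$ the complex structure $I$ is the standard one, $z=x+iy$ is the standard coordinate, and $|dz|^2=dx^2+dy^2$. The holomorphic cubic form is $\Xi:=-\omega\bigl(\pi^{(1,0)},\nabla\pi^{(1,0)}\bigr)\in H^0(M;\mathrm{Sym}^3T^*M)$, where the projection $\pi^{(1,0)}$ of $T_{\mathbb{C}}M$ onto $T^{1,0}M\subset T_{\mathbb{C}}M$ is viewed as an element of $\Omega^{1,0}(M;T_{\mathbb{C}}M)$. On $B_1^*$ write $\Xi=\Xi_0\,dz^3$ with $\Xi_0$ holomorphic on $B_1^*$. The form $\Xi$ has order $N\in\mathbb{Z}$ at the origin if: for $N>0$, $\Xi_0$ has a zero of multiplicity $N$ at $0$; for $N<0$, $\Xi_0$ has a pole of order $|N|$ at $0$; for $N=0$, $\Xi_0$ is holomorphic and nonvanishing at $0$. In particular, essential singularities and the case $\Xi\equiv0$ are excluded. The monodromy is the parallel transport of $\nabla$ around the loop, a linear automorphism of a tangent space, regarded as a matrix via a choice of basis (hence determined up to conjugation). *)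

theory Defs
  imports "HOL-Complex_Analysis.Complex_Analysis" "HOL-Library.Landau_Symbols"
begin

text \<open>
  Differential geometry on an open set \<open>M\<close> of the complex plane. The tangent bundle is
  trivialised by the coordinate frame: the real tangent space at every point is the real
  vector space \<^typ>\<open>complex\<close> (with basis \<open>1\<close>, \<open>\<i>\<close> corresponding to the coordinate fields
  \<open>\<partial>\<^sub>x\<close>, \<open>\<partial>\<^sub>y\<close>), the standard complex structure \<open>I\<close> is multiplication by \<open>\<i>\<close>, and a vector
  field is a function from \<^typ>\<open>complex\<close> to \<^typ>\<open>complex\<close>, of which only the values on \<open>M\<close>
  matter. All derivatives are real Frechet derivatives.
\<close>

primrec Ck_on :: "nat \<Rightarrow> complex set \<Rightarrow> (complex \<Rightarrow> 'b::real_normed_vector) \<Rightarrow> bool" where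
  "Ck_on 0 M f \<longleftrightarrow> continuous_on M f"
| "Ck_on (Suc k) M f \<longleftrightarrow>
     (\<forall>z\<in>M. f differentiable (at z)) \<and>
     (\<forall>v. Ck_on k M (\<lambda>z. frechet_derivative f (at z) v))"

definition smooth_on :: "complex set \<Rightarrow> (complex \<Rightarrow> 'b::real_normed_vector) \<Rightarrow> bool" where
  "smooth_on M f \<longleftrightarrow> (\<forall>k. Ck_on k M f)"

definition dir_deriv ::
    "(complex \<Rightarrow> complex) \<Rightarrow> (complex \<Rightarrow> 'b::real_normed_vector) \<Rightarrow> complex \<Rightarrow> 'b" where
  "dir_deriv X f z = frechet_derivative f (at z) (X z)"

definition lie_bracket ::
    "(complex \<Rightarrow> complex) \<Rightarrow> (complex \<Rightarrow> complex) \<Rightarrow> complex \<Rightarrow> complex" where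
  "lie_bracket X Y z = dir_deriv X Y z - dir_deriv Y X z"


subsection \<open>Kaehler metrics\<close>

text \<open>A metric assigns to a point a bilinear form on the tangent space \<^typ>\<open>complex\<close>.\<close>

type_synonym metric = "complex \<Rightarrow> complex \<Rightarrow> complex \<Rightarrow> real"

definition kaehler_form :: "metric \<Rightarrow> complex \<Rightarrow> complex \<Rightarrow> complex \<Rightarrow> real" where
  "kaehler_form g z u v = g z (\<i> * u) v"

text \<open>
  The last clause is \<open>d\<omega> = 0\<close>, written out on constant vector fields. It holds
  automatically in real dimension two and is kept so that the definition is the usual one.
\<close>

definition kaehler_metric_on :: "complex set \<Rightarrow> metric \<Rightarrow> bool" where
  "kaehler_metric_on M g \<longleftrightarrow>
     (\<forall>u v. smooth_on M (\<lambda>z. g z u v)) \<and>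
     (\<forall>z\<in>M. bilinear (g z)) \<and>
     (\<forall>z\<in>M. \<forall>u v. g z u v = g z v u) \<and>
     (\<forall>z\<in>M. \<forall>u. u \<noteq> 0 \<longrightarrow> g z u u > 0) \<and>
     (\<forall>z\<in>M. \<forall>u v. g z (\<i> * u) (\<i> * v) = g z u v) \<and>
     (\<forall>z\<in>M. \<forall>u v t.
        frechet_derivative (\<lambda>p. kaehler_form g p v t) (at z) u
      + frechet_derivative (\<lambda>p. kaehler_form g p t u) (at z) v
      + frechet_derivative (\<lambda>p. kaehler_form g p u v) (at z) t = 0)"


subsection \<open>Connections on the tangent bundle\<close>

text \<open>
  As the tangent bundle is trivialised, every connection on it is \<open>d + \<Gamma>\<close> for a smooth
  one-form \<open>\<Gamma>\<close> with values in the real endomorphisms of \<^typ>\<open>complex\<close>. A connection is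
  represented by this \<open>\<Gamma>\<close>: the first argument is the point, the second the direction of
  differentiation.
\<close>

type_synonym connection = "complex \<Rightarrow> complex \<Rightarrow> complex \<Rightarrow> complex"

definition connection_on :: "complex set \<Rightarrow> connection \<Rightarrow> bool" where
  "connection_on M \<Gamma> \<longleftrightarrow>
     (\<forall>z\<in>M. bilinear (\<Gamma> z)) \<and> (\<forall>u v. smooth_on M (\<lambda>z. \<Gamma> z u v))"

definition nabla ::
    "connection \<Rightarrow> (complex \<Rightarrow> complex) \<Rightarrow> (complex \<Rightarrow> complex) \<Rightarrow> complex \<Rightarrow> complex" where
  "nabla \<Gamma> X Y z = dir_deriv X Y z + \<Gamma> z (X z) (Y z)"

definition flat_on :: "complex set \<Rightarrow> connection \<Rightarrow> bool" where
  "flat_on M \<Gamma> \<longleftrightarrow>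
     (\<forall>X Y Z. smooth_on M X \<and> smooth_on M Y \<and> smooth_on M Z \<longrightarrow>
        (\<forall>z\<in>M. nabla \<Gamma> X (nabla \<Gamma> Y Z) z - nabla \<Gamma> Y (nabla \<Gamma> X Z) z
               - nabla \<Gamma> (lie_bracket X Y) Z z = 0))"

definition torsion_free_on :: "complex set \<Rightarrow> connection \<Rightarrow> bool" where
  "torsion_free_on M \<Gamma> \<longleftrightarrow>
     (\<forall>X Y. smooth_on M X \<and> smooth_on M Y \<longrightarrow>
        (\<forall>z\<in>M. nabla \<Gamma> X Y z - nabla \<Gamma> Y X z = lie_bracket X Y z))"

definition symplectic_on :: "complex set \<Rightarrow> metric \<Rightarrow> connection \<Rightarrow> bool" where
  "symplectic_on M g \<Gamma> \<longleftrightarrow>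
     (\<forall>X Y Z. smooth_on M X \<and> smooth_on M Y \<and> smooth_on M Z \<longrightarrow>
        (\<forall>z\<in>M. dir_deriv X (\<lambda>p. kaehler_form g p (Y p) (Z p)) z =
                 kaehler_form g z (nabla \<Gamma> X Y z) (Z z) +
                 kaehler_form g z (Y z) (nabla \<Gamma> X Z z)))"

definition nabla_I ::
    "connection \<Rightarrow> (complex \<Rightarrow> complex) \<Rightarrow> (complex \<Rightarrow> complex) \<Rightarrow> complex \<Rightarrow> complex" where
  "nabla_I \<Gamma> X Y z = nabla \<Gamma> X (\<lambda>p. \<i> * Y p) z - \<i> * nabla \<Gamma> X Y z"

definition special_kaehler_on :: "complex set \<Rightarrow> metric \<Rightarrow> connection \<Rightarrow> bool" where
  "special_kaehler_on M g \<Gamma> \<longleftrightarrow>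
     kaehler_metric_on M g \<and> connection_on M \<Gamma> \<and>
     flat_on M \<Gamma> \<and> torsion_free_on M \<Gamma> \<and> symplectic_on M g \<Gamma> \<and>
     (\<forall>X Y. smooth_on M X \<and> smooth_on M Y \<longrightarrow>
        (\<forall>z\<in>M. nabla_I \<Gamma> X Y z = nabla_I \<Gamma> Y X z))"


subsection \<open>The holomorphic cubic form\<close>

text \<open>
  An element \<open>a + i b\<close> of the complexified tangent space (with \<open>a\<close>, \<open>b\<close> real tangent
  vectors, i.e. of type \<^typ>\<open>complex\<close>) is represented by the pair \<open>(a, b)\<close>. The formal
  imaginary unit \<open>i\<close> of the complexification must not be confused with \<open>I\<close>, which is
  multiplication by \<^term>\<open>\<i>\<close> on each component.
\<close>

type_synonym ctangent = "complex \<times> complex"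

text \<open>The complex bilinear extension of \<open>\<omega>\<close>.\<close>

definition kaehler_form_C :: "metric \<Rightarrow> complex \<Rightarrow> ctangent \<Rightarrow> ctangent \<Rightarrow> complex" where
  "kaehler_form_C g z p q =
     Complex (kaehler_form g z (fst p) (fst q) - kaehler_form g z (snd p) (snd q))
             (kaehler_form g z (fst p) (snd q) + kaehler_form g z (snd p) (fst q))"

text \<open>The projection \<open>v \<mapsto> (v - i I v) / 2\<close> to the \<open>(1,0)\<close> part, on real tangent vectors.\<close>

definition proj10 :: "complex \<Rightarrow> ctangent" where
  "proj10 v = (v / 2, - (\<i> * v) / 2)"

text \<open>The complex linear extension of the connection.\<close>

definition nabla_C ::
    "connection \<Rightarrow> (complex \<Rightarrow> complex) \<Rightarrow> (complex \<Rightarrow> ctangent) \<Rightarrow> complex \<Rightarrow> ctangent" where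
  "nabla_C \<Gamma> X Y z = (nabla \<Gamma> X (\<lambda>p. fst (Y p)) z, nabla \<Gamma> X (\<lambda>p. snd (Y p)) z)"

definition nabla_proj10 ::
    "connection \<Rightarrow> (complex \<Rightarrow> complex) \<Rightarrow> (complex \<Rightarrow> complex) \<Rightarrow> complex \<Rightarrow> ctangent" where
  "nabla_proj10 \<Gamma> X Y z = nabla_C \<Gamma> X (\<lambda>p. proj10 (Y p)) z - proj10 (nabla \<Gamma> X Y z)"

text \<open>
  \<open>\<Xi> = - \<omega>(\<pi>, \<nabla>\<pi>)\<close> with \<open>\<pi>\<close> the projection to the \<open>(1,0)\<close> part, evaluated on three real
  tangent vectors. As \<open>\<nabla>\<pi>\<close> is tensorial, \<open>v\<close> and \<open>t\<close> may be extended to constant fields.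
\<close>

definition cubic_form ::
    "metric \<Rightarrow> connection \<Rightarrow> complex \<Rightarrow> complex \<Rightarrow> complex \<Rightarrow> complex \<Rightarrow> complex" where
  "cubic_form g \<Gamma> z u v t =
     - kaehler_form_C g z (proj10 u) (nabla_proj10 \<Gamma> (\<lambda>_. v) (\<lambda>_. t) z)"

text \<open>
  Since \<open>dz(u) = u\<close> for a real tangent vector \<open>u\<close>, the equation \<open>\<Xi> = \<Xi>\<^sub>0 dz\<^sup>3\<close> reads
  \<open>\<Xi>(u, v, t) = \<Xi>\<^sub>0 u v t\<close>. The conditions on \<open>\<Xi>\<^sub>0\<close> near the origin rule out an essential
  singularity and \<open>\<Xi> \<equiv> 0\<close>, so that \<^const>\<open>zorder\<close> is the multiplicity of the zero or
  minus the order of the pole; it does not depend on the value of \<open>\<Xi>\<^sub>0\<close> at \<open>0\<close>.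
\<close>

definition cubic_form_order :: "complex set \<Rightarrow> metric \<Rightarrow> connection \<Rightarrow> int \<Rightarrow> bool" where
  "cubic_form_order M g \<Gamma> N \<longleftrightarrow>
     (\<exists>\<Xi>0. \<Xi>0 holomorphic_on M \<and>
        (\<forall>z\<in>M. \<forall>u v t. cubic_form g \<Gamma> z u v t = \<Xi>0 z * u * v * t) \<and>
        isolated_singularity_at \<Xi>0 0 \<and> not_essential \<Xi>0 0 \<and>
        (\<exists>\<^sub>F z in at 0. \<Xi>0 z \<noteq> 0) \<and>
        zorder \<Xi>0 0 = N)"


subsection \<open>Parallel transport\<close>

text \<open>
  Parallel vector fields along a piecewise \<open>C\<^sup>1\<close> path are continuous solutions of the parallelity
  equation outside a finite set, which absorbs the corners and the end points of the path.
\<close>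

definition parallel_along ::
    "connection \<Rightarrow> (real \<Rightarrow> complex) \<Rightarrow> (real \<Rightarrow> complex) \<Rightarrow> bool" where
  "parallel_along \<Gamma> \<gamma> V \<longleftrightarrow>
     continuous_on {0..1} V \<and>
     (\<exists>S. finite S \<and> (\<forall>t\<in>{0..1} - S.
        \<gamma> differentiable (at t) \<and>
        (V has_vector_derivative - \<Gamma> (\<gamma> t) (vector_derivative \<gamma> (at t)) (V t)) (at t)))"

definition parallel_transport ::
    "connection \<Rightarrow> (real \<Rightarrow> complex) \<Rightarrow> complex \<Rightarrow> complex" where
  "parallel_transport \<Gamma> \<gamma> v = (THE u. \<exists>V. parallel_along \<Gamma> \<gamma> V \<and> V 0 = v \<and> V 1 = u)"

text \<open>
  \<open>A\<close> is given by the matrix \<open>B\<close> with respect to some basis of the real vector space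
  \<^typ>\<open>complex\<close>; equivalently, the matrix of \<open>A\<close> in any basis is conjugate to \<open>B\<close>.
\<close>

definition conjugate_to_matrix :: "(complex \<Rightarrow> complex) \<Rightarrow> real^2^2 \<Rightarrow> bool" where
  "conjugate_to_matrix A B \<longleftrightarrow>
     (\<exists>P :: real^2 \<Rightarrow> complex. linear P \<and> bij P \<and> (\<forall>x. A (P x) = P (B *v x)))"

definition punctured_disc :: "complex set" where
  "punctured_disc = {z. 0 < norm z \<and> norm z < 1}"

end

theory Submission
  imports Defs "HOL-Real_Asymp.Real_Asymp"
begin

text \<open>
  Write \<open>\<nabla> = d + \<Gamma>\<close>. In one complex dimension the special Kaehler conditions say that
  \<open>\<Gamma>(u, v) = a u v + cnj (b u v)\<close> with \<open>a = \<partial> log w\<close> and \<open>\<Xi>\<^sub>0 = - (i/2) w b\<close>, and flatness turns into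
  \<open>\<partial>a/\<partial>(cnj z) = - \<bar>b\<bar>\<^sup>2\<close> and \<open>\<partial>b/\<partial>(cnj z) = - b cnj a\<close> (\<open>special_kaehler_local_form\<close>).
  Consequently a real one-form \<open>Re (\<phi> dz)\<close> is parallel if and only if \<open>\<phi>\<close> is holomorphic and
  \<open>\<phi>' = a \<phi> + b cnj \<phi>\<close>. The punctured disc is covered by the left half-plane through \<open>exp\<close>, and
  there the equations for \<open>a\<close> and \<open>b\<close> are the integrability conditions that yield a real
  two-dimensional space of solutions (\<open>flat_section_exists\<close>).

  Since \<open>\<omega>\<close> is parallel too, a basis \<open>\<phi>, \<psi>\<close> can be normalised so that
  \<open>w = Im (cnj \<phi> \<psi>)\<close>; its Wronskian is \<open>\<phi> \<psi>' - \<psi> \<phi>' = 4 \<Xi>\<^sub>0\<close>. The translation by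
  \<open>2 \<pi> i\<close> acts on the solutions by a matrix of determinant one, and parallel transport around the
  loop is dual to this matrix or to its inverse
  (\<open>parallel_transport_preserves_flat_forms\<close>). All three assertions of the theorem therefore
  follow once the trace of the matrix is known to be \<open>2 cos (\<pi> \<beta>)\<close>
  (\<open>flat_coframe_monodromy\<close>, \<open>conjugacy_class_from_trace\<close>).

  The trace is found by function theory. By positivity of \<open>w\<close> the quotient \<open>\<tau> = \<psi>/\<phi>\<close> takes
  values in the upper half-plane, and the translation by \<open>2 \<pi> i\<close> acts on it by a Moebius map.

  \<^item> If this map has a fixed point inside the half-plane, a Cayley transform turns \<open>\<tau>\<close> into a function
    \<open>q\<close> of modulus less than one that the translation multiplies by a constant, so that
    \<open>q = exp (\<nu> \<xi>) u (exp \<xi>)\<close> with \<open>\<nu> \<ge> 0\<close>. The Wronskian expresses the square of an eigenfunction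
    through \<open>q'\<close> and \<open>\<Xi>\<^sub>0\<close>; reading off exponents shows that \<open>w\<close> grows like a power
    \<open>\<bar>z\<bar> powr (N + 1 - d)\<close> with \<open>d > 0\<close>, hence \<open>\<beta> = N + 1 - d\<close>, and that the eigenvalue is
    \<open>exp (i \<pi> \<beta>)\<close> (\<open>elliptic_monodromy\<close>).

  \<^item> If it is a translation up to conjugation, \<open>exp (\<plusminus>2 \<pi> i \<tau>)\<close> is a bounded function of \<open>z\<close> with a
    simple zero; then \<open>w\<close> has the logarithmic growth, \<open>\<beta> = N + 1\<close>, and the double
    eigenvalue is \<open>exp (i \<pi> (N + 1))\<close> (\<open>parabolic_monodromy\<close>).

  \<^item> It cannot be a dilation: \<open>log \<tau>\<close> takes values in a strip, and a suitable multiple of it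
    would be the logarithm of a bounded function of \<open>z\<close> with winding number \<open>-1\<close> around \<open>0\<close>
    (\<open>hyperbolic_monodromy_impossible\<close>).
\<close>

section \<open>Linear ordinary differential equations\<close>

text \<open>
  Picard iteration: the \<open>n\<close>-th iterated integral is bounded by \<open>norm x0 (K t)\<^sup>n / n!\<close>, so the series
  of the iterated integrals converges uniformly together with its derivative.
\<close>

lemma linear_ode_solution_exists:
  fixes f :: "real \<Rightarrow> 'a \<Rightarrow> 'a::banach"
  assumes lin: "\<And>t. t \<in> {0..1} \<Longrightarrow> linear (f t)"
    and bd: "\<And>t x. t \<in> {0..1} \<Longrightarrow> norm (f t x) \<le> K * norm x"
    and cont: "\<And>x. continuous_on {0..1} x \<Longrightarrow> continuous_on {0..1} (\<lambda>t. f t (x t))"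
  obtains s where "s 0 = x0"
    "\<And>t. t \<in> {0..1} \<Longrightarrow> (s has_vector_derivative f t (s t)) (at t within {0..1})"
proof -
  define X where "X = rec_nat (\<lambda>t. x0) (\<lambda>n x t. integral {0..t} (\<lambda>r. f r (x r)))"
  have X0: "X 0 = (\<lambda>t. x0)" and XS: "X (Suc n) = (\<lambda>t. integral {0..t} (\<lambda>r. f r (X n r)))" for n
    by (simp_all add: X_def)
  have K: "K * norm x \<ge> 0" for x :: 'a
    using order_trans[OF norm_ge_zero bd[of 0 x]] by simp
  \<comment> \<open>\<open>F n\<close> is the derivative of \<open>X n\<close>, including the constant function \<open>X 0\<close>.\<close>
  define F where "F n t = (case n of 0 \<Rightarrow> 0 | Suc m \<Rightarrow> f t (X m t))" for n t
  have "continuous_on {0..1} (X n) \<and>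
      (\<forall>t\<in>{0..1}. (X n has_vector_derivative F n t) (at t within {0..1}))" for n
  proof (induction n)
    case 0
    then show ?case by (simp add: X0 F_def)
  next
    case (Suc n)
    then have c: "continuous_on {0..1} (\<lambda>r. f r (X n r))"
      using cont by blast
    have d: "(X (Suc n) has_vector_derivative F (Suc n) t) (at t within {0..1})" if "t \<in> {0..1}" for t
      using integral_has_vector_derivative[OF c that] by (simp add: XS F_def)
    then show ?case
      by (meson continuous_on_eq_continuous_within has_vector_derivative_continuous)
  qed
  then have Xc: "continuous_on {0..1} (X n)"
    and Xd: "t \<in> {0..1} \<Longrightarrow> (X n has_vector_derivative F n t) (at t within {0..1})" for n t
    by blast+
  have Xb: "norm (X n t) \<le> norm x0 * (K * t) ^ n / fact n" if "t \<in> {0..1}" for n t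
    using that
  proof (induction n arbitrary: t)
    case 0
    then show ?case by (simp add: X0)
  next
    case (Suc n)
    define G where "G t = norm x0 * (K * t) ^ Suc n / fact (Suc n)" for t
    have G: "(G has_vector_derivative K * (norm x0 * (K * r) ^ n / fact n)) (at r)" for r
      unfolding G_def has_real_derivative_iff_has_vector_derivative[symmetric]
      by (rule derivative_eq_intros refl | simp)+
    have Gc: "continuous_on S G" for S
      unfolding G_def by (intro continuous_intros) auto
    show ?case
    proof (cases "t = 0")
      case True
      then show ?thesis by (simp add: XS)
    next
      case False
      have "norm (X (Suc n) t - X (Suc n) 0) \<le> G t - G 0"
      proof (rule differentiable_bound_general)
        show "0 < t" using False Suc.prems by simp
        show "continuous_on {0..t} (X (Suc n))"
          using Xc Suc.prems continuous_on_subset by (metis atLeastAtMost_iff atLeastatMost_subset_iff order_refl)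
        fix r assume r: "0 < r" "r < t"
        then have r1: "r \<in> {0..1}" "r \<in> {0<..<1}" using Suc.prems by auto
        show "(X (Suc n) has_vector_derivative F (Suc n) r) (at r)"
          using Xd[OF r1(1)] r1(2) at_within_Icc_at by (metis greaterThanLessThan_iff)
        show "(G has_vector_derivative K * (norm x0 * (K * r) ^ n / fact n)) (at r)"
          by (rule G)
        have "norm (F (Suc n) r) \<le> K * norm (X n r)"
          using bd r1 by (simp add: F_def)
        also have "\<dots> \<le> K * (norm x0 * (K * r) ^ n / fact n)"
        proof (cases "x0 = 0")
          case True
          then show ?thesis using Suc.IH[OF r1(1)] by simp
        next
          case False
          then have "K \<ge> 0" using K[of x0] by (simp add: zero_le_mult_iff)
          then show ?thesis using Suc.IH[OF r1(1)] mult_left_mono by blast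
        qed
        finally show "norm (F (Suc n) r) \<le> K * (norm x0 * (K * r) ^ n / fact n)" .
      qed (rule Gc)
      then show ?thesis by (simp add: XS G_def)
    qed
  qed
  define s where "s t = (\<Sum>n. X n t)" for t
  have Xb1: "norm (X n t) \<le> norm x0 * (\<bar>K\<bar> ^ n / fact n)" if "t \<in> {0..1}" for n t
  proof -
    have "(K * t) ^ n \<le> \<bar>K * t\<bar> ^ n" by (metis abs_ge_self power_abs)
    also have "\<dots> \<le> \<bar>K\<bar> ^ n"
      using that by (intro power_mono) (auto simp: abs_mult mult_left_le)
    finally have "norm x0 * (K * t) ^ n / fact n \<le> norm x0 * (\<bar>K\<bar> ^ n / fact n)"
      by (simp add: divide_right_mono mult_left_mono)
    then show ?thesis using Xb[OF that, of n] by linarith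
  qed
  have sm: "summable (\<lambda>n. norm x0 * (\<bar>K\<bar> ^ n / fact n))"
    using summable_exp[of "\<bar>K\<bar>"] by (intro summable_mult) (simp add: field_simps)
  have ul: "uniform_limit {0..1} (\<lambda>n t. \<Sum>i<n. X i t) s sequentially"
    unfolding s_def by (rule Weierstrass_m_test[OF Xb1 sm]) 
  have sums: "(\<lambda>n. X n t) sums s t" if "t \<in> {0..1}" for t
    unfolding s_def by (intro summable_sums summable_comparison_test'[OF sm, of 0] Xb1[OF that])
  have "\<exists>g. \<forall>t\<in>{0..1}. (\<lambda>n. X n t) sums (g t) \<and>
     (g has_derivative (\<lambda>h. h *\<^sub>R f t (s t))) (at t within {0..1})"
  proof (rule has_derivative_series[where x=0 and l="s 0"])
    show "(X n has_derivative (\<lambda>h. h *\<^sub>R F n t)) (at t within {0..1})" if "t \<in> {0..1}" for n t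
      using Xd[OF that] by (simp add: has_vector_derivative_def)
    show "(\<lambda>n. X n 0) sums s 0" using sums by simp
    fix e :: real assume e: "e > 0"
    define e' where "e' = e / (\<bar>K\<bar> + 1)"
    have e': "e' > 0" "\<bar>K\<bar> * e' \<le> e" using e by (auto simp: e'_def field_simps)
    have "\<forall>\<^sub>F n in sequentially. \<forall>t\<in>{0..1}. norm ((\<Sum>i<n. X i t) - s t) < e'"
      using uniform_limitD[OF ul e'(1)] by (simp add: dist_norm)
    then have "\<forall>\<^sub>F n in sequentially. \<forall>t\<in>{0..1}. norm ((\<Sum>i<Suc n. F i t) - f t (s t)) \<le> e"
    proof eventually_elim
      case (elim n)
      show ?case
      proof
        fix t :: real assume t: "t \<in> {0..1}"
        interpret linear "f t" using lin t by simp
        have "(\<Sum>i<Suc n. F i t) = f t (\<Sum>i<n. X i t)"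
          by (subst sum.lessThan_Suc_shift) (simp add: F_def sum)
        then have "norm ((\<Sum>i<Suc n. F i t) - f t (s t)) = norm (f t ((\<Sum>i<n. X i t) - s t))"
          by (simp add: diff)
        also have "\<dots> \<le> K * norm ((\<Sum>i<n. X i t) - s t)" using bd t by simp
        also have "\<dots> \<le> \<bar>K\<bar> * e'" 
          using elim t by (intro mult_mono) (auto simp: less_imp_le)
        finally show "norm ((\<Sum>i<Suc n. F i t) - f t (s t)) \<le> e" using e' by linarith
      qed
    qed
    then have "\<forall>\<^sub>F n in sequentially. \<forall>t\<in>{0..1}. norm ((\<Sum>i<n. F i t) - f t (s t)) \<le> e"
      by (subst (asm) eventually_sequentially_Suc)
    then show "\<forall>\<^sub>F n in sequentially. \<forall>t\<in>{0..1}. \<forall>h.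
        norm ((\<Sum>i<n. h *\<^sub>R F i t) - h *\<^sub>R f t (s t)) \<le> e * norm h"
    proof eventually_elim
      case (elim n)
      then have "\<bar>h\<bar> * norm ((\<Sum>i<n. F i t) - f t (s t)) \<le> \<bar>h\<bar> * e" if "t \<in> {0..1}" for t h
        using that by (intro mult_left_mono) auto
      then show ?case
        by (simp add: scaleR_sum_right[symmetric] scaleR_diff_right[symmetric] mult.commute)
    qed
  qed auto
  then obtain g where g: "\<And>t. t\<in>{0..1} \<Longrightarrow> (\<lambda>n. X n t) sums (g t)"
     "\<And>t. t\<in>{0..1} \<Longrightarrow> (g has_derivative (\<lambda>h. h *\<^sub>R f t (s t))) (at t within {0..1})" by blast
  have gs: "g t = s t" if "t \<in> {0..1}" for t
    using g(1)[OF that] sums[OF that] sums_unique2 by blast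
  have "X n 0 = (if n = 0 then x0 else 0)" for n
    by (cases n) (auto simp: X0 XS)
  then have "(\<lambda>n. X n 0) sums x0"
    using sums_single[of 0 "\<lambda>_. x0"] by simp
  then have "g 0 = x0" using g(1)[of 0] sums_unique2 by auto
  moreover have "(g has_vector_derivative f t (g t)) (at t within {0..1})" if "t \<in> {0..1}" for t
    using g(2)[OF that] gs[OF that] by (simp add: has_vector_derivative_def)
  ultimately show ?thesis by (rule that)
qed

text \<open>
  Since \<open>2 e \<bar>d\<bar> \<le> e\<^sup>2 + \<bar>d\<bar>\<^sup>2\<close>, the function \<open>(\<bar>d\<bar>\<^sup>2 + e\<^sup>2) exp (- (2 K + 1) t)\<close> is
  nonincreasing.
\<close>

lemma gronwall_inequality:
  fixes d :: "real \<Rightarrow> 'a::real_inner"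
  assumes deriv: "\<And>t. t \<in> {0..1} \<Longrightarrow> (d has_vector_derivative d' t) (at t within {0..1})"
    and bound: "\<And>t. t \<in> {0..1} \<Longrightarrow> norm (d' t) \<le> K * norm (d t) + e"
    and "d 0 = 0" and e: "e \<ge> 0" and K: "K \<ge> 0"
  shows "norm (d 1) \<le> e * exp (K + 1)"
proof -
  define f where "f t = (d t \<bullet> d t + e\<^sup>2) * exp (- (2 * K + 1) * t)" for t
  have dc: "continuous_on {0..1} d"
    using deriv by (meson continuous_on_eq_continuous_within has_vector_derivative_continuous)
  have young: "2 * x \<le> (2 * K + 1) * (n\<^sup>2 + e\<^sup>2)" if "x \<le> n * (K * n + e)" for x n :: real
  proof -
    have "2 * (n * e) \<le> n\<^sup>2 + e\<^sup>2" using sum_squares_bound[of n e] by simp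
    moreover have "0 \<le> K * e\<^sup>2" using K by simp
    ultimately show ?thesis using that by (simp add: algebra_simps power2_eq_square)
  qed
  have "f 0 \<ge> f 1"
  proof (rule DERIV_nonpos_imp_decreasing_open[where f=f and a=0 and b=1])
    show "continuous_on {0..1} f" unfolding f_def by (intro continuous_intros dc)
    fix t :: real assume t: "0 < t" "t < 1"
    then have "(d has_vector_derivative d' t) (at t)"
      using deriv[of t] at_within_Icc_at[of 0 t 1] by simp
    note [derivative_intros] = this[unfolded has_vector_derivative_def]
    have "(f has_derivative (\<lambda>h. h * (((2 * (d t \<bullet> d' t)) - (2 * K + 1) * (d t \<bullet> d t + e\<^sup>2)) * exp (- (2 * K + 1) * t)))) (at t)"
      unfolding f_def
      apply (rule derivative_eq_intros refl)+
      apply (auto simp: fun_eq_iff algebra_simps inner_commute)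
      done
    then have "(f has_real_derivative (((2 * (d t \<bullet> d' t)) - (2 * K + 1) * (d t \<bullet> d t + e\<^sup>2)) * exp (- (2 * K + 1) * t))) (at t)"
      unfolding has_field_derivative_def by (rule back_subst[of "\<lambda>D. (f has_derivative D) (at t)"]) (simp add: fun_eq_iff)
    moreover have "2 * (d t \<bullet> d' t) \<le> (2 * K + 1) * (d t \<bullet> d t + e\<^sup>2)"
    proof -
      have "d t \<bullet> d' t \<le> norm (d t) * norm (d' t)" by (rule norm_cauchy_schwarz)
      also have "\<dots> \<le> norm (d t) * (K * norm (d t) + e)"
        using bound[of t] t by (intro mult_left_mono) auto
      finally have "2 * (d t \<bullet> d' t) \<le> (2 * K + 1) * ((norm (d t))\<^sup>2 + e\<^sup>2)"
        by (rule young)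
      then show ?thesis by (simp only: power2_norm_eq_inner)
    qed
    ultimately show "\<exists>y. (f has_real_derivative y) (at t) \<and> y \<le> 0"
      by (intro exI conjI) (auto simp: mult_nonpos_nonneg)
  qed simp
  then have "f 1 \<le> e\<^sup>2"
    using \<open>d 0 = 0\<close> by (simp add: f_def)
  then have "f 1 * exp (2 * K + 1) \<le> e\<^sup>2 * exp (2 * K + 1)"
    by (intro mult_right_mono) auto
  also have "f 1 * exp (2 * K + 1) = (norm (d 1))\<^sup>2 + e\<^sup>2"
    unfolding f_def power2_norm_eq_inner mult.assoc exp_add[symmetric] by simp
  finally have 1: "(norm (d 1))\<^sup>2 + e\<^sup>2 \<le> e\<^sup>2 * exp (2 * K + 1)" .
  have "e\<^sup>2 * exp (2 * K + 1) \<le> e\<^sup>2 * exp (2 * (K + 1))"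
    by (intro mult_left_mono) auto
  also have "exp (2 * (K + 1)) = (exp (K + 1))\<^sup>2"
    by (rule exp_double)
  also have "e\<^sup>2 * (exp (K + 1))\<^sup>2 = (e * exp (K + 1))\<^sup>2"
    by (rule power_mult_distrib[symmetric])
  finally have "(norm (d 1))\<^sup>2 \<le> (e * exp (K + 1))\<^sup>2"
    using 1 by (meson le_add_same_cancel1 order_trans zero_le_power2)
  then show ?thesis
    by (rule power2_le_imp_le) (use e in simp)
qed

section \<open>Flat sections over convex domains\<close>

text \<open>
  A form of uniform continuity in which only one of the two nearby points has to lie in the
  compact set.
\<close>

lemma uniformly_continuous_near_compact:
  fixes f :: "'a::euclidean_space \<Rightarrow> 'b::metric_space"
  assumes "open U" "compact S" "S \<subseteq> U" "continuous_on U f" "e > 0"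
  obtains r where "r > 0"
    "\<And>c k. c \<in> S \<Longrightarrow> norm k < r \<Longrightarrow> c + k \<in> U \<and> dist (f (c + k)) (f c) < e"
proof -
  obtain R where R: "R > 0" "(\<Union>x\<in>S. cball x R) \<subseteq> U"
    using compact_subset_open_imp_cball_epsilon_subset[OF assms(2,1,3)] by blast
  define T where "T = (\<Union>x\<in>S. cball x R)"
  have "compact T" "T \<subseteq> U"
    unfolding T_def using compact_minkowski_sum_cball[OF assms(2)] R by auto
  then have "uniformly_continuous_on T f"
    using assms(4) by (auto intro!: compact_uniformly_continuous intro: continuous_on_subset)
  then obtain d where d: "d > 0" "\<And>x y. x \<in> T \<Longrightarrow> y \<in> T \<Longrightarrow> dist x y < d \<Longrightarrow> dist (f x) (f y) < e"
    using \<open>e > 0\<close> unfolding uniformly_continuous_on_def by metis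
  show thesis
  proof (rule that[of "min d R"])
    fix c k :: 'a assume c: "c \<in> S" and k: "norm k < min d R"
    have "c \<in> T" "c + k \<in> T"
      using c k R(1) unfolding T_def by (auto intro!: bexI[of _ c] simp: dist_norm)
    then show "c + k \<in> U \<and> dist (f (c + k)) (f c) < e"
      using d(2)[of "c + k" c] k \<open>T \<subseteq> U\<close> by (auto simp: dist_norm)
  qed (use d R in auto)
qed

text \<open>
  Continuity of the Wirtinger derivatives \<open>P\<close> and \<open>Q\<close> near \<open>S\<close> makes the first order Taylor
  remainder small uniformly in the base point.
\<close>

lemma uniform_linearization_on_compact:
  fixes f P Q :: "complex \<Rightarrow> complex"
  assumes U: "open U" and S: "compact S" "S \<subseteq> U"
    and deriv: "\<And>z. z \<in> U \<Longrightarrow> (f has_derivative (\<lambda>h. P z * h + Q z * cnj h)) (at z)"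
    and cont: "continuous_on U P" "continuous_on U Q"
    and "e > 0"
  obtains r where "r > 0"
    "\<And>c k. c \<in> S \<Longrightarrow> norm k < r \<Longrightarrow> c + k \<in> U \<and>
       norm (f (c + k) - f c - (P c * k + Q c * cnj k)) \<le> e * norm k"
proof -
  have e2: "e / 2 > 0" using \<open>e > 0\<close> by simp
  obtain d1 where d1: "d1 > 0" "\<And>c k. c \<in> S \<Longrightarrow> norm k < d1 \<Longrightarrow> c + k \<in> U \<and> dist (P (c + k)) (P c) < e / 2"
    using uniformly_continuous_near_compact[OF U S cont(1) e2] by blast
  obtain d2 where d2: "d2 > 0" "\<And>c k. c \<in> S \<Longrightarrow> norm k < d2 \<Longrightarrow> c + k \<in> U \<and> dist (Q (c + k)) (Q c) < e / 2"
    using uniformly_continuous_near_compact[OF U S cont(2) e2] by blast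
  define r where "r = min d1 d2"
  have r: "r > 0" "r \<le> d1" "r \<le> d2" using d1 d2 by (auto simp: r_def)
  show thesis
  proof (rule that[OF r(1)])
    fix c k :: complex assume c: "c \<in> S" and k: "norm k < r"
    have ck: "c + t *\<^sub>R k \<in> ball c r" if "t \<in> {0..1}" for t :: real
    proof -
      have "\<bar>t\<bar> * norm k \<le> norm k" using that by (simp add: mult_left_le_one_le)
      then show ?thesis using k by (simp add: dist_norm norm_mult)
    qed
    let ?f' = "\<lambda>z h. P z * h + Q z * cnj h"
    have near: "x \<in> U" "norm (P x - P c) \<le> e / 2" "norm (Q x - Q c) \<le> e / 2" if "x \<in> ball c r" for x
      using d1(2)[OF c, of "x - c"] d2(2)[OF c, of "x - c"] that r
      by (auto simp: dist_norm norm_minus_commute)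
    have "norm (f (c + k) - f c - ?f' c (c + k - c)) \<le> norm (c + k - c) * e"
    proof (rule differentiable_bound_linearization[where S="ball c r" and f'="?f'"])
      show "c + t *\<^sub>R (c + k - c) \<in> ball c r" if "t \<in> {0..1}" for t using ck[OF that] by simp
      show "(f has_derivative ?f' x) (at x within ball c r)" if "x \<in> ball c r" for x
        by (rule has_derivative_at_withinI[OF deriv[OF near(1)[OF that]]])
      show "c \<in> ball c r" using r by simp
      fix x assume x: "x \<in> ball c r"
      show "onorm (?f' x - ?f' c) \<le> e"
      proof (rule onorm_le)
        fix h :: complex
        have "(?f' x - ?f' c) h = (P x - P c) * h + (Q x - Q c) * cnj h"
          by (simp add: algebra_simps)
        also have "norm \<dots> \<le> norm (P x - P c) * norm h + norm (Q x - Q c) * norm h"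
          by (rule order_trans[OF norm_triangle_ineq]) (simp add: norm_mult)
        also have "\<dots> \<le> e / 2 * norm h + e / 2 * norm h"
          using near[OF x] by (intro add_mono mult_right_mono) auto
        finally show "norm ((?f' x - ?f' c) h) \<le> e * norm h" by simp
      qed
    qed
    moreover have "c + k \<in> U" using d1(2)[OF c] k r by auto
    ultimately show "c + k \<in> U \<and> norm (f (c + k) - f c - ?f' c k) \<le> e * norm k"
      by (simp add: mult.commute)
  qed
qed

lemma cnj_linear_ode_solution_exists:
  fixes a b :: "real \<Rightarrow> complex"
  assumes a: "continuous_on {0..1} a" and b: "continuous_on {0..1} b"
  shows "\<exists>s. s 0 = x0 \<and> (\<forall>t\<in>{0..1}. (s has_vector_derivative a t * s t + b t * cnj (s t)) (at t within {0..1}))"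
proof -
  have "compact (a ` {0..1})" "compact (b ` {0..1})"
    using a b by (auto intro: compact_continuous_image)
  then obtain Ka Kb where K: "\<And>t. t \<in> {0..1} \<Longrightarrow> norm (a t) \<le> Ka" "\<And>t. t \<in> {0..1} \<Longrightarrow> norm (b t) \<le> Kb"
    by (metis compact_imp_bounded bounded_iff imageI)
  obtain s where "s 0 = x0" "\<And>t. t \<in> {0..1} \<Longrightarrow> (s has_vector_derivative a t * s t + b t * cnj (s t)) (at t within {0..1})"
  proof (rule linear_ode_solution_exists[where f="\<lambda>t x. a t * x + b t * cnj x" and K="Ka + Kb" and ?x0.0 = x0])
    show "linear (\<lambda>x. a t * x + b t * cnj x)" for t
      by (rule linearI) (auto simp: algebra_simps scaleR_conv_of_real)
    show "continuous_on {0..1} (\<lambda>t. a t * x t + b t * cnj (x t))" if "continuous_on {0..1} x" for x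
      by (intro continuous_intros that a b)
    fix t :: real and x :: complex assume t: "t \<in> {0..1}"
    have "norm (a t * x + b t * cnj x) \<le> norm (a t) * norm x + norm (b t) * norm x"
      by (rule order_trans[OF norm_triangle_ineq]) (simp add: norm_mult)
    also have "\<dots> \<le> Ka * norm x + Kb * norm x"
      using K[OF t] by (intro add_mono mult_right_mono) auto
    finally show "norm (a t * x + b t * cnj x) \<le> (Ka + Kb) * norm x" by (simp add: algebra_simps)
  qed blast
  then show ?thesis by blast
qed

text \<open>
  A Frobenius theorem for the equation \<open>d\<phi> = (A \<phi> + B cnj \<phi>) dz\<close>; the prescribed antiholomorphic
  derivatives of \<open>A\<close> and \<open>B\<close> are its integrability conditions. The solution is obtained by solving
  the equation along the segments that start at \<open>p\<close>. It is differentiable for the following reason.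
  If \<open>s y\<close> and \<open>s z\<close> are the solutions along two neighbouring segments and \<open>h = y - z\<close>, the first
  order prediction of \<open>s y t\<close> is \<open>s z t + t h G t\<close> with \<open>G = A (s z) + B cnj (s z)\<close>. The
  error \<open>D\<close> of this prediction satisfies a linear differential equation whose inhomogeneous part is
  \<open>o(h)\<close>, because the terms of first order in \<open>h\<close> cancel by integrability, and Gronwall's
  inequality transfers this bound to \<open>D\<close>.
\<close>

lemma flat_section_exists:
  fixes A B :: "complex \<Rightarrow> complex"
  assumes U: "open U" "convex U" "p \<in> U"
    and dA: "\<And>z. z \<in> U \<Longrightarrow> (A has_derivative (\<lambda>h. A1 z * h + - (B z * cnj (B z)) * cnj h)) (at z)"
    and dB: "\<And>z. z \<in> U \<Longrightarrow> (B has_derivative (\<lambda>h. B1 z * h + - (B z * cnj (A z)) * cnj h)) (at z)"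
    and c1: "continuous_on U A1" "continuous_on U B1"
  obtains \<phi> where "\<phi> p = \<alpha>"
    "\<And>z. z \<in> U \<Longrightarrow> (\<phi> has_field_derivative A z * \<phi> z + B z * cnj (\<phi> z)) (at z)"
proof -
  have cA: "continuous_on U A"
    by (intro continuous_at_imp_continuous_on ballI has_derivative_continuous[OF dA])
  have cB: "continuous_on U B"
    by (intro continuous_at_imp_continuous_on ballI has_derivative_continuous[OF dB])
  define c where "c z t = p + of_real t * (z - p)" for z and t :: real
  have cU: "c z t \<in> U" if "z \<in> U" "t \<in> {0..1}" for z t
    using convexD[OF U(2,3) that(1), of "1 - t" t] that by (simp add: c_def algebra_simps scaleR_conv_of_real)
  have cc: "continuous_on T (c z)" for z T unfolding c_def by (intro continuous_intros)
  have cont_c: "continuous_on {0..1} (\<lambda>t. F (c z t))" if "z \<in> U" "continuous_on U F" for z and F :: "complex \<Rightarrow> complex"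
    by (rule continuous_on_compose2[OF that(2) cc]) (use cU that in auto)
  have "\<exists>s. s 0 = \<alpha> \<and> (\<forall>t\<in>{0..1}. (s has_vector_derivative
           (z - p) * (A (c z t) * s t + B (c z t) * cnj (s t))) (at t within {0..1}))"
    if "z \<in> U" for z
    using cnj_linear_ode_solution_exists[of "\<lambda>t. (z - p) * A (c z t)" "\<lambda>t. (z - p) * B (c z t)" \<alpha>]
    by (simp add: distrib_left mult.assoc continuous_intros cont_c cA cB that)
  then have "\<exists>s. \<forall>z\<in>U. s z 0 = \<alpha> \<and> (\<forall>t\<in>{0..1}. (s z has_vector_derivative
           (z - p) * (A (c z t) * s z t + B (c z t) * cnj (s z t))) (at t within {0..1}))"
    by (intro bchoice) blast
  then obtain s where s0: "\<And>z. z \<in> U \<Longrightarrow> s z 0 = \<alpha>" and sd: "\<And>z t. z \<in> U \<Longrightarrow> t \<in> {0..1} \<Longrightarrow> (s z has_vector_derivative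
           (z - p) * (A (c z t) * s z t + B (c z t) * cnj (s z t))) (at t within {0..1})"
    by blast
  have sc: "continuous_on {0..1} (s z)" if "z \<in> U" for z
    
    unfolding continuous_on_eq_continuous_within
    using has_vector_derivative_continuous[OF sd[OF that]] by blast
  define \<phi> where "\<phi> z = s z 1" for z
  have "s p 1 = s p 0"
    using sd[OF U(3)] by (intro has_derivative_zero_unique[of "{0..1}"]) (auto simp: has_vector_derivative_def)
  then have "\<phi> p = \<alpha>" using s0 U by (simp add: \<phi>_def)
  moreover have "(\<phi> has_field_derivative A z * \<phi> z + B z * cnj (\<phi> z)) (at z)" if z: "z \<in> U" for z
  proof -
    define X where "X = z - p"
    define G where "G = (\<lambda>t. A (c z t) * s z t + B (c z t) * cnj (s z t))"
    define G1 where "G1 t = A1 (c z t) * s z t + B1 (c z t) * cnj (s z t) + A (c z t) * G t" for t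
    have Gc: "continuous_on {0..1} G" unfolding G_def
      by (intro continuous_intros cont_c cA cB z sc)
    have G1c: "continuous_on {0..1} G1" unfolding G1_def
      by (intro continuous_intros cont_c cA cB c1 z sc Gc)
    have Gd: "(G has_vector_derivative X * G1 t) (at t within {0..1})" if t: "t \<in> {0..1}" for t
    proof -
      have dc: "(c z has_derivative (\<lambda>h. of_real h * X)) (at t within {0..1})"
        unfolding c_def X_def by (auto intro!: derivative_eq_intros)
      have dAc: "((\<lambda>t. A (c z t)) has_derivative (\<lambda>h. A1 (c z t) * (of_real h * X) + - (B (c z t) * cnj (B (c z t))) * cnj (of_real h * X))) (at t within {0..1})"
        by (rule has_derivative_compose[OF dc dA[OF cU[OF z t]]])
      have dBc: "((\<lambda>t. B (c z t)) has_derivative (\<lambda>h. B1 (c z t) * (of_real h * X) + - (B (c z t) * cnj (A (c z t))) * cnj (of_real h * X))) (at t within {0..1})"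
        by (rule has_derivative_compose[OF dc dB[OF cU[OF z t]]])
      have ds: "(s z has_derivative (\<lambda>h. h *\<^sub>R (X * G t))) (at t within {0..1})"
        using sd[OF z t] by (simp add: has_vector_derivative_def X_def G_def)
      show ?thesis
        unfolding has_vector_derivative_def
        apply (subst G_def)
        apply (rule derivative_eq_intros dAc dBc ds has_derivative_cnj refl)+
        by (simp add: fun_eq_iff G_def G1_def algebra_simps scaleR_conv_of_real)
    qed
    define S where "S = c z ` {0..1}"
    have S: "compact S" "S \<subseteq> U"
      unfolding S_def using cc cU z by (auto intro!: compact_continuous_image)
    have cnjc: "continuous_on U (\<lambda>z. - (B z * cnj (B z)))" "continuous_on U (\<lambda>z. - (B z * cnj (A z)))"
      by (intro continuous_intros cA cB)+
    have bdd: "\<exists>M\<ge>0. \<forall>t\<in>{0..1}. norm (F t) \<le> M" if "continuous_on {0..1} F" for F :: "real \<Rightarrow> complex"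
    proof -
      have "bounded (F ` {0..1})" using that by (intro compact_imp_bounded compact_continuous_image) auto
      then obtain M where M: "\<forall>x\<in>F ` {0..1}. norm x \<le> M" by (auto simp: bounded_iff)
      show ?thesis using M by (intro exI[of _ "max M 0"]) (auto simp: le_max_iff_disj)
    qed
    obtain MA where MA: "MA \<ge> 0" "\<And>t. t \<in> {0..1} \<Longrightarrow> norm (A (c z t)) \<le> MA" using bdd[OF cont_c[OF z cA]] by blast
    obtain MB where MB: "MB \<ge> 0" "\<And>t. t \<in> {0..1} \<Longrightarrow> norm (B (c z t)) \<le> MB" using bdd[OF cont_c[OF z cB]] by blast
    obtain Ms where Ms: "Ms \<ge> 0" "\<And>t. t \<in> {0..1} \<Longrightarrow> norm (s z t) \<le> Ms" using bdd[OF sc[OF z]] by blast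
    obtain MG where MG: "MG \<ge> 0" "\<And>t. t \<in> {0..1} \<Longrightarrow> norm (G t) \<le> MG" using bdd[OF Gc] by blast
    obtain M1 where M1: "M1 \<ge> 0" "\<And>t. t \<in> {0..1} \<Longrightarrow> norm (G1 t) \<le> M1" using bdd[OF G1c] by blast
    show ?thesis
      unfolding has_field_derivative_def has_derivative_within_alt
    proof (intro conjI allI impI)
      show "bounded_linear ((*) (A z * \<phi> z + B z * cnj (\<phi> z)))" by (rule bounded_linear_mult_right)
      fix e :: real assume "e > 0"
      \<comment> \<open>\<open>K\<close> bounds the coefficients of the equation for \<open>D\<close>, and \<open>norm h * e1 * (M1 + L)\<close> its inhomogeneous part.\<close>
      define K where "K = (norm X + 1) * (MA + MB + 2)"
      define L where "L = (norm X + 1) * (2 * Ms + 2 * MG)"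
      define e1 where "e1 = e / (exp (K + 1) * (M1 + L + 1))"
      have K0: "K \<ge> 0" "L \<ge> 0" using MA MB Ms MG by (simp_all add: K_def L_def)
      have e1: "e1 > 0" using \<open>e > 0\<close> K0 M1 by (simp add: e1_def add_nonneg_pos)
      obtain r1 where r1: "r1 > 0" "\<And>c k. c \<in> S \<Longrightarrow> norm k < r1 \<Longrightarrow> c + k \<in> U \<and>
         norm (A (c + k) - A c - (A1 c * k + - (B c * cnj (B c)) * cnj k)) \<le> e1 * norm k" 
        using uniform_linearization_on_compact[OF U(1) S dA c1(1) cnjc(1) e1] by blast
      obtain r2 where r2: "r2 > 0" "\<And>c k. c \<in> S \<Longrightarrow> norm k < r2 \<Longrightarrow> c + k \<in> U \<and>
         norm (B (c + k) - B c - (B1 c * k + - (B c * cnj (A c)) * cnj k)) \<le> e1 * norm k" 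
        using uniform_linearization_on_compact[OF U(1) S dB c1(2) cnjc(2) e1] by blast
      define e2 where "e2 = min e1 1"
      have e2: "e2 > 0" "e2 \<le> e1" "e2 \<le> 1" using e1 by (auto simp: e2_def)
      obtain r3 where r3: "r3 > 0" "\<And>c k. c \<in> S \<Longrightarrow> norm k < r3 \<Longrightarrow> c + k \<in> U \<and> dist (A (c + k)) (A c) < e2"
        using uniformly_continuous_near_compact[OF U(1) S cA e2(1)] by blast
      obtain r4 where r4: "r4 > 0" "\<And>c k. c \<in> S \<Longrightarrow> norm k < r4 \<Longrightarrow> c + k \<in> U \<and> dist (B (c + k)) (B c) < e2"
        using uniformly_continuous_near_compact[OF U(1) S cB e2(1)] by blast
      define r where "r = Min {r1, r2, r3, r4, e1, 1}"
      have r: "r > 0" "r \<le> r1" "r \<le> r2" "r \<le> r3" "r \<le> r4" "r \<le> e1" "r \<le> 1" using r1 r2 r3 r4 e1 by (auto simp: r_def)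
      show "\<exists>d>0. \<forall>y\<in>UNIV. norm (y - z) < d \<longrightarrow>
          norm (\<phi> y - \<phi> z - (A z * \<phi> z + B z * cnj (\<phi> z)) * (y - z)) \<le> e * norm (y - z)"
      proof (intro exI conjI ballI impI)
        fix y assume y: "norm (y - z) < r"
        define h where "h = y - z"
        have h: "norm h < r" using y by (simp add: h_def)
        have zS: "z \<in> S" unfolding S_def by (rule image_eqI[of _ _ 1]) (auto simp: c_def)
        have yU: "y \<in> U" using r1(2)[OF zS, of h] h r by (auto simp: h_def)
        have cy: "c y t = c z t + of_real t * h" for t by (simp add: c_def h_def algebra_simps)
        have yX: "y - p = X + h" by (simp add: X_def h_def)
        define D where "D = (\<lambda>t. s y t - s z t - of_real t * h * G t)"
        define D' where "D' t = (X + h) * (A (c y t) * s y t + B (c y t) * cnj (s y t)) - X * G t - h * G t - of_real t * h * (X * G1 t)" for t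
        have "norm (D 1) \<le> (norm h * e1 * (M1 + L)) * exp (K + 1)"
        proof (rule gronwall_inequality)
          fix t :: real assume t: "t \<in> {0..1}"
          have t1: "0 \<le> t" "t \<le> 1" using t by auto
          have ds: "(s y has_derivative (\<lambda>k. k *\<^sub>R ((X + h) * (A (c y t) * s y t + B (c y t) * cnj (s y t))))) (at t within {0..1})"
            "(s z has_derivative (\<lambda>k. k *\<^sub>R (X * G t))) (at t within {0..1})"
            "(G has_derivative (\<lambda>k. k *\<^sub>R (X * G1 t))) (at t within {0..1})"
            using sd[OF z t] sd[OF yU t] Gd[OF t] by (simp_all add: has_vector_derivative_def X_def G_def yX[unfolded X_def])
          show "(D has_vector_derivative D' t) (at t within {0..1})"
            unfolding D_def D'_def has_vector_derivative_def
            apply (rule derivative_eq_intros ds refl)+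
            by (simp add: fun_eq_iff algebra_simps scaleR_conv_of_real)
          define x where "x = c z t"
          have xS: "x \<in> S" using t by (auto simp: x_def S_def)
          define k where "k = of_real t * h"
          have nk: "norm k \<le> norm h" using t1 by (simp add: k_def norm_mult mult_left_le_one_le)
          then have k: "norm k < r1" "norm k < r2" "norm k < r3" "norm k < r4" using h r by auto
          define rA where "rA = A (x + k) - A x - (A1 x * k + - (B x * cnj (B x)) * cnj k)"
          define rB where "rB = B (x + k) - B x - (B1 x * k + - (B x * cnj (A x)) * cnj k)"
          have nr: "norm rA \<le> e1 * norm h" "norm rB \<le> e1 * norm h"
            using r1(2)[OF xS k(1)] r2(2)[OF xS k(2)] nk e1 unfolding rA_def rB_def
            by (meson mult_left_mono order_trans less_imp_le)+
          define EA where "EA = A (x + k) - A x"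
          define EB where "EB = B (x + k) - B x"
          have nE: "norm EA \<le> e1" "norm EB \<le> e1" "norm EA \<le> 1" "norm EB \<le> 1"
            using r3(2)[OF xS k(3)] r4(2)[OF xS k(4)] e2 by (auto simp: EA_def EB_def dist_norm)
          \<comment> \<open>The part of the right hand side that is of higher order in \<open>h\<close>.\<close>
          define W where "W = rA * s z t + rB * cnj (s z t) + EA * k * G t + EB * cnj k * cnj (G t)"
          have cyx: "c y t = x + k" by (simp add: cy x_def k_def)
          have Aeq: "A (c y t) = A x + (A1 x * k + - (B x * cnj (B x)) * cnj k) + rA"
            by (simp add: cyx rA_def)
          have Beq: "B (c y t) = B x + (B1 x * k + - (B x * cnj (A x)) * cnj k) + rB"
            by (simp add: cyx rB_def)
          have sy: "s y t = D t + s z t + k * G t" by (simp add: D_def k_def)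
          have Gt: "G t = A x * s z t + B x * cnj (s z t)" by (simp add: G_def x_def)
          have cG: "cnj (G t) = cnj (A x) * cnj (s z t) + cnj (B x) * s z t" by (simp add: Gt)
          have "A (c y t) * s y t + B (c y t) * cnj (s y t) = A (c y t) * D t + B (c y t) * cnj (D t)
              + (A (c y t) * s z t + B (c y t) * cnj (s z t) + A (c y t) * k * G t + B (c y t) * cnj k * cnj (G t))"
            by (simp add: sy algebra_simps)
          also have "A (c y t) * s z t + B (c y t) * cnj (s z t) + A (c y t) * k * G t + B (c y t) * cnj k * cnj (G t)
             = A (c y t) * s z t + B (c y t) * cnj (s z t) + (A x + EA) * k * G t + (B x + EB) * cnj k * cnj (G t)"
            by (simp add: EA_def EB_def cyx)
          \<comment> \<open>The terms with \<open>cnj k\<close> cancel: this is where integrability enters.\<close>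
          also have "\<dots> = G t + k * G1 t + W"
            unfolding Aeq Beq W_def G1_def x_def[symmetric]
            using cG Gt by (simp add: algebra_simps)
          finally have key: "A (c y t) * s y t + B (c y t) * cnj (s y t) = 
             (A (c y t) * D t + B (c y t) * cnj (D t)) + (G t + k * G1 t + W)" .
          have D'eq: "D' t = (X + h) * (A (c y t) * D t + B (c y t) * cnj (D t)) + (h * k * G1 t + (X + h) * W)"
            unfolding D'_def key by (simp add: k_def algebra_simps)
          have nX: "norm (X + h) \<le> norm X + 1"
            using norm_triangle_ineq[of X h] h r by linarith
          have n1: "norm (A (c y t) * D t + B (c y t) * cnj (D t)) \<le> (MA + MB + 2) * norm (D t)"
          proof -
            have "A (c y t) = A x + EA" "B (c y t) = B x + EB" by (auto simp: EA_def EB_def cyx)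
            then have "norm (A (c y t)) \<le> MA + 1" "norm (B (c y t)) \<le> MB + 1"
              using MA(2)[OF t] MB(2)[OF t] nE norm_triangle_ineq[of "A x" EA] norm_triangle_ineq[of "B x" EB]
              by (auto simp: x_def)
            then have "norm (A (c y t)) * norm (D t) + norm (B (c y t)) * norm (D t) \<le> (MA + 1) * norm (D t) + (MB + 1) * norm (D t)"
              by (intro add_mono mult_right_mono) auto
            then show ?thesis
              using norm_triangle_ineq[of "A (c y t) * D t" "B (c y t) * cnj (D t)"]
              by (simp add: norm_mult algebra_simps)
          qed
          have nW: "norm W \<le> norm h * e1 * (2 * Ms + 2 * MG)"
          proof -
            have "norm W \<le> norm rA * norm (s z t) + norm rB * norm (s z t) + norm EA * norm k * norm (G t) + norm EB * norm k * norm (G t)"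
              unfolding W_def by (intro norm_triangle_mono) (auto simp: norm_mult)
            also have "\<dots> \<le> (e1 * norm h) * Ms + (e1 * norm h) * Ms + e1 * norm h * MG + e1 * norm h * MG"
              using nr nE Ms MG nk e1 t by (intro add_mono mult_mono) auto
            finally show ?thesis by (simp add: algebra_simps)
          qed
          have "norm (D' t) \<le> norm (X + h) * norm (A (c y t) * D t + B (c y t) * cnj (D t)) + (norm h * norm k * norm (G1 t) + norm (X + h) * norm W)"
            unfolding D'eq by (intro norm_triangle_mono) (auto simp: norm_mult)
          also have "\<dots> \<le> (norm X + 1) * ((MA + MB + 2) * norm (D t)) + (norm h * e1 * M1 + (norm X + 1) * (norm h * e1 * (2 * Ms + 2 * MG)))"
            using nX n1 nW M1 t nk h r e1 by (intro add_mono mult_mono) auto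
          finally show "norm (D' t) \<le> K * norm (D t) + norm h * e1 * (M1 + L)"
            by (simp add: K_def L_def algebra_simps)
        next
          show "D 0 = 0" using s0[OF z] s0[OF yU] by (simp add: D_def)
        qed (use K0 e1 M1 in auto)
        also have "\<dots> = norm h * (e * ((M1 + L) / (M1 + L + 1)))"
          using K0 M1 by (simp add: e1_def)
        also have "\<dots> \<le> norm h * (e * 1)"
          using K0 M1 \<open>e > 0\<close> by (intro mult_left_mono) (auto simp: field_simps)
        finally show "norm (\<phi> y - \<phi> z - (A z * \<phi> z + B z * cnj (\<phi> z)) * (y - z)) \<le> e * norm (y - z)"
          by (simp add: D_def \<phi>_def G_def h_def c_def mult.commute)
      qed (use r in auto)
    qed
  qed
  ultimately show thesis using that by blast
qed

section \<open>The local form of a special Kaehler structure\<close>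

lemma smooth_on_const: "smooth_on M (\<lambda>_. c)"
proof -
  have "Ck_on k M (\<lambda>_. c)" for k and c :: 'a
    by (induction k arbitrary: c) simp_all
  then show ?thesis by (simp add: smooth_on_def)
qed

lemma nabla_const [simp]: "nabla \<Gamma> (\<lambda>_. u) (\<lambda>_. v) = (\<lambda>z. \<Gamma> z u v)"
  by (simp add: nabla_def dir_deriv_def fun_eq_iff)

lemma lie_bracket_const [simp]: "lie_bracket (\<lambda>_. u) (\<lambda>_. v) = (\<lambda>_. 0)"
  by (simp add: lie_bracket_def dir_deriv_def fun_eq_iff)

lemma complex_of_real_Re_Im:
  "of_real (Re x) = (x + cnj x) / 2" "of_real (Im x) = - \<i> * (x - cnj x) / 2"
  by (simp_all add: complex_eq_iff)

text \<open>
  The two coefficients are the Wirtinger derivatives when \<open>f\<close> is a Frechet derivative.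
\<close>

lemma real_linear_complex_decomposition:
  fixes f :: "complex \<Rightarrow> complex"
  assumes "linear f"
  shows "f h = (f 1 - \<i> * f \<i>) / 2 * h + (f 1 + \<i> * f \<i>) / 2 * cnj h"
proof -
  interpret linear f by fact
  have "f h = f (Re h *\<^sub>R 1 + Im h *\<^sub>R \<i>)"
    by (simp add: scaleR_conv_of_real mult.commute complex_eq[symmetric])
  also have "\<dots> = of_real (Re h) * f 1 + of_real (Im h) * f \<i>"
    by (simp only: add scale) (simp only: scaleR_conv_of_real)
  also have "of_real (Re h) = (h + cnj h) / 2" by (rule complex_of_real_Re_Im)
  also have "of_real (Im h) = - \<i> * (h - cnj h) / 2" by (rule complex_of_real_Re_Im)
  finally show ?thesis by (simp add: field_simps)
qed

lemma smooth_on_wirtinger: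
  fixes f :: "complex \<Rightarrow> complex"
  assumes "smooth_on M f"
  obtains P Q where "\<And>z. z \<in> M \<Longrightarrow> (f has_derivative (\<lambda>h. P z * h + Q z * cnj h)) (at z)"
    "continuous_on M P" "continuous_on M Q"
proof -
  have *: "Ck_on (Suc 0) M f" using assms unfolding smooth_on_def by blast
  define D where "D z = frechet_derivative f (at z)" for z
  have D: "(f has_derivative D z) (at z)" if "z \<in> M" for z
    using * that by (simp add: D_def frechet_derivative_works[symmetric])
  have c: "continuous_on M (\<lambda>z. D z v)" for v
    using * by (simp add: D_def)
  show thesis
  proof (rule that[of "\<lambda>z. (D z 1 - \<i> * D z \<i>) / 2" "\<lambda>z. (D z 1 + \<i> * D z \<i>) / 2"])
    fix z assume "z \<in> M"
    note d = D[OF this]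
    have "D z = (\<lambda>h. (D z 1 - \<i> * D z \<i>) / 2 * h + (D z 1 + \<i> * D z \<i>) / 2 * cnj h)"
      using real_linear_complex_decomposition[OF has_derivative_linear[OF d]] by (rule ext)
    with d show "(f has_derivative (\<lambda>h. (D z 1 - \<i> * D z \<i>) / 2 * h + (D z 1 + \<i> * D z \<i>) / 2 * cnj h)) (at z)"
      by simp
  qed (intro continuous_intros c; simp)+
qed

text \<open>
  Each condition is evaluated on constant vector fields. Vanishing torsion and the symmetry of
  \<open>\<nabla>I\<close> leave the two components \<open>a u v\<close> and \<open>cnj (b u v)\<close> of \<open>\<Gamma>(u, v)\<close>; flatness relates the
  antiholomorphic derivatives of \<open>a\<close> and \<open>b\<close> to \<open>a\<close> and \<open>b\<close> themselves; \<open>\<nabla>\<omega> = 0\<close> says that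
  \<open>dw = 2 w Re (a dz)\<close>.
\<close>

lemma special_kaehler_local_form:
  assumes M: "open M" and special: "special_kaehler_on M g \<Gamma>"
    and conformal: "\<And>z u v. z \<in> M \<Longrightarrow> g z u v = w z * (u \<bullet> v)"
  obtains a b a1 b1 where
    "\<And>z u v. z \<in> M \<Longrightarrow> \<Gamma> z u v = a z * u * v + cnj (b z * u * v)"
    "\<And>z. z \<in> M \<Longrightarrow> (a has_derivative (\<lambda>h. a1 z * h + - (b z * cnj (b z)) * cnj h)) (at z)"
    "\<And>z. z \<in> M \<Longrightarrow> (b has_derivative (\<lambda>h. b1 z * h + - (b z * cnj (a z)) * cnj h)) (at z)"
    "continuous_on M a1" "continuous_on M b1"
    "\<And>z. z \<in> M \<Longrightarrow> (w has_derivative (\<lambda>h. 2 * w z * Re (a z * h))) (at z)"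
    "\<And>z. z \<in> M \<Longrightarrow> w z > 0"
    "\<And>z. z \<in> M \<Longrightarrow> cubic_form g \<Gamma> z 1 1 1 = - (\<i> / 2) * w z * b z"
proof -
  note defs = special[unfolded special_kaehler_on_def kaehler_metric_on_def connection_on_def]
  have bil: "bilinear (\<Gamma> z)" if "z \<in> M" for z using defs that by blast
  have sm: "smooth_on M (\<lambda>z. \<Gamma> z u v)" for u v using defs by blast
  have smg: "smooth_on M (\<lambda>z. g z u v)" for u v
    using defs[THEN conjunct1, THEN conjunct1] by blast
  have sym: "\<Gamma> z u v = \<Gamma> z v u" if "z \<in> M" for z u v
  proof -
    have "torsion_free_on M \<Gamma>" using defs by blast
    then have "nabla \<Gamma> (\<lambda>_. u) (\<lambda>_. v) z - nabla \<Gamma> (\<lambda>_. v) (\<lambda>_. u) z = lie_bracket (\<lambda>_. u) (\<lambda>_. v) z"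
      unfolding torsion_free_on_def using that smooth_on_const by blast
    then show ?thesis by simp
  qed
  have nI: "nabla_I \<Gamma> X Y z = nabla_I \<Gamma> Y X z" if "smooth_on M X" "smooth_on M Y" "z \<in> M" for X Y z
    using defs that by blast
  have I: "\<Gamma> z \<i> \<i> = - \<Gamma> z 1 1" if z: "z \<in> M" for z
  proof -
    have "nabla_I \<Gamma> (\<lambda>_. 1) (\<lambda>_. \<i>) z = nabla_I \<Gamma> (\<lambda>_. \<i>) (\<lambda>_. 1) z"
      using nI[OF smooth_on_const smooth_on_const z] .
    then have "\<Gamma> z 1 (- 1) - \<i> * \<Gamma> z 1 \<i> = \<Gamma> z \<i> \<i> - \<i> * \<Gamma> z \<i> 1"
      by (simp add: nabla_I_def)
    then show ?thesis using sym[OF z, of 1 \<i>] bilinear_rneg[OF bil[OF z], of 1 1] by simp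
  qed
  define a where "a z = (\<Gamma> z 1 1 - \<i> * \<Gamma> z 1 \<i>) / 2" for z
  define b where "b z = cnj ((\<Gamma> z 1 1 + \<i> * \<Gamma> z 1 \<i>) / 2)" for z
  have \<Gamma>: "\<Gamma> z u v = a z * u * v + cnj (b z * u * v)" if z: "z \<in> M" for z u v
  proof -
    have ux: "x = Re x *\<^sub>R 1 + Im x *\<^sub>R \<i>" for x
      by (simp add: scaleR_conv_of_real mult.commute complex_eq[symmetric])
    have "\<Gamma> z u v = \<Gamma> z (Re u *\<^sub>R 1 + Im u *\<^sub>R \<i>) (Re v *\<^sub>R 1 + Im v *\<^sub>R \<i>)"
      using ux[of u] ux[of v] by simp
    also have "\<dots> = of_real (Re u * Re v) * \<Gamma> z 1 1 + of_real (Re u * Im v) * \<Gamma> z 1 \<i>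
        + of_real (Im u * Re v) * \<Gamma> z \<i> 1 + of_real (Im u * Im v) * \<Gamma> z \<i> \<i>"
      by (simp only: bilinear_ladd[OF bil[OF z]] bilinear_radd[OF bil[OF z]] bilinear_lmul[OF bil[OF z]]
            bilinear_rmul[OF bil[OF z]]) (simp add: scaleR_conv_of_real algebra_simps)
    also have "\<dots> = of_real (Re (u * v)) * \<Gamma> z 1 1 + of_real (Im (u * v)) * \<Gamma> z 1 \<i>"
      using I[OF z] sym[OF z, of \<i> 1] by (simp add: algebra_simps)
    also have "of_real (Re (u * v)) = (u * v + cnj (u * v)) / 2" by (rule complex_of_real_Re_Im)
    also have "of_real (Im (u * v)) = - \<i> * (u * v - cnj (u * v)) / 2" by (rule complex_of_real_Re_Im)
    finally show ?thesis by (simp add: a_def b_def field_simps)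
  qed
  obtain P Q where PQ: "\<And>z. z \<in> M \<Longrightarrow> ((\<lambda>z. \<Gamma> z 1 1) has_derivative (\<lambda>h. P z * h + Q z * cnj h)) (at z)"
    "continuous_on M P" "continuous_on M Q" using smooth_on_wirtinger[OF sm] by blast
  obtain R S where RS: "\<And>z. z \<in> M \<Longrightarrow> ((\<lambda>z. \<Gamma> z 1 \<i>) has_derivative (\<lambda>h. R z * h + S z * cnj h)) (at z)"
    "continuous_on M R" "continuous_on M S" using smooth_on_wirtinger[OF sm] by blast
  define a1 where "a1 z = (P z - \<i> * R z) / 2" for z
  define a2 where "a2 z = (Q z - \<i> * S z) / 2" for z
  define b1 where "b1 z = cnj ((Q z + \<i> * S z) / 2)" for z
  define b2 where "b2 z = cnj ((P z + \<i> * R z) / 2)" for z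
  have da: "(a has_derivative (\<lambda>h. a1 z * h + a2 z * cnj h)) (at z)" if z: "z \<in> M" for z
  proof -
    have "((\<lambda>z. \<Gamma> z 1 1 - \<i> * \<Gamma> z 1 \<i>) has_derivative
        (\<lambda>h. (P z * h + Q z * cnj h) - \<i> * (R z * h + S z * cnj h))) (at z)"
      by (intro derivative_intros PQ(1)[OF z] RS(1)[OF z])
    from bounded_linear.has_derivative[OF bounded_linear_divide[of 2] this]
    have "((\<lambda>z. (\<Gamma> z 1 1 - \<i> * \<Gamma> z 1 \<i>) / 2) has_derivative (\<lambda>h. a1 z * h + a2 z * cnj h)) (at z)"
      by (rule back_subst[of "\<lambda>D. (_ has_derivative D) (at z)"])
        (simp add: fun_eq_iff a1_def a2_def field_simps)
    then show ?thesis by (simp add: a_def[abs_def])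
  qed
  have db: "(b has_derivative (\<lambda>h. b1 z * h + b2 z * cnj h)) (at z)" if z: "z \<in> M" for z
  proof -
    have "((\<lambda>z. \<Gamma> z 1 1 + \<i> * \<Gamma> z 1 \<i>) has_derivative
        (\<lambda>h. (P z * h + Q z * cnj h) + \<i> * (R z * h + S z * cnj h))) (at z)"
      by (intro derivative_intros PQ(1)[OF z] RS(1)[OF z])
    from has_derivative_cnj[OF bounded_linear.has_derivative[OF bounded_linear_divide[of 2] this]]
    have "((\<lambda>z. cnj ((\<Gamma> z 1 1 + \<i> * \<Gamma> z 1 \<i>) / 2)) has_derivative (\<lambda>h. b1 z * h + b2 z * cnj h)) (at z)"
      by (rule back_subst[of "\<lambda>D. (_ has_derivative D) (at z)"])
        (simp add: fun_eq_iff b1_def b2_def field_simps)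
    then show ?thesis by (simp add: b_def[abs_def])
  qed
  have flat: "a2 z = - (b z * cnj (b z)) \<and> b2 z = - (b z * cnj (a z))" if z: "z \<in> M" for z
  proof -
    have fd: "frechet_derivative (\<lambda>z. \<Gamma> z u v) (at z) h =
        (a1 z * h + a2 z * cnj h) * u * v + cnj ((b1 z * h + b2 z * cnj h) * u * v)" for u v h
    proof -
      have "((\<lambda>z. a z * u * v + cnj (b z * u * v)) has_derivative
         (\<lambda>h. (a1 z * h + a2 z * cnj h) * u * v + cnj ((b1 z * h + b2 z * cnj h) * u * v))) (at z)"
        by (rule has_derivative_cnj derivative_eq_intros da[OF z] db[OF z] refl)+ (simp add: fun_eq_iff)
      then have "((\<lambda>z. \<Gamma> z u v) has_derivative
         (\<lambda>h. (a1 z * h + a2 z * cnj h) * u * v + cnj ((b1 z * h + b2 z * cnj h) * u * v))) (at z)"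
        by (rule has_derivative_transform_within_open[OF _ M z]) (simp add: \<Gamma>)
      then show ?thesis by (simp add: frechet_derivative_at[symmetric])
    qed
    \<comment> \<open>The curvature \<open>R(1, i) v\<close>.\<close>
    have eq: "2 * \<i> * v * (a2 z + b z * cnj (b z)) - 2 * \<i> * cnj v * cnj (b2 z + b z * cnj (a z)) = 0" for v
    proof -
      have "flat_on M \<Gamma>" using defs by blast
      then have "nabla \<Gamma> (\<lambda>_. 1) (nabla \<Gamma> (\<lambda>_. \<i>) (\<lambda>_. v)) z - nabla \<Gamma> (\<lambda>_. \<i>) (nabla \<Gamma> (\<lambda>_. 1) (\<lambda>_. v)) z
               - nabla \<Gamma> (lie_bracket (\<lambda>_. 1) (\<lambda>_. \<i>)) (\<lambda>_. v) z = 0"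
        unfolding flat_on_def using z smooth_on_const by blast
      then have "nabla \<Gamma> (\<lambda>_. 1) (\<lambda>z. \<Gamma> z \<i> v) z - nabla \<Gamma> (\<lambda>_. \<i>) (\<lambda>z. \<Gamma> z 1 v) z - \<Gamma> z 0 v = 0"
        by simp
      then show ?thesis
        unfolding nabla_def dir_deriv_def fd \<Gamma>[OF z] by (simp add: algebra_simps)
    qed
    have 1: "(a2 z + b z * cnj (b z)) - cnj (b2 z + b z * cnj (a z)) = 0"
      using eq[of 1] by (simp add: right_diff_distrib[symmetric] del: complex_cnj_add)
    have 2: "(a2 z + b z * cnj (b z)) + cnj (b2 z + b z * cnj (a z)) = 0"
      using eq[of \<i>] by (simp add: distrib_left[symmetric] del: complex_cnj_add)
    have "a2 z + b z * cnj (b z) = 0" "cnj (b2 z + b z * cnj (a z)) = 0"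
      using 1 2 by (simp_all del: complex_cnj_add) 
    then have "a2 z + b z * cnj (b z) = 0" "b2 z + b z * cnj (a z) = 0"
      by (simp_all only: complex_cnj_zero_iff)
    then show ?thesis by (simp add: eq_neg_iff_add_eq_0)
  qed
  have gw: "g z 1 1 = w z" if "z \<in> M" for z using conformal[OF that] by simp
  have dw: "(w has_derivative (\<lambda>h. 2 * w z * Re (a z * h))) (at z)" if z: "z \<in> M" for z
  proof -
    have "Ck_on (Suc 0) M (\<lambda>z. g z 1 1)" using smg[of 1 1] unfolding smooth_on_def by blast
    then have "(\<lambda>z. g z 1 1) differentiable (at z)" using z by simp
    then obtain D where "((\<lambda>z. g z 1 1) has_derivative D) (at z)" by (auto simp: differentiable_def)
    then have D: "(w has_derivative D) (at z)"
      by (rule has_derivative_transform_within_open[OF _ M z]) (simp add: gw)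
    then have D': "((\<lambda>p. kaehler_form g p 1 \<i>) has_derivative D) (at z)"
      by (rule has_derivative_transform_within_open[OF _ M z]) (simp add: conformal kaehler_form_def)
    have "D h = 2 * w z * Re (a z * h)" for h
    proof -
      have "symplectic_on M g \<Gamma>" using defs by blast
      then have "dir_deriv (\<lambda>_. h) (\<lambda>p. kaehler_form g p 1 \<i>) z =
                 kaehler_form g z (nabla \<Gamma> (\<lambda>_. h) (\<lambda>_. 1) z) \<i> +
                 kaehler_form g z 1 (nabla \<Gamma> (\<lambda>_. h) (\<lambda>_. \<i>) z)"
        unfolding symplectic_on_def using z smooth_on_const[of M h] smooth_on_const[of M 1] smooth_on_const[of M \<i>] by blast
      then have "D h = w z * ((\<i> * \<Gamma> z h 1) \<bullet> \<i> + \<i> \<bullet> \<Gamma> z h \<i>)"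
        unfolding dir_deriv_def frechet_derivative_at[OF D', symmetric]
        by (simp add: kaehler_form_def conformal[OF z] distrib_left)
      then show ?thesis by (simp add: \<Gamma>[OF z] inner_complex_def algebra_simps)
    qed
    then have "D = (\<lambda>h. 2 * w z * Re (a z * h))" by (rule ext)
    with D show ?thesis by simp
  qed
  have w_pos: "w z > 0" if z: "z \<in> M" for z
  proof -
    have "g z 1 1 > 0" using defs z by (metis one_neq_zero)
    then show ?thesis by (simp add: gw z)
  qed
  have cub: "cubic_form g \<Gamma> z 1 1 1 = - (\<i> / 2) * w z * b z" if z: "z \<in> M" for z
    by (simp add: cubic_form_def kaehler_form_C_def proj10_def nabla_proj10_def nabla_C_def kaehler_form_def
        conformal[OF z] \<Gamma>[OF z] inner_complex_def complex_eq_iff field_simps)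
  show thesis
  proof (rule that)
    show "continuous_on M a1" "continuous_on M b1"
      unfolding a1_def b1_def by (intro continuous_intros PQ RS; simp)+
  qed (use \<Gamma> da db flat dw w_pos cub in auto)
qed

section \<open>Parallel one-forms on the left half-plane\<close>

definition half_plane :: "complex set" where
  "half_plane = {\<xi>. Re \<xi> < 0}"

lemma open_half_plane: "open half_plane"
  by (simp add: half_plane_def open_halfspace_Re_lt)

lemma convex_half_plane: "convex half_plane"
  by (simp add: half_plane_def convex_halfspace_Re_lt)

lemma open_punctured_disc: "open punctured_disc"
proof -
  have "punctured_disc = ball 0 1 - {0}" by (auto simp: punctured_disc_def)
  then show ?thesis using open_delete[OF open_ball[of "0::complex" 1], of 0] by simp
qed

lemma exp_in_punctured_disc: "exp \<xi> \<in> punctured_disc \<longleftrightarrow> \<xi> \<in> half_plane"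
  by (simp add: punctured_disc_def half_plane_def)

abbreviation deck :: "complex \<Rightarrow> complex" where
  "deck \<xi> \<equiv> \<xi> + 2 * of_real pi * \<i>"

lemma shift_in_half_plane: "deck \<xi> \<in> half_plane \<longleftrightarrow> \<xi> \<in> half_plane"
  by (simp add: half_plane_def)

lemma exp_shift: "exp (deck \<xi>) = exp \<xi>"
  by (simp add: exp_add)

text \<open>
  The equation says that the multivalued one-form \<open>Re (\<phi> dz)\<close> is parallel. The function \<open>\<phi>\<close> depends on
  \<open>\<xi> = log z\<close> but stays the coefficient of \<open>dz\<close>, so the chain rule contributes the factor \<open>exp \<xi>\<close>.
\<close>

definition flat_form :: "(complex \<Rightarrow> complex) \<Rightarrow> (complex \<Rightarrow> complex) \<Rightarrow> (complex \<Rightarrow> complex) \<Rightarrow> bool" where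
  "flat_form a b \<phi> \<longleftrightarrow> (\<forall>\<xi>\<in>half_plane. (\<phi> has_field_derivative
      exp \<xi> * (a (exp \<xi>) * \<phi> \<xi> + b (exp \<xi>) * cnj (\<phi> \<xi>))) (at \<xi>))"

text \<open>
  The pullbacks \<open>exp \<xi> a (exp \<xi>)\<close> and \<open>exp \<xi> b (exp \<xi>)\<close> satisfy the same integrability
  conditions as \<open>a\<close> and \<open>b\<close>.
\<close>

lemma flat_form_exists:
  assumes da: "\<And>z. z \<in> punctured_disc \<Longrightarrow> (a has_derivative (\<lambda>h. a1 z * h + - (b z * cnj (b z)) * cnj h)) (at z)"
    and db: "\<And>z. z \<in> punctured_disc \<Longrightarrow> (b has_derivative (\<lambda>h. b1 z * h + - (b z * cnj (a z)) * cnj h)) (at z)"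
    and c: "continuous_on punctured_disc a1" "continuous_on punctured_disc b1"
    and p: "p \<in> half_plane"
  obtains \<phi> where "\<phi> p = \<alpha>" "flat_form a b \<phi>"
proof -
  define A where "A = (\<lambda>\<xi>. exp \<xi> * a (exp \<xi>))"
  define B where "B = (\<lambda>\<xi>. exp \<xi> * b (exp \<xi>))"
  have e: "(exp has_derivative (\<lambda>h. exp \<xi> * h)) (at \<xi>)" for \<xi> :: complex
    using DERIV_exp[of \<xi>] by (simp add: has_field_derivative_def)
  obtain \<phi> where "\<phi> p = \<alpha>" "\<And>z. z \<in> half_plane \<Longrightarrow> (\<phi> has_field_derivative A z * \<phi> z + B z * cnj (\<phi> z)) (at z)"
  proof (rule flat_section_exists[OF open_half_plane convex_half_plane p])
    fix \<xi> assume \<xi>: "\<xi> \<in> half_plane"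
    then have z: "exp \<xi> \<in> punctured_disc" by (simp add: exp_in_punctured_disc)
    show "(A has_derivative (\<lambda>h. (A \<xi> + exp \<xi> * exp \<xi> * a1 (exp \<xi>)) * h + - (B \<xi> * cnj (B \<xi>)) * cnj h)) (at \<xi>)"
      unfolding A_def
      by (rule derivative_eq_intros e has_derivative_compose[OF e da[OF z]] refl)+
        (simp add: fun_eq_iff B_def algebra_simps exp_cnj)
    show "(B has_derivative (\<lambda>h. (B \<xi> + exp \<xi> * exp \<xi> * b1 (exp \<xi>)) * h + - (B \<xi> * cnj (A \<xi>)) * cnj h)) (at \<xi>)"
      unfolding B_def
      by (rule derivative_eq_intros e has_derivative_compose[OF e db[OF z]] refl)+
        (simp add: fun_eq_iff A_def algebra_simps exp_cnj)
  next
    have ca: "continuous_on punctured_disc a"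
      by (intro continuous_at_imp_continuous_on ballI has_derivative_continuous[OF da])
    have cb: "continuous_on punctured_disc b"
      by (intro continuous_at_imp_continuous_on ballI has_derivative_continuous[OF db])
    have cexp: "continuous_on half_plane (\<lambda>\<xi>. F (exp \<xi>))" if "continuous_on punctured_disc F" for F :: "complex \<Rightarrow> complex"
      by (rule continuous_on_compose2[OF that]) (auto intro!: continuous_intros simp: exp_in_punctured_disc)
    show "continuous_on half_plane (\<lambda>\<xi>. A \<xi> + exp \<xi> * exp \<xi> * a1 (exp \<xi>))"
      "continuous_on half_plane (\<lambda>\<xi>. B \<xi> + exp \<xi> * exp \<xi> * b1 (exp \<xi>))"
      unfolding A_def B_def by (intro continuous_intros cexp c ca cb)+
  qed blast
  then show thesis
    by (intro that[of \<phi>]) (simp_all add: flat_form_def A_def B_def algebra_simps)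
qed

lemma flat_form_combination:
  assumes "flat_form a b \<phi>" "flat_form a b \<psi>"
  shows "flat_form a b (\<lambda>\<xi>. of_real x * \<phi> \<xi> + of_real y * \<psi> \<xi>)"
  unfolding flat_form_def
proof
  fix \<xi> assume "\<xi> \<in> half_plane"
  then have d: "(\<phi> has_field_derivative exp \<xi> * (a (exp \<xi>) * \<phi> \<xi> + b (exp \<xi>) * cnj (\<phi> \<xi>))) (at \<xi>)"
    "(\<psi> has_field_derivative exp \<xi> * (a (exp \<xi>) * \<psi> \<xi> + b (exp \<xi>) * cnj (\<psi> \<xi>))) (at \<xi>)"
    using assms by (auto simp: flat_form_def)
  show "((\<lambda>\<xi>. of_real x * \<phi> \<xi> + of_real y * \<psi> \<xi>) has_field_derivative
      exp \<xi> * (a (exp \<xi>) * (of_real x * \<phi> \<xi> + of_real y * \<psi> \<xi>) +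
        b (exp \<xi>) * cnj (of_real x * \<phi> \<xi> + of_real y * \<psi> \<xi>))) (at \<xi>)"
    by (rule derivative_eq_intros d refl)+ (simp add: algebra_simps)
qed

lemma flat_form_shift:
  assumes "flat_form a b \<phi>"
  shows "flat_form a b (\<lambda>\<xi>. \<phi> (deck \<xi>))"
  unfolding flat_form_def
proof
  fix \<xi> assume "\<xi> \<in> half_plane"
  then have "(\<phi> has_field_derivative exp \<xi> * (a (exp \<xi>) * \<phi> (deck \<xi>)
      + b (exp \<xi>) * cnj (\<phi> (deck \<xi>)))) (at (deck \<xi>))"
    using assms shift_in_half_plane exp_shift unfolding flat_form_def by metis
  then show "((\<lambda>\<xi>. \<phi> (deck \<xi>)) has_field_derivative exp \<xi> * (a (exp \<xi>) * \<phi> (deck \<xi>)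
      + b (exp \<xi>) * cnj (\<phi> (deck \<xi>)))) (at \<xi>)"
    by (subst (asm) DERIV_shift)
qed

text \<open>
  The wedge product of two parallel one-forms is a parallel two-form, hence a constant multiple
  of \<open>\<omega>\<close>: both \<open>Im (cnj \<phi> \<psi>)\<close> and \<open>w\<close> have the logarithmic derivative \<open>2 Re (a dz)\<close>.
\<close>

lemma flat_forms_area_constant:
  assumes dw: "\<And>z. z \<in> punctured_disc \<Longrightarrow> (w has_derivative (\<lambda>h. 2 * w z * Re (a z * h))) (at z)"
    and w: "\<And>z. z \<in> punctured_disc \<Longrightarrow> w z > 0"
    and \<phi>: "flat_form a b \<phi>" and \<psi>: "flat_form a b \<psi>"
  obtains c where "\<And>\<xi>. \<xi> \<in> half_plane \<Longrightarrow> Im (cnj (\<phi> \<xi>) * \<psi> \<xi>) = c * w (exp \<xi>)"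
proof -
  define f where "f = (\<lambda>\<xi>. Im (cnj (\<phi> \<xi>) * \<psi> \<xi>) / w (exp \<xi>))"
  have "(f has_derivative (\<lambda>h. 0)) (at \<xi> within half_plane)" if \<xi>: "\<xi> \<in> half_plane" for \<xi>
  proof -
    have z: "exp \<xi> \<in> punctured_disc" using \<xi> by (simp add: exp_in_punctured_disc)
    have e: "(exp has_derivative (\<lambda>h. exp \<xi> * h)) (at \<xi>)"
      using DERIV_exp[of \<xi>] by (simp add: has_field_derivative_def)
    have d: "(\<phi> has_derivative (\<lambda>h. exp \<xi> * (a (exp \<xi>) * \<phi> \<xi> + b (exp \<xi>) * cnj (\<phi> \<xi>)) * h)) (at \<xi>)"
      "(\<psi> has_derivative (\<lambda>h. exp \<xi> * (a (exp \<xi>) * \<psi> \<xi> + b (exp \<xi>) * cnj (\<psi> \<xi>)) * h)) (at \<xi>)"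
      using \<phi> \<psi> \<xi> by (auto simp: flat_form_def has_field_derivative_def)
    have dwe: "((\<lambda>\<xi>. w (exp \<xi>)) has_derivative (\<lambda>h. 2 * w (exp \<xi>) * Re (a (exp \<xi>) * (exp \<xi> * h)))) (at \<xi>)"
      by (rule has_derivative_compose[OF e dw[OF z]])
    have "((\<lambda>\<xi>. cnj (\<phi> \<xi>) * \<psi> \<xi>) has_derivative
        (\<lambda>h. cnj (\<phi> \<xi>) * (exp \<xi> * (a (exp \<xi>) * \<psi> \<xi> + b (exp \<xi>) * cnj (\<psi> \<xi>)) * h) +
          cnj (exp \<xi> * (a (exp \<xi>) * \<phi> \<xi> + b (exp \<xi>) * cnj (\<phi> \<xi>)) * h) * \<psi> \<xi>)) (at \<xi>)"
      by (intro has_derivative_mult has_derivative_cnj d)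
    from bounded_linear.has_derivative[OF bounded_linear_Im this]
    have dI: "((\<lambda>\<xi>. Im (cnj (\<phi> \<xi>) * \<psi> \<xi>)) has_derivative
        (\<lambda>h. 2 * Im (cnj (\<phi> \<xi>) * \<psi> \<xi>) * Re (a (exp \<xi>) * (exp \<xi> * h)))) (at \<xi>)"
      by (rule back_subst[of "\<lambda>D. (_ has_derivative D) (at \<xi>)"]) (simp add: fun_eq_iff algebra_simps)
    have "w (exp \<xi>) \<noteq> 0" using w[OF z] by simp
    have zero: "(2 * i * r * v - i * (2 * v * r)) / (v * v) = 0" for i r v :: real
      by simp
    show ?thesis
      using has_derivative_divide'[OF dI dwe \<open>w (exp \<xi>) \<noteq> 0\<close>]
      unfolding f_def zero by (rule has_derivative_at_withinI)
  qed
  then obtain c where c: "\<And>\<xi>. \<xi> \<in> half_plane \<Longrightarrow> f \<xi> = c"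
    using has_derivative_zero_constant[OF convex_half_plane, of f] by blast
  show thesis
  proof (rule that[of c])
    fix \<xi> assume \<xi>: "\<xi> \<in> half_plane"
    then have "w (exp \<xi>) > 0" using w by (simp add: exp_in_punctured_disc)
    then have nz: "w (exp \<xi>) \<noteq> 0" by simp
    show "Im (cnj (\<phi> \<xi>) * \<psi> \<xi>) = c * w (exp \<xi>)"
      using c[OF \<xi>] unfolding f_def nonzero_divide_eq_eq[OF nz] .
  qed
qed

text \<open>
  Cramer's rule for a vector \<open>u\<close> that is known through its pairings with two covectors \<open>x\<close> and \<open>y\<close>.
\<close>

lemma complex_dual_basis:
  "of_real (Im (cnj x * y)) * u = \<i> * (of_real (Re (x * u)) * cnj y - of_real (Re (y * u)) * cnj x)"
  by (simp add: complex_eq_iff) (simp add: algebra_simps)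

lemma complex_dual_basis_eqI:
  assumes "Im (cnj x * y) \<noteq> 0" "Re (x * u) = Re (x * v)" "Re (y * u) = Re (y * v)"
  shows "u = v"
proof -
  have "of_real (Im (cnj x * y)) * u = of_real (Im (cnj x * y)) * v"
    by (simp only: complex_dual_basis assms(2,3))
  then show ?thesis using assms(1) by (simp only: mult_cancel_left of_real_eq_0_iff) blast
qed

text \<open>
  Cramer's rule for the expansion of \<open>u\<close> in the real basis \<open>x, y\<close>.
\<close>

lemma complex_dual_basis_form:
  "of_real (Im (cnj x * y)) * u = of_real (Im (cnj u * y)) * x - of_real (Im (cnj u * x)) * y"
  by (simp add: complex_eq_iff algebra_simps)

text \<open>
  By Cramer's rule the coefficients are quotients of areas of parallel one-forms, and these are
  constant.
\<close>

lemma flat_form_in_span: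
  assumes dw: "\<And>z. z \<in> punctured_disc \<Longrightarrow> (w has_derivative (\<lambda>h. 2 * w z * Re (a z * h))) (at z)"
    and w: "\<And>z. z \<in> punctured_disc \<Longrightarrow> w z > 0"
    and flat: "flat_form a b \<phi>" "flat_form a b \<psi>" "flat_form a b \<eta>"
    and area: "\<And>\<xi>. \<xi> \<in> half_plane \<Longrightarrow> Im (cnj (\<phi> \<xi>) * \<psi> \<xi>) = w (exp \<xi>)"
  obtains x y :: real where
    "\<And>\<xi>. \<xi> \<in> half_plane \<Longrightarrow> \<eta> \<xi> = of_real x * \<phi> \<xi> + of_real y * \<psi> \<xi>"
proof -
  obtain x where x: "\<And>\<xi>. \<xi> \<in> half_plane \<Longrightarrow> Im (cnj (\<eta> \<xi>) * \<psi> \<xi>) = x * w (exp \<xi>)"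
    using flat_forms_area_constant[OF dw w flat(3,2)] by blast
  obtain y where y: "\<And>\<xi>. \<xi> \<in> half_plane \<Longrightarrow> Im (cnj (\<eta> \<xi>) * \<phi> \<xi>) = y * w (exp \<xi>)"
    using flat_forms_area_constant[OF dw w flat(3,1)] by blast
  show thesis
  proof (rule that[of x "- y"])
    fix \<xi> assume \<xi>: "\<xi> \<in> half_plane"
    have "of_real (w (exp \<xi>)) * \<eta> \<xi> = of_real (w (exp \<xi>)) * (of_real x * \<phi> \<xi> + of_real (- y) * \<psi> \<xi>)"
      using complex_dual_basis_form[of "\<phi> \<xi>" "\<psi> \<xi>" "\<eta> \<xi>"]
      unfolding x[OF \<xi>] y[OF \<xi>] area[OF \<xi>] by (simp add: algebra_simps)
    then show "\<eta> \<xi> = of_real x * \<phi> \<xi> + of_real (- y) * \<psi> \<xi>"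
      using w[of "exp \<xi>"] \<xi> by (simp add: exp_in_punctured_disc)
  qed
qed

section \<open>Parallel transport along a loop\<close>

text \<open>
  Near \<open>t\<close> the lift differs by a constant from the principal logarithm of \<open>\<gamma> s / \<gamma> t\<close>.
\<close>

lemma log_lift_has_vector_derivative:
  fixes q :: "real \<Rightarrow> complex"
  assumes "continuous (at t) q" and "\<forall>\<^sub>F s in at t. \<gamma> s = exp (q s)" and "\<gamma> t = exp (q t)"
    and "(\<gamma> has_vector_derivative d) (at t)"
  shows "(q has_vector_derivative d / \<gamma> t) (at t)"
proof -
  have "(q \<longlongrightarrow> q t) (at t)" using assms(1) by (simp add: continuous_at)
  then have "\<forall>\<^sub>F s in at t. dist (q s) (q t) < pi" by (rule tendstoD) simp
  then have ev: "\<forall>\<^sub>F s in at t. q t + Ln (\<gamma> s / \<gamma> t) = q s"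
    using assms(2)
  proof eventually_elim
    case (elim s)
    have "\<bar>Im (q s - q t)\<bar> < pi"
      using elim(1) abs_Im_le_cmod[of "q s - q t"] by (simp add: dist_norm)
    then have "Ln (exp (q s - q t)) = q s - q t" by (intro Ln_exp) auto
    then show ?case using elim(2) assms(3) by (simp add: exp_diff)
  qed
  have nz: "\<gamma> t \<noteq> 0" using assms(3) by simp
  have "((\<lambda>z. Ln (z / \<gamma> t)) has_field_derivative 1 / \<gamma> t) (at (\<gamma> t))"
    using nz by (auto intro!: derivative_eq_intros)
  from field_vector_diff_chain_at[OF assms(4) this]
  have "((\<lambda>s. q t + Ln (\<gamma> s / \<gamma> t)) has_vector_derivative d / \<gamma> t) (at t)"
    by (auto intro!: derivative_eq_intros simp: o_def)
  then show ?thesis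
    unfolding has_vector_derivative_def
    by (rule has_derivative_transform_eventually[OF _ ev]) (simp_all add: nz)
qed

lemma flat_form_along_lift:
  assumes \<phi>: "flat_form a b \<phi>" and "q t \<in> half_plane" and "\<gamma> t = exp (q t)"
    and "(q has_vector_derivative d / \<gamma> t) (at t)"
  shows "((\<lambda>t. \<phi> (q t)) has_vector_derivative (a (\<gamma> t) * \<phi> (q t) + b (\<gamma> t) * cnj (\<phi> (q t))) * d) (at t)"
proof -
  have "(\<phi> has_field_derivative \<gamma> t * (a (\<gamma> t) * \<phi> (q t) + b (\<gamma> t) * cnj (\<phi> (q t)))) (at (q t))"
    using \<phi> assms(2,3) by (simp add: flat_form_def)
  from field_vector_diff_chain_at[OF assms(4) this]
  show ?thesis using assms(3) by (simp add: o_def mult.commute)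
qed

text \<open>
  The derivative of the pairing \<open>Re (\<phi> V)\<close> of a parallel one-form with a parallel vector field.
\<close>

lemma pairing_derivative_zero:
  "Re (n * - (\<alpha> * d * v + cnj (\<beta> * d * v)) + (\<alpha> * n + \<beta> * cnj n) * d * v) = 0"
proof -
  define X where "X = n * cnj (\<beta> * d * v)"
  have "n * - (\<alpha> * d * v + cnj (\<beta> * d * v)) + (\<alpha> * n + \<beta> * cnj n) * d * v = cnj X - X"
    by (simp add: X_def algebra_simps)
  then show ?thesis by simp
qed

text \<open>
  If \<open>n\<close> satisfies the equation of a parallel one-form, the quotient \<open>i cnj n / w\<close> satisfies that of a
  parallel vector field; this is the algebra behind the derivative of the quotient.
\<close>

lemma dual_field_derivative:
  fixes w h :: real
  assumes "w \<noteq> 0"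
  shows "(\<i> * cnj (of_real h * ((\<alpha> * n + \<beta> * cnj n) * d)) * of_real w
      - \<i> * cnj n * of_real (2 * w * Re (\<alpha> * (of_real h * d)))) / (of_real w * of_real w)
    = of_real h * - (\<alpha> * d * (\<i> * cnj n / of_real w) + cnj (\<beta> * d * (\<i> * cnj n / of_real w)))"
proof -
  have "complex_of_real (2 * w * Re (\<alpha> * (of_real h * d)))
      = of_real w * (\<alpha> * (of_real h * d) + cnj (\<alpha> * (of_real h * d)))"
    unfolding complex_add_cnj by simp
  then have "\<i> * cnj (of_real h * ((\<alpha> * n + \<beta> * cnj n) * d)) * of_real w
      - \<i> * cnj n * of_real (2 * w * Re (\<alpha> * (of_real h * d)))
    = of_real w * (of_real h * - (\<alpha> * d * (\<i> * cnj n) + cnj (\<beta> * d * (\<i> * cnj n))))"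
    by (simp only:) (simp add: algebra_simps)
  then show ?thesis by (simp only:) (use assms in \<open>simp add: field_simps\<close>)
qed

text \<open>
  The pairing of a parallel vector field with a parallel one-form is constant along the lifted path.
  Two independent one-forms separate vectors, so a parallel field is determined by its initial
  value. Conversely the field \<open>V\<close> that has constant pairings with \<open>\<phi>\<close> and \<open>\<psi>\<close> is given by Cramer's
  rule and is parallel. So the description in the definition of parallel transport has a unique
  solution, which is the value of \<open>V\<close> at the end of the path.
\<close>

lemma parallel_transport_preserves_flat_forms:
  assumes \<Gamma>: "\<And>z u v. z \<in> punctured_disc \<Longrightarrow> \<Gamma> z u v = a z * u * v + cnj (b z * u * v)"
    and dw: "\<And>z. z \<in> punctured_disc \<Longrightarrow> (w has_derivative (\<lambda>h. 2 * w z * Re (a z * h))) (at z)"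
    and w: "\<And>z. z \<in> punctured_disc \<Longrightarrow> w z > 0"
    and flat: "flat_form a b \<phi>" "flat_form a b \<psi>"
    and area: "\<And>\<xi>. \<xi> \<in> half_plane \<Longrightarrow> Im (cnj (\<phi> \<xi>) * \<psi> \<xi>) = w (exp \<xi>)"
    and \<gamma>: "valid_path \<gamma>" "path_image \<gamma> \<subseteq> punctured_disc"
    and q: "path q" "\<And>t. t \<in> {0..1} \<Longrightarrow> \<gamma> t = exp (q t)"
  shows "Re (\<phi> (q 1) * parallel_transport \<Gamma> \<gamma> v) = Re (\<phi> (q 0) * v)"
    "Re (\<psi> (q 1) * parallel_transport \<Gamma> \<gamma> v) = Re (\<psi> (q 0) * v)"
proof -
  have qc: "continuous_on {0..1} q" using q(1) by (simp add: path_def)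
  have \<gamma>M: "\<gamma> t \<in> punctured_disc" if "t \<in> {0..1}" for t
    using \<gamma>(2) that by (auto simp: path_image_def)
  have qH: "q t \<in> half_plane" if "t \<in> {0..1}" for t
    using \<gamma>M[OF that] q(2)[OF that] exp_in_punctured_disc by metis
  have flat_cont: "continuous_on {0..1} (\<lambda>t. \<eta> (q t))" if "flat_form a b \<eta>" for \<eta>
  proof (rule continuous_on_compose2[OF _ qc])
    show "continuous_on half_plane \<eta>"
      using that unfolding flat_form_def
      by (intro continuous_at_imp_continuous_on ballI) (blast intro: DERIV_isCont)
  qed (use qH in auto)
  have dq: "(q has_vector_derivative d / \<gamma> t) (at t)"
    if t: "t \<in> {0<..<1}" and d: "(\<gamma> has_vector_derivative d) (at t)" for t d
  proof (rule log_lift_has_vector_derivative[OF _ _ _ d])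
    show "continuous (at t) q"
      using continuous_on_interior[OF qc, of t] t by simp
    show "\<forall>\<^sub>F s in at t. \<gamma> s = exp (q s)"
      using eventually_at_in_open'[of "{0<..<1}" t] t q(2) by (auto elim!: eventually_mono)
  qed (use q(2) t in auto)
  have const: "Re (\<eta> (q 1) * V 1) = Re (\<eta> (q 0) * V 0)"
    if \<eta>: "flat_form a b \<eta>" and V: "parallel_along \<Gamma> \<gamma> V" for \<eta> V
  proof -
    obtain S where S: "finite S" and cV: "continuous_on {0..1} V"
      and dV: "\<And>t. t \<in> {0..1} - S \<Longrightarrow> \<gamma> differentiable (at t) \<and>
        (V has_vector_derivative - \<Gamma> (\<gamma> t) (vector_derivative \<gamma> (at t)) (V t)) (at t)"
      using V unfolding parallel_along_def by blast
    show ?thesis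
    proof (rule has_derivative_zero_unique_strong_interval[of "insert 0 (insert 1 S)" 0 1
          "\<lambda>t. Re (\<eta> (q t) * V t)"])
      show "continuous_on {0..1} (\<lambda>t. Re (\<eta> (q t) * V t))"
        by (intro continuous_intros flat_cont \<eta> cV)
      fix t :: real assume t: "t \<in> {0..1} - insert 0 (insert 1 S)"
      then have t': "t \<in> {0<..<1}" "t \<in> {0..1} - S" "t \<in> {0..1}" by auto
      define d where "d = vector_derivative \<gamma> (at t)"
      have d: "(\<gamma> has_vector_derivative d) (at t)"
        using dV[OF t'(2)] vector_derivative_works by (auto simp: d_def)
      have d1: "((\<lambda>t. \<eta> (q t)) has_vector_derivative (a (\<gamma> t) * \<eta> (q t) + b (\<gamma> t) * cnj (\<eta> (q t))) * d) (at t)"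
        by (rule flat_form_along_lift[where \<gamma>=\<gamma> and q=q and t=t and d=d, OF \<eta> qH[OF t'(3)] q(2)[OF t'(3)] dq[OF t'(1) d]])
      have d2: "(V has_vector_derivative - (a (\<gamma> t) * d * V t + cnj (b (\<gamma> t) * d * V t))) (at t)"
        using dV[OF t'(2)] by (simp add: \<Gamma>[OF \<gamma>M[OF t'(3)]] d_def)
      have "((\<lambda>t. Re (\<eta> (q t) * V t)) has_vector_derivative
          Re (\<eta> (q t) * - (a (\<gamma> t) * d * V t + cnj (b (\<gamma> t) * d * V t))
            + (a (\<gamma> t) * \<eta> (q t) + b (\<gamma> t) * cnj (\<eta> (q t))) * d * V t)) (at t)"
        by (rule bounded_linear.has_vector_derivative[OF bounded_linear_Re has_vector_derivative_mult[OF d1 d2]])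
      then have "((\<lambda>t. Re (\<eta> (q t) * V t)) has_vector_derivative 0) (at t)"
        by (simp only: pairing_derivative_zero)
      then show "((\<lambda>t. Re (\<eta> (q t) * V t)) has_derivative (\<lambda>h. 0)) (at t within {0..1})"
        unfolding has_vector_derivative_def scaleR_zero_right by (rule has_derivative_at_withinI)
    qed (use S in auto)
  qed
  define c1 where "c1 = Re (\<phi> (q 0) * v)"
  define c2 where "c2 = Re (\<psi> (q 0) * v)"
  define N where "N = (\<lambda>\<xi>. of_real (- c2) * \<phi> \<xi> + of_real c1 * \<psi> \<xi>)"
  have N: "flat_form a b N" unfolding N_def by (rule flat_form_combination[OF flat])
  define V where "V = (\<lambda>t. \<i> * cnj (N (q t)) / of_real (w (\<gamma> t)))"
  have V0: "V 0 = v"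
  proof -
    have "q 0 \<in> half_plane" "\<gamma> 0 = exp (q 0)" using qH q(2) by simp_all
    note area0 = area[OF this(1), folded this(2)]
    have "of_real (w (\<gamma> 0)) * v = \<i> * (of_real c1 * cnj (\<psi> (q 0)) - of_real c2 * cnj (\<phi> (q 0)))"
      unfolding area0[symmetric] c1_def c2_def by (rule complex_dual_basis)
    also have "\<dots> = \<i> * cnj (N (q 0))" by (simp add: N_def)
    finally have "of_real (w (\<gamma> 0)) * v = \<i> * cnj (N (q 0))" .
    then show ?thesis using w[OF \<gamma>M[of 0]] by (simp add: V_def field_simps)
  qed
  have wc: "continuous_on punctured_disc w"
    by (intro continuous_at_imp_continuous_on ballI has_derivative_continuous[OF dw])
  have par: "parallel_along \<Gamma> \<gamma> V"
  proof -
    obtain S where S: "finite S" "\<gamma> C1_differentiable_on ({0..1} - S)" and \<gamma>c: "continuous_on {0..1} \<gamma>"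
      using \<gamma>(1) by (auto simp: valid_path_def piecewise_C1_differentiable_on_def)
    have "continuous_on {0..1} (\<lambda>t. w (\<gamma> t))"
      by (rule continuous_on_compose2[OF wc \<gamma>c]) (use \<gamma>M in auto)
    then have "continuous_on {0..1} V"
      unfolding V_def using w[OF \<gamma>M] by (intro continuous_intros flat_cont N) force+
    moreover have "\<gamma> differentiable (at t) \<and> (V has_vector_derivative - \<Gamma> (\<gamma> t) (vector_derivative \<gamma> (at t)) (V t)) (at t)"
      if t: "t \<in> {0..1} - insert 0 (insert 1 S)" for t
    proof -
      have t': "t \<in> {0<..<1}" "t \<in> {0..1}" using t by auto
      define d where "d = vector_derivative \<gamma> (at t)"
      have diff: "\<gamma> differentiable (at t)" using S(2) t by (auto simp: C1_differentiable_on_eq)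
      then have d: "(\<gamma> has_vector_derivative d) (at t)"
        using vector_derivative_works by (auto simp: d_def)
      have w0: "w (\<gamma> t) \<noteq> 0" using w[OF \<gamma>M[OF t'(2)]] by simp
      have d1: "((\<lambda>t. N (q t)) has_vector_derivative (a (\<gamma> t) * N (q t) + b (\<gamma> t) * cnj (N (q t))) * d) (at t)"
        by (rule flat_form_along_lift[where \<gamma>=\<gamma> and q=q and t=t and d=d, OF N qH[OF t'(2)] q(2)[OF t'(2)] dq[OF t'(1) d]])
      have dwt: "((\<lambda>t. w (\<gamma> t)) has_derivative (\<lambda>h. 2 * w (\<gamma> t) * Re (a (\<gamma> t) * (h *\<^sub>R d)))) (at t)"
        by (rule has_derivative_compose[OF d[unfolded has_vector_derivative_def] dw[OF \<gamma>M[OF t'(2)]]])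
      have "(V has_derivative (\<lambda>h. h *\<^sub>R (- \<Gamma> (\<gamma> t) d (V t)))) (at t)"
      proof -
        have "((\<lambda>t. cnj (N (q t))) has_derivative
            (\<lambda>h. cnj (h *\<^sub>R ((a (\<gamma> t) * N (q t) + b (\<gamma> t) * cnj (N (q t))) * d)))) (at t)"
          by (rule has_derivative_cnj[OF d1[unfolded has_vector_derivative_def]])
        from bounded_linear.has_derivative[OF bounded_linear_mult_right[of \<i>] this]
        have dn: "((\<lambda>t. \<i> * cnj (N (q t))) has_derivative
            (\<lambda>h. \<i> * cnj (h *\<^sub>R ((a (\<gamma> t) * N (q t) + b (\<gamma> t) * cnj (N (q t))) * d)))) (at t)" .
        have w0': "complex_of_real (w (\<gamma> t)) \<noteq> 0" using w0 by simp
        have "(V has_derivative (\<lambda>h. h *\<^sub>R (- (a (\<gamma> t) * d * V t + cnj (b (\<gamma> t) * d * V t))))) (at t)"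
          using has_derivative_divide'[OF dn bounded_linear.has_derivative[OF bounded_linear_of_real dwt] w0']
          unfolding V_def scaleR_conv_of_real dual_field_derivative[OF w0] .
        then show ?thesis by (simp add: \<Gamma>[OF \<gamma>M[OF t'(2)]])
      qed
      then show ?thesis using diff by (simp add: has_vector_derivative_def d_def)
    qed
    ultimately show ?thesis
      unfolding parallel_along_def
      by (intro conjI exI[of _ "insert 0 (insert 1 S)"] ballI) (simp_all add: S(1))
  qed
  have uniq: "u = V 1" if "parallel_along \<Gamma> \<gamma> V'" "V' 0 = v" "V' 1 = u" for V' u
  proof -
    have "Re (\<phi> (q 1) * u) = Re (\<phi> (q 1) * V 1)" "Re (\<psi> (q 1) * u) = Re (\<psi> (q 1) * V 1)"
      using const[OF flat(1) that(1)] const[OF flat(1) par] const[OF flat(2) that(1)] const[OF flat(2) par] that V0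
      by simp_all
    moreover have "Im (cnj (\<phi> (q 1)) * \<psi> (q 1)) \<noteq> 0"
      using area[OF qH[of 1]] w[OF \<gamma>M[of 1]] q(2)[of 1] by (simp del: times_complex.sel)
    ultimately show ?thesis by (intro complex_dual_basis_eqI)
  qed
  have "parallel_transport \<Gamma> \<gamma> v = V 1"
    unfolding parallel_transport_def
    using par V0 uniq by (intro the_equality) blast+
  then show "Re (\<phi> (q 1) * parallel_transport \<Gamma> \<gamma> v) = Re (\<phi> (q 0) * v)"
    "Re (\<psi> (q 1) * parallel_transport \<Gamma> \<gamma> v) = Re (\<psi> (q 0) * v)"
    using const[OF flat(1) par] const[OF flat(2) par] V0 by simp_all
qed

section \<open>Quasi-periodic holomorphic functions on the left half-plane\<close>

lemma shift_by_int_multiple: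
  assumes per: "\<And>\<xi>. \<xi> \<in> half_plane \<Longrightarrow> F (deck \<xi>) = F \<xi>"
    and \<xi>: "\<xi> \<in> half_plane" and \<zeta>: "exp \<zeta> = exp \<xi>"
  shows "F \<zeta> = F \<xi>"
proof -
  have nat: "F (\<xi> + of_nat n * (2 * of_real pi * \<i>)) = F \<xi>" if "\<xi> \<in> half_plane" for n \<xi>
  proof (induction n)
    case (Suc n)
    have "\<xi> + of_nat n * (2 * of_real pi * \<i>) \<in> half_plane"
      using that by (simp add: half_plane_def)
    from per[OF this] Suc show ?case by (simp add: algebra_simps)
  qed simp
  obtain n :: int where n: "\<zeta> = \<xi> + of_int (2 * n) * of_real pi * \<i>"
    using \<zeta> by (auto simp: exp_eq)
  show ?thesis
  proof (cases "n \<ge> 0")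
    case True
    then show ?thesis using nat[OF \<xi>, of "nat n"] n by (simp add: algebra_simps)
  next
    case False
    have "\<zeta> \<in> half_plane" using n \<xi> by (simp add: half_plane_def)
    from nat[OF this, of "nat (- n)"] False n show ?thesis by (simp add: algebra_simps)
  qed
qed

text \<open>
  The candidate is \<open>F \<circ> Ln\<close>. By periodicity it agrees with \<open>F (Ln (- z) + i \<pi>)\<close>, which is
  holomorphic across the branch cut.
\<close>

lemma periodic_holomorphic_descends:
  assumes hol: "F holomorphic_on half_plane"
    and per: "\<And>\<xi>. \<xi> \<in> half_plane \<Longrightarrow> F (deck \<xi>) = F \<xi>"
  obtains k where "k holomorphic_on punctured_disc" "\<And>\<xi>. \<xi> \<in> half_plane \<Longrightarrow> F \<xi> = k (exp \<xi>)"
proof -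
  define k where "k z = F (Ln z)" for z
  have Fk: "k z = F \<xi>" if "exp \<xi> = z" "\<xi> \<in> half_plane" for z \<xi>
    unfolding k_def by (rule shift_by_int_multiple[where F=F, OF per that(2)]) (use that(1) in auto)
  have H: "Ln z \<in> half_plane" "Ln (- z) + of_real pi * \<i> \<in> half_plane" if "z \<in> punctured_disc" for z
    using that by (auto simp: half_plane_def punctured_disc_def)
  have 1: "k holomorphic_on (punctured_disc \<inter> - \<real>\<^sub>\<le>\<^sub>0)"
  proof -
    have "(F \<circ> Ln) holomorphic_on (punctured_disc \<inter> - \<real>\<^sub>\<le>\<^sub>0)"
      by (rule holomorphic_on_compose_gen[OF _ hol]) (auto intro!: holomorphic_intros H)
    then show ?thesis by (simp add: k_def[abs_def] o_def)
  qed
  have 2: "k holomorphic_on (punctured_disc \<inter> uminus -` (- \<real>\<^sub>\<le>\<^sub>0))"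
  proof -
    have "(F \<circ> (\<lambda>z. Ln (- z) + of_real pi * \<i>)) holomorphic_on (punctured_disc \<inter> uminus -` (- \<real>\<^sub>\<le>\<^sub>0))"
      by (rule holomorphic_on_compose_gen[OF _ hol]) (auto intro!: holomorphic_intros H)
    moreover have "(F \<circ> (\<lambda>z. Ln (- z) + of_real pi * \<i>)) z = k z"
      if "z \<in> punctured_disc \<inter> uminus -` (- \<real>\<^sub>\<le>\<^sub>0)" for z
      using Fk[of "Ln (- z) + of_real pi * \<i>" z] H[of z] that by (auto simp: punctured_disc_def exp_add)
    ultimately show ?thesis by (rule holomorphic_transform)
  qed
  have op: "open (- \<real>\<^sub>\<le>\<^sub>0 :: complex set)" using closed_nonpos_Reals_complex by blast
  have "k holomorphic_on ((punctured_disc \<inter> - \<real>\<^sub>\<le>\<^sub>0) \<union> (punctured_disc \<inter> uminus -` (- \<real>\<^sub>\<le>\<^sub>0)))"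
    by (intro holomorphic_on_Un 1 2 open_Int open_punctured_disc op open_vimage continuous_intros)
  moreover have "(punctured_disc \<inter> - \<real>\<^sub>\<le>\<^sub>0) \<union> (punctured_disc \<inter> uminus -` (- \<real>\<^sub>\<le>\<^sub>0)) = punctured_disc"
    by (auto simp: punctured_disc_def complex_nonpos_Reals_iff complex_eq_iff)
  ultimately have "k holomorphic_on punctured_disc" by simp
  then show thesis using that Fk by metis
qed

lemma holomorphic_factor_at_0:
  assumes hol: "g holomorphic_on ball 0 R" and nz: "z0 \<in> ball 0 R" "g z0 \<noteq> 0"
  obtains n :: nat and r and l where "0 < r" "r \<le> R" "l holomorphic_on ball 0 r"
    "\<And>z. z \<in> ball 0 r \<Longrightarrow> g z = z ^ n * l z \<and> l z \<noteq> 0"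
proof (cases "g 0 = 0")
  case True
  have R: "0 \<in> ball 0 R" using nz(1) by (simp add: less_le_trans[OF le_less_trans[OF norm_ge_zero]])
  have nc: "\<not> g constant_on ball 0 R"
    using True nz R unfolding constant_on_def by metis
  show thesis
  proof (rule holomorphic_factor_zero_nonconstant[OF hol open_ball connected_ball R True nc])
    fix l r and n :: nat
    assume *: "0 < n" "0 < r" "ball 0 r \<subseteq> ball (0::complex) R" "l holomorphic_on ball 0 r"
      "\<And>w. w \<in> ball 0 r \<Longrightarrow> g w = (w - 0) ^ n * l w" "\<And>w. w \<in> ball 0 r \<Longrightarrow> l w \<noteq> 0"
    then have "r \<le> R" by (auto simp: ball_subset_ball_iff)
    with * show thesis by (intro that[of r l n]) auto
  qed
next
  case False
  have R: "0 < R" using nz(1) by (simp add: le_less_trans[OF norm_ge_zero])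
  have "isCont g 0"
    using hol R by (meson centre_in_ball holomorphic_on_imp_continuous_on continuous_on_eq_continuous_at open_ball)
  then obtain e where e: "e > 0" "\<And>z. dist 0 z < e \<Longrightarrow> g z \<noteq> 0"
    using False continuous_at_avoid by blast
  show thesis
  proof (rule that[of "min e R" g 0])
    show "g holomorphic_on ball 0 (min e R)" using hol by (rule holomorphic_on_subset) auto
  qed (use e R in auto)
qed

lemma exp_in_small_ball:
  assumes "exp \<xi> \<in> ball 0 r" "r \<le> 1"
  shows "\<xi> \<in> half_plane"
proof -
  have "exp (Re \<xi>) < r" using assms(1) by simp
  then have "exp (Re \<xi>) < 1" using assms(2) by (rule less_le_trans)
  then show ?thesis by (simp add: half_plane_def)
qed

lemma tendsto_at_0_along_exp:
  assumes "isCont u (0::complex)"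
  shows "((\<lambda>t::real. u (of_real (exp t))) \<longlongrightarrow> u 0) at_bot"
proof -
  have "((\<lambda>t::real. exp t) \<longlongrightarrow> 0) at_bot" by real_asymp
  from tendsto_of_real[OF this, where 'a=complex] have "((\<lambda>t::real. complex_of_real (exp t)) \<longlongrightarrow> 0) at_bot"
    by simp
  then show ?thesis by (rule isCont_tendsto_compose[OF assms])
qed

lemma holomorphic_on_ball_isCont_0:
  "u holomorphic_on ball 0 r \<Longrightarrow> 0 < r \<Longrightarrow> isCont u 0"
  by (meson centre_in_ball holomorphic_on_imp_continuous_on continuous_on_eq_continuous_at open_ball)

text \<open>
  The exponent \<open>\<mu>\<close> matters modulo integers and can be replaced by some \<open>m \<le> 0\<close>. Then \<open>F \<xi> exp (- m \<xi>)\<close>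
  is periodic and still bounded on the left half-plane, so it is a function of \<open>exp \<xi>\<close> with a
  removable singularity at \<open>0\<close>.
\<close>

lemma bounded_quasi_periodic_expansion:
  fixes \<mu> :: real
  assumes hol: "F holomorphic_on half_plane"
    and per: "\<And>\<xi>. \<xi> \<in> half_plane \<Longrightarrow> F (deck \<xi>) = exp (2 * of_real pi * \<i> * of_real \<mu>) * F \<xi>"
    and bd: "\<And>\<xi>. \<xi> \<in> half_plane \<Longrightarrow> norm (F \<xi>) \<le> B"
    and nz: "\<xi>0 \<in> half_plane" "F \<xi>0 \<noteq> 0"
  obtains \<nu> r :: real and u where "0 < r" "r \<le> 1" "u holomorphic_on ball 0 r" "\<nu> \<ge> 0"
    "exp (2 * of_real pi * \<i> * of_real \<nu>) = exp (2 * of_real pi * \<i> * of_real \<mu>)"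
    "\<And>z. z \<in> ball 0 r \<Longrightarrow> u z \<noteq> 0"
    "\<And>\<xi>. exp \<xi> \<in> ball 0 r \<Longrightarrow> F \<xi> = exp (of_real \<nu> * \<xi>) * u (exp \<xi>)"
proof -
  define m where "m = \<mu> - of_int \<lceil>\<mu>\<rceil>"
  have m: "m \<le> 0" by (simp add: m_def)
  have expm: "exp (2 * of_real pi * \<i> * of_real (m + of_int j)) = exp (2 * of_real pi * \<i> * of_real \<mu>)" for j
    unfolding exp_eq by (rule exI[of _ "j - \<lceil>\<mu>\<rceil>"]) (simp add: m_def algebra_simps)
  define G where "G \<xi> = F \<xi> * exp (- of_real m * \<xi>)" for \<xi>
  have "G holomorphic_on half_plane" unfolding G_def by (intro holomorphic_intros hol)
  moreover have "G (deck \<xi>) = G \<xi>" if "\<xi> \<in> half_plane" for \<xi>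
  proof -
    have "exp (- of_real m * (deck \<xi>)) =
        exp (- of_real m * \<xi> - 2 * of_real pi * \<i> * of_real m)"
      by (simp add: algebra_simps)
    also have "\<dots> = exp (- of_real m * \<xi>) / exp (2 * of_real pi * \<i> * of_real m)"
      by (rule exp_diff)
    finally have "exp (- of_real m * (deck \<xi>)) =
        exp (- of_real m * \<xi>) / exp (2 * of_real pi * \<i> * of_real m)" .
    then show ?thesis using per[OF that] expm[of 0] by (simp add: G_def)
  qed
  ultimately obtain k where k: "k holomorphic_on punctured_disc" "\<And>\<xi>. \<xi> \<in> half_plane \<Longrightarrow> G \<xi> = k (exp \<xi>)"
    using periodic_holomorphic_descends by blast
  have kb: "norm (k z) \<le> B" if "z \<in> punctured_disc" for z
  proof -
    have e: "exp (Ln z) = z" and H: "Ln z \<in> half_plane"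
      using that by (auto simp: punctured_disc_def half_plane_def)
    have "norm (k z) = norm (F (Ln z)) * exp (- m * Re (Ln z))"
      unfolding k(2)[OF H, unfolded e, symmetric] by (simp add: G_def norm_mult)
    also have "\<dots> \<le> norm (F (Ln z)) * 1"
      using m H by (intro mult_left_mono) (auto simp: half_plane_def mult_nonpos_nonpos)
    finally show ?thesis using bd[OF H] by simp
  qed
  have pd: "punctured_disc = ball 0 1 - {0}" by (auto simp: punctured_disc_def)
  have "eventually (\<lambda>z. norm (k z) \<le> B) (at 0)"
    unfolding eventually_at by (intro exI[of _ 1]) (auto intro!: kb simp: punctured_disc_def)
  moreover have "0 \<in> interior (ball (0::complex) 1)" by simp
  ultimately obtain g where g: "g holomorphic_on ball 0 1" "\<And>z. z \<in> punctured_disc \<Longrightarrow> g z = k z"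
    using holomorphic_on_extend_bounded[of k "ball 0 1" 0] k(1) unfolding pd by blast
  have "g (exp \<xi>0) \<noteq> 0" "exp \<xi>0 \<in> ball 0 1"
    using g(2)[of "exp \<xi>0"] k(2)[OF nz(1)] nz exp_in_punctured_disc[of \<xi>0]
    by (auto simp: G_def punctured_disc_def)
  then obtain n r u where u: "0 < r" "r \<le> 1" "u holomorphic_on ball 0 r"
    "\<And>z. z \<in> ball 0 r \<Longrightarrow> g z = z ^ n * u z \<and> u z \<noteq> 0"
    using holomorphic_factor_at_0[OF g(1)] by metis
  define \<nu> where "\<nu> = m + of_nat n"
  have Feq: "F \<xi> = exp (of_real \<nu> * \<xi>) * u (exp \<xi>)" if "exp \<xi> \<in> ball 0 r" for \<xi>
  proof -
    have \<xi>: "exp \<xi> \<in> punctured_disc" "\<xi> \<in> half_plane"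
      using exp_in_small_ball[OF that u(2)] by (simp_all add: exp_in_punctured_disc)
    have "F \<xi> = exp (of_real m * \<xi>) * G \<xi>" by (simp add: G_def exp_minus)
    also have "G \<xi> = exp \<xi> ^ n * u (exp \<xi>)"
      using k(2)[OF \<xi>(2)] g(2)[OF \<xi>(1)] u(4)[OF that] by simp
    finally show ?thesis by (simp add: \<nu>_def exp_add distrib_right exp_of_nat_mult)
  qed
  \<comment> \<open>Otherwise \<open>F\<close> would be unbounded along the negative real axis.\<close>
  have "\<nu> \<ge> 0"
  proof (rule ccontr)
    assume "\<not> \<nu> \<ge> 0"
    then have neg: "\<nu> < 0" by simp
    have c: "isCont u 0"
      using u(1,3) by (meson centre_in_ball holomorphic_on_imp_continuous_on continuous_on_eq_continuous_at open_ball)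
    have "((\<lambda>t::real. norm (u (of_real (exp t)))) \<longlongrightarrow> norm (u 0)) at_bot"
      by (intro tendsto_norm tendsto_at_0_along_exp c)
    moreover have "filterlim (\<lambda>t::real. exp (\<nu> * t)) at_top at_bot" using neg by real_asymp
    ultimately have "filterlim (\<lambda>t::real. norm (u (of_real (exp t))) * exp (\<nu> * t)) at_top at_bot"
      using u(4)[of 0] u(1) by (intro filterlim_tendsto_pos_mult_at_top[of _ "norm (u 0)"]) auto
    then have "\<forall>\<^sub>F t in at_bot. B < norm (u (of_real (exp t))) * exp (\<nu> * t)"
      by (simp add: filterlim_at_top_dense)
    moreover have "\<forall>\<^sub>F t::real in at_bot. exp t < r" 
      using u(1) by real_asymp
    moreover have "\<forall>\<^sub>F t::real in at_bot. t < 0" by (rule eventually_gt_at_bot)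
    ultimately have "\<forall>\<^sub>F t::real in at_bot. False"
    proof eventually_elim
      case (elim t)
      have "norm (F (of_real t)) = norm (u (of_real (exp t))) * exp (\<nu> * t)"
        using Feq[of "of_real t"] elim(2) by (simp add: norm_mult exp_of_real)
      moreover have "norm (F (of_real t)) \<le> B" using elim(3) by (intro bd) (simp add: half_plane_def)
      ultimately show ?case using elim(1) by simp
    qed
    then show False by simp
  qed
  with u Feq expm[of "int n"] show thesis by (intro that[of r u \<nu>]) (auto simp: \<nu>_def)
qed

lemma exp_in_ball_iff: "r > 0 \<Longrightarrow> exp \<xi> \<in> ball 0 r \<longleftrightarrow> Re \<xi> < ln r"
  unfolding mem_ball_0 norm_exp_eq_Re by (metis exp_less_cancel_iff exp_ln)

lemma exp_preimage_ball:
  assumes "r > 0"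
  shows "open {\<xi>. exp \<xi> \<in> ball (0::complex) r}" "convex {\<xi>. exp \<xi> \<in> ball (0::complex) r}"
  unfolding exp_in_ball_iff[OF assms] by (simp_all add: open_halfspace_Re_lt convex_halfspace_Re_lt)

lemma holomorphic_on_ball_compose_exp:
  assumes "u holomorphic_on ball 0 r"
  shows "(\<lambda>\<xi>. u (exp \<xi>)) holomorphic_on {\<xi>. exp \<xi> \<in> ball 0 r}"
proof -
  have "(u \<circ> exp) holomorphic_on {\<xi>. exp \<xi> \<in> ball 0 r}"
    by (rule holomorphic_on_compose_gen[OF _ assms]) (auto intro!: holomorphic_intros)
  then show ?thesis by (simp add: o_def)
qed

lemma exists_exp_in_ball:
  assumes "r > 0"
  shows "\<exists>\<xi>. exp \<xi> \<in> ball (0::complex) r"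
  by (rule exI[of _ "of_real (ln r - 1)"]) (subst exp_in_ball_iff[OF assms], simp)

text \<open>
  The formula for the square of \<open>\<psi>\<close> alone determines \<open>l\<close> up to sign. The sign is found by
  dividing \<open>\<psi>\<close> by \<open>exp (\<kappa> \<xi> / 2)\<close> and by the periodic function \<open>sqrt (u (exp \<xi>))\<close>: the quotient has
  square one and is constant because its domain is connected.
\<close>

lemma square_root_multiplier:
  fixes \<kappa> :: real
  assumes hol: "\<psi> holomorphic_on half_plane"
    and shift: "\<And>\<xi>. \<xi> \<in> half_plane \<Longrightarrow> \<psi> (deck \<xi>) = l * \<psi> \<xi>"
    and r: "0 < r" "r \<le> 1" and u: "u holomorphic_on ball 0 r" "\<And>z. z \<in> ball 0 r \<Longrightarrow> u z \<noteq> 0"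
    and sq: "\<And>\<xi>. exp \<xi> \<in> ball 0 r \<Longrightarrow> (\<psi> \<xi>)\<^sup>2 = exp (of_real \<kappa> * \<xi>) * u (exp \<xi>)"
  shows "l = exp (\<i> * of_real (pi * \<kappa>))"
proof -
  define P where "P = {\<xi>. exp \<xi> \<in> ball (0::complex) r}"
  have P: "open P" "convex P" using exp_preimage_ball[OF r(1)] by (simp_all add: P_def)
  have PH: "\<xi> \<in> half_plane" if "\<xi> \<in> P" for \<xi>
    using exp_in_small_ball[OF _ r(2)] that by (simp add: P_def)
  obtain h where h: "h holomorphic_on ball 0 r" "\<And>z. z \<in> ball 0 r \<Longrightarrow> u z = exp (h z)"
    using contractible_imp_holomorphic_log[OF u(1) convex_imp_contractible[OF convex_ball] u(2)] by blast
  define s where "s \<xi> = \<psi> \<xi> * exp (- (of_real \<kappa> * \<xi> + h (exp \<xi>)) / 2)" for \<xi>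
  have sqs: "(s \<xi>)\<^sup>2 = 1" if "\<xi> \<in> P" for \<xi>
  proof -
    have two: "2 * (- x / 2) = - x" for x :: complex by simp
    have "(s \<xi>)\<^sup>2 = (\<psi> \<xi>)\<^sup>2 * exp (2 * (- (of_real \<kappa> * \<xi> + h (exp \<xi>)) / 2))"
      unfolding s_def power_mult_distrib exp_double ..
    also have "\<dots> = exp (of_real \<kappa> * \<xi>) * exp (h (exp \<xi>)) * exp (- (of_real \<kappa> * \<xi> + h (exp \<xi>)))"
      using sq[of \<xi>] h(2)[of "exp \<xi>"] that unfolding two by (simp add: P_def)
    also have "\<dots> = exp 0" unfolding exp_add[symmetric] by simp
    finally show ?thesis by simp
  qed
  have "s constant_on P"
  proof (rule continuous_finite_range_constant)
    show "connected P" using P by (simp add: convex_connected)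
    have "(\<lambda>\<xi>. h (exp \<xi>)) holomorphic_on P" unfolding P_def by (rule holomorphic_on_ball_compose_exp[OF h(1)])
    moreover have "\<psi> holomorphic_on P" by (rule holomorphic_on_subset[OF hol]) (use PH in auto)
    ultimately have "s holomorphic_on P" unfolding s_def by (intro holomorphic_intros) auto
    then show "continuous_on P s" by (rule holomorphic_on_imp_continuous_on)
    have "s ` P \<subseteq> {1, -1}" using sqs by (auto simp: power2_eq_1_iff)
    then show "finite (s ` P)" by (rule finite_subset) simp
  qed
  then obtain c where c: "\<And>\<xi>. \<xi> \<in> P \<Longrightarrow> s \<xi> = c" by (auto simp: constant_on_def)
  obtain \<xi> where \<xi>: "\<xi> \<in> P" using exists_exp_in_ball[OF r(1)] by (auto simp: P_def)
  have "deck \<xi> \<in> P" using \<xi> by (simp add: P_def exp_shift)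
  then have "s (deck \<xi>) = s \<xi>" using c \<xi> by simp
  moreover have "s (deck \<xi>) = l * exp (- (\<i> * of_real (pi * \<kappa>))) * s \<xi>"
  proof -
    have "- (of_real \<kappa> * (deck \<xi>) + h (exp (deck \<xi>))) / 2
      = - (\<i> * of_real (pi * \<kappa>)) + (- (of_real \<kappa> * \<xi> + h (exp \<xi>)) / 2)"
      unfolding exp_shift by (simp add: field_simps)
    then show ?thesis
      unfolding s_def shift[OF PH[OF \<xi>]] by (simp only: exp_add mult_ac)
  qed
  moreover have "s \<xi> \<noteq> 0" using sqs[OF \<xi>] by auto
  ultimately have "l * exp (- (\<i> * of_real (pi * \<kappa>))) = 1" by simp
  then show ?thesis by (simp add: exp_minus field_simps)
qed

lemma holomorphic_exp_1_constant:
  assumes "open P" "convex P" "E holomorphic_on P" and "\<And>\<xi>. \<xi> \<in> P \<Longrightarrow> exp (E \<xi>) = 1"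
  obtains c where "\<And>\<xi>. \<xi> \<in> P \<Longrightarrow> E \<xi> = c"
proof -
  have "(E has_field_derivative 0) (at \<xi> within P)" if \<xi>: "\<xi> \<in> P" for \<xi>
  proof -
    have d: "(E has_field_derivative deriv E \<xi>) (at \<xi>)"
      by (rule holomorphic_derivI[OF assms(3,1) \<xi>])
    have "((\<lambda>\<xi>. exp (E \<xi>)) has_field_derivative exp (E \<xi>) * deriv E \<xi>) (at \<xi>)"
      by (rule DERIV_fun_exp[OF d])
    moreover have "((\<lambda>\<xi>. exp (E \<xi>)) has_field_derivative 0) (at \<xi>)"
      by (rule has_field_derivative_transform_within_open[OF DERIV_const assms(1) \<xi>]) (simp add: assms(4))
    ultimately have "deriv E \<xi> = 0" using DERIV_unique by fastforce
    with d show ?thesis by (simp add: has_field_derivative_at_within)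
  qed
  then show thesis
    using has_field_derivative_zero_constant[OF assms(2)] that by blast
qed

text \<open>
  Take the logarithm of the expansion of the bounded periodic function \<open>exp f\<close>. Geometrically, \<open>m\<close> is
  the winding number of a bounded function without zeros on the punctured disc, and this is
  the order of its zero at the origin.
\<close>

lemma additive_quasi_periodic_expansion:
  fixes m :: int
  assumes hol: "f holomorphic_on half_plane"
    and shift: "\<And>\<xi>. \<xi> \<in> half_plane \<Longrightarrow> f (deck \<xi>) = f \<xi> + 2 * of_real pi * \<i> * of_int m"
    and bd: "\<And>\<xi>. \<xi> \<in> half_plane \<Longrightarrow> Re (f \<xi>) \<le> B"
  obtains r h where "0 < r" "r \<le> 1" "h holomorphic_on ball 0 r" "m \<ge> 0"
    "\<And>\<xi>. exp \<xi> \<in> ball 0 r \<Longrightarrow> f \<xi> = of_int m * \<xi> + h (exp \<xi>)"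
proof -
  have expm: "exp (2 * of_real pi * \<i> * of_int m) = (1 :: complex)"
    by (simp add: exp_eq_1)
  obtain \<nu> r u where *: "0 < r" "r \<le> 1" "u holomorphic_on ball 0 r" "\<nu> \<ge> 0"
    "\<And>z. z \<in> ball 0 r \<Longrightarrow> u z \<noteq> 0"
    "\<And>\<xi>. exp \<xi> \<in> ball 0 r \<Longrightarrow> exp (f \<xi>) = exp (of_real \<nu> * \<xi>) * u (exp \<xi>)"
  proof (rule bounded_quasi_periodic_expansion[where F="\<lambda>\<xi>. exp (f \<xi>)" and \<mu>=0 and B="exp B" and ?\<xi>0.0="-1"])
    show "(\<lambda>\<xi>. exp (f \<xi>)) holomorphic_on half_plane" by (intro holomorphic_intros hol)
    show "exp (f (deck \<xi>)) = exp (2 * of_real pi * \<i> * of_real 0) * exp (f \<xi>)"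
      if "\<xi> \<in> half_plane" for \<xi>
      unfolding shift[OF that] exp_add expm by simp
  qed (use bd in \<open>auto simp: half_plane_def\<close>)
  define P where "P = {\<xi>. exp \<xi> \<in> ball (0::complex) r}"
  have P: "open P" "convex P" using exp_preimage_ball[OF *(1)] by (simp_all add: P_def)
  have PH: "\<xi> \<in> half_plane" if "\<xi> \<in> P" for \<xi>
    using exp_in_small_ball[OF _ *(2)] that by (simp add: P_def)
  obtain h where h: "h holomorphic_on ball 0 r" "\<And>z. z \<in> ball 0 r \<Longrightarrow> u z = exp (h z)"
    using contractible_imp_holomorphic_log[OF *(3) convex_imp_contractible[OF convex_ball] *(5)] by blast
  define E where "E \<xi> = f \<xi> - of_real \<nu> * \<xi> - h (exp \<xi>)" for \<xi>
  obtain c where c: "\<And>\<xi>. \<xi> \<in> P \<Longrightarrow> E \<xi> = c"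
  proof (rule holomorphic_exp_1_constant[OF P])
    have "(\<lambda>\<xi>. h (exp \<xi>)) holomorphic_on P" unfolding P_def by (rule holomorphic_on_ball_compose_exp[OF h(1)])
    moreover have "f holomorphic_on P" by (rule holomorphic_on_subset[OF hol]) (use PH in auto)
    ultimately show "E holomorphic_on P" unfolding E_def by (intro holomorphic_intros) auto
    show "exp (E \<xi>) = 1" if "\<xi> \<in> P" for \<xi>
      using *(6)[of \<xi>] h(2)[of "exp \<xi>"] that by (simp add: E_def exp_diff P_def)
  qed blast
  obtain \<xi> where \<xi>: "\<xi> \<in> P" using exists_exp_in_ball[OF *(1)] by (auto simp: P_def)
  have "deck \<xi> \<in> P" using \<xi> by (simp add: P_def exp_shift)
  then have "E (deck \<xi>) = E \<xi>" using c \<xi> by simp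
  then have "2 * of_real pi * \<i> * (of_int m - of_real \<nu>) = 0"
    unfolding E_def shift[OF PH[OF \<xi>]] exp_shift by (simp add: algebra_simps)
  then have "complex_of_real (of_int m) = of_real \<nu>" by simp
  then have \<nu>: "\<nu> = of_int m" using of_real_eq_iff by metis
  show thesis
  proof (rule that[of r "\<lambda>z. h z + c"])
    show "f \<xi> = of_int m * \<xi> + (h (exp \<xi>) + c)" if "exp \<xi> \<in> ball 0 r" for \<xi>
      using c[of \<xi>] that by (simp add: P_def E_def \<nu> algebra_simps)
  qed (use * h \<nu> in \<open>auto intro!: holomorphic_intros\<close>)
qed

section \<open>Hyperbolic, parabolic and elliptic monodromy\<close>

lemma Im_of_real_mult: "Im (of_real s * x) = s * Im x"
  by simp

lemma Im_quotient:
  assumes "x \<noteq> 0"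
  shows "Im (y / x) = Im (cnj x * y) / (norm x)\<^sup>2"
proof -
  have "y / x = cnj x * y / of_real ((norm x)\<^sup>2)"
    using assms unfolding complex_norm_square by (simp add: field_simps)
  then show ?thesis by (simp only: Im_divide_of_real)
qed

text \<open>
  The quotient \<open>\<tau> = \<eta>/\<psi>\<close>, up to sign, has values in the upper half-plane and is divided by
  \<open>r\<^sup>2\<close>. Its logarithm has bounded imaginary part, so \<open>i \<pi> log \<tau> / ln \<bar>r\<bar>\<close> has bounded real
  part; but it changes by \<open>- 2 \<pi> i\<close>, against \<open>additive_quasi_periodic_expansion\<close>.
\<close>

lemma hyperbolic_monodromy_impossible:
  fixes r K :: real
  assumes hol: "\<psi> holomorphic_on half_plane" "\<eta> holomorphic_on half_plane"
    and shift: "\<And>\<xi>. \<xi> \<in> half_plane \<Longrightarrow> \<psi> (deck \<xi>) = of_real r * \<psi> \<xi>"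
      "\<And>\<xi>. \<xi> \<in> half_plane \<Longrightarrow> \<eta> (deck \<xi>) = \<eta> \<xi> / of_real r"
    and r: "r \<noteq> 0" "\<bar>r\<bar> \<noteq> 1" and "K \<noteq> 0"
    and area: "\<And>\<xi>. \<xi> \<in> half_plane \<Longrightarrow> Im (cnj (\<psi> \<xi>) * \<eta> \<xi>) = K * W \<xi>"
    and W: "\<And>\<xi>. \<xi> \<in> half_plane \<Longrightarrow> W \<xi> > 0"
  shows False
proof -
  define \<tau> where "\<tau> \<xi> = of_real (sgn K) * (\<eta> \<xi> / \<psi> \<xi>)" for \<xi>
  have nz: "\<psi> \<xi> \<noteq> 0" if "\<xi> \<in> half_plane" for \<xi>
  proof
    assume "\<psi> \<xi> = 0"
    then show False using area[OF that] W[OF that] \<open>K \<noteq> 0\<close> by simp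
  qed
  have Im\<tau>: "Im (\<tau> \<xi>) > 0" if "\<xi> \<in> half_plane" for \<xi>
  proof -
    have "Im (\<tau> \<xi>) = sgn K * Im (\<eta> \<xi> / \<psi> \<xi>)"
      unfolding \<tau>_def by (rule Im_of_real_mult)
    also have "\<dots> = sgn K * (Im (cnj (\<psi> \<xi>) * \<eta> \<xi>) / (norm (\<psi> \<xi>))\<^sup>2)"
      unfolding Im_quotient[OF nz[OF that]] ..
    also have "\<dots> = \<bar>K\<bar> * W \<xi> / (norm (\<psi> \<xi>))\<^sup>2"
      unfolding area[OF that] by (simp add: abs_sgn)
    finally show ?thesis using W[OF that] nz[OF that] \<open>K \<noteq> 0\<close> by simp
  qed
  define f where "f \<xi> = \<i> * of_real (pi / ln \<bar>r\<bar>) * Ln (\<tau> \<xi>)" for \<xi>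
  have lnr: "ln \<bar>r\<bar> \<noteq> 0" using r by simp
  show False
  proof (rule additive_quasi_periodic_expansion[where f=f and m="-1" and B="pi * pi / \<bar>ln \<bar>r\<bar>\<bar>"])
    have "\<tau> holomorphic_on half_plane"
      unfolding \<tau>_def by (intro holomorphic_intros hol nz)
    moreover have "\<tau> \<xi> \<notin> \<real>\<^sub>\<le>\<^sub>0" if "\<xi> \<in> half_plane" for \<xi>
      using Im\<tau>[OF that] by (auto simp: complex_nonpos_Reals_iff)
    ultimately show "f holomorphic_on half_plane"
      unfolding f_def by (intro holomorphic_intros) auto
    fix \<xi> assume \<xi>: "\<xi> \<in> half_plane"
    have "\<tau> (deck \<xi>) = of_real (1 / r\<^sup>2) * \<tau> \<xi>"
      unfolding \<tau>_def shift[OF \<xi>] by (simp add: power2_eq_square)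
    moreover have "Ln (of_real (1 / r\<^sup>2) * \<tau> \<xi>) = of_real (ln (1 / r\<^sup>2)) + Ln (\<tau> \<xi>)"
    proof -
      have pos: "1 / r\<^sup>2 > 0" and nz: "\<tau> \<xi> \<noteq> 0" using r Im\<tau>[OF \<xi>] by auto
      show ?thesis using Ln_times_of_real[OF pos nz] unfolding Ln_of_real[OF pos] .
    qed
    moreover have "ln (1 / r\<^sup>2) = - 2 * ln \<bar>r\<bar>"
      using r ln_realpow[of "\<bar>r\<bar>" 2] by (simp add: ln_div)
    ultimately have L: "Ln (\<tau> (deck \<xi>)) = of_real (- 2 * ln \<bar>r\<bar>) + Ln (\<tau> \<xi>)"
      by (simp only:)
    show "f (deck \<xi>) = f \<xi> + 2 * of_real pi * \<i> * of_int (- 1)"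
      unfolding f_def L using lnr by (simp add: field_simps)
    have "Re (f \<xi>) = - (pi / ln \<bar>r\<bar>) * Im (Ln (\<tau> \<xi>))" by (simp add: f_def)
    also have "\<dots> \<le> \<bar>- (pi / ln \<bar>r\<bar>) * Im (Ln (\<tau> \<xi>))\<bar>" by (rule abs_ge_self)
    also have "\<dots> = pi / \<bar>ln \<bar>r\<bar>\<bar> * \<bar>Im (Ln (\<tau> \<xi>))\<bar>" by (simp add: abs_mult)
    also have "\<dots> \<le> pi / \<bar>ln \<bar>r\<bar>\<bar> * pi"
      using Im_Ln_le_pi[of "\<tau> \<xi>"] mpi_less_Im_Ln[of "\<tau> \<xi>"] Im\<tau>[OF \<xi>] by (intro mult_left_mono) force+
    finally show "Re (f \<xi>) \<le> pi * pi / \<bar>ln \<bar>r\<bar>\<bar>" by simp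
  qed simp
qed

lemma norm_square_asymptotics:
  fixes \<kappa> :: real
  assumes r: "0 < r" and u: "u holomorphic_on ball 0 r"
    and sq: "\<And>\<xi>. exp \<xi> \<in> ball 0 r \<Longrightarrow> (\<psi> \<xi>)\<^sup>2 = exp (of_real \<kappa> * \<xi>) * u (exp \<xi>)"
  shows "((\<lambda>t::real. (norm (\<psi> (of_real t)))\<^sup>2 / exp (\<kappa> * t)) \<longlongrightarrow> norm (u 0)) at_bot"
proof (rule Lim_transform_eventually)
  show "((\<lambda>t::real. norm (u (of_real (exp t)))) \<longlongrightarrow> norm (u 0)) at_bot"
    by (intro tendsto_norm tendsto_at_0_along_exp holomorphic_on_ball_isCont_0[OF u r])
  have "\<forall>\<^sub>F t::real in at_bot. exp t < r" using r by real_asymp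
  then show "\<forall>\<^sub>F t::real in at_bot. norm (u (of_real (exp t))) = (norm (\<psi> (of_real t)))\<^sup>2 / exp (\<kappa> * t)"
  proof eventually_elim
    case (elim t)
    have "(norm (\<psi> (of_real t)))\<^sup>2 = norm ((\<psi> (of_real t))\<^sup>2)" by (simp add: norm_power)
    also have "\<dots> = norm (exp (of_real \<kappa> * of_real t :: complex)) * norm (u (exp (of_real t)))"
      using sq[of "of_real t"] elim by (simp add: norm_mult)
    finally show ?case by (simp add: exp_of_real)
  qed
qed

text \<open>
  The quotient \<open>\<eta>/\<psi>\<close> is translated by \<open>\<epsilon>\<close> and its imaginary part has a constant sign. With the
  right sign in front, \<open>f = \<plusminus>2 \<pi> i \<eta>/\<psi>\<close> has negative real part and changes by \<open>2 \<pi> i m\<close> with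
  \<open>m = \<plusminus>1\<close>; then \<open>m \<ge> 0\<close> leaves \<open>f = \<xi> + h (exp \<xi>)\<close>. The derivative of this equation together with the
  Wronskian gives \<open>\<psi>\<^sup>2 = exp (\<kappa> \<xi>) u (exp \<xi>)\<close>, which determines \<open>\<epsilon>\<close>, and \<open>W\<close> is proportional to
  \<open>- \<bar>\<psi>\<bar>\<^sup>2 Re f\<close>.
\<close>

lemma parabolic_monodromy:
  fixes K \<kappa> :: real and \<epsilon> :: real
  assumes hol: "\<psi> holomorphic_on half_plane" "\<eta> holomorphic_on half_plane"
    and eps: "\<epsilon> = 1 \<or> \<epsilon> = -1"
    and shift: "\<And>\<xi>. \<xi> \<in> half_plane \<Longrightarrow> \<psi> (deck \<xi>) = of_real \<epsilon> * \<psi> \<xi>"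
      "\<And>\<xi>. \<xi> \<in> half_plane \<Longrightarrow> \<eta> (deck \<xi>) = of_real \<epsilon> * \<eta> \<xi> + \<psi> \<xi>"
    and K: "K \<noteq> 0"
    and area: "\<And>\<xi>. \<xi> \<in> half_plane \<Longrightarrow> Im (cnj (\<psi> \<xi>) * \<eta> \<xi>) = K * W \<xi>"
    and W: "\<And>\<xi>. \<xi> \<in> half_plane \<Longrightarrow> W \<xi> > 0"
    and r0: "0 < r0" "r0 \<le> 1" and X: "X holomorphic_on ball 0 r0" "\<And>z. z \<in> ball 0 r0 \<Longrightarrow> X z \<noteq> 0"
    and wronskian: "\<And>\<xi>. exp \<xi> \<in> ball 0 r0 \<Longrightarrow>
      deriv \<eta> \<xi> * \<psi> \<xi> - \<eta> \<xi> * deriv \<psi> \<xi> = exp (of_real \<kappa> * \<xi>) * X (exp \<xi>)"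
  obtains A where "A > 0" "((\<lambda>t::real. W (of_real t) / (- t * exp (\<kappa> * t))) \<longlongrightarrow> A) at_bot"
    "of_real \<epsilon> = exp (\<i> * of_real (pi * \<kappa>))"
proof -
  have nz: "\<psi> \<xi> \<noteq> 0" if "\<xi> \<in> half_plane" for \<xi>
  proof
    assume "\<psi> \<xi> = 0"
    then show False using area[OF that] W[OF that] K by simp
  qed
  define c where "c = 2 * of_real pi * \<i> * of_real (sgn K)"
  have c: "c \<noteq> 0" using K by (simp add: c_def sgn_if)
  define f where "f \<xi> = c * (\<eta> \<xi> / \<psi> \<xi>)" for \<xi>
  \<comment> \<open>\<open>m\<close> is the period of \<open>f\<close> in units of \<open>2 \<pi> i\<close>.\<close>
  define m :: int where "m = (if K * \<epsilon> > 0 then 1 else -1)"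
  have m: "of_int m = sgn K * \<epsilon>" using eps K by (auto simp: m_def sgn_if zero_less_mult_iff)
  have Ref: "Re (f \<xi>) = - 2 * pi * (\<bar>K\<bar> * W \<xi> / (norm (\<psi> \<xi>))\<^sup>2)" if "\<xi> \<in> half_plane" for \<xi>
  proof -
    have aux: "Re (2 * of_real pi * \<i> * of_real k * x) = - 2 * pi * k * Im x" for k x by simp
    have "Re (f \<xi>) = - 2 * pi * sgn K * Im (\<eta> \<xi> / \<psi> \<xi>)"
      unfolding f_def c_def by (rule aux)
    also have "\<dots> = - 2 * pi * (sgn K * K * W \<xi> / (norm (\<psi> \<xi>))\<^sup>2)"
      unfolding Im_quotient[OF nz[OF that]] area[OF that] by (simp only: mult.assoc times_divide_eq_right)
    finally show ?thesis by (simp add: abs_sgn mult.commute)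
  qed
  have holf: "f holomorphic_on half_plane" unfolding f_def by (intro holomorphic_intros hol nz)
  obtain r h where r: "0 < r" "r \<le> 1" "h holomorphic_on ball 0 r" "m \<ge> 0"
    "\<And>\<xi>. exp \<xi> \<in> ball 0 r \<Longrightarrow> f \<xi> = of_int m * \<xi> + h (exp \<xi>)"
  proof (rule additive_quasi_periodic_expansion[where f=f and m=m and B=0])
    fix \<xi> assume \<xi>: "\<xi> \<in> half_plane"
    have "\<eta> (deck \<xi>) / \<psi> (deck \<xi>) = \<eta> \<xi> / \<psi> \<xi> + of_real \<epsilon>"
      unfolding shift[OF \<xi>] using nz[OF \<xi>] eps by (auto simp: field_simps)
    moreover have "c * of_real \<epsilon> = 2 * of_real pi * \<i> * of_int m"
    proof -
      have "complex_of_real (sgn K * \<epsilon>) = of_int m" unfolding m[symmetric] by simp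
      then show ?thesis by (simp add: c_def)
    qed
    ultimately show "f (deck \<xi>) = f \<xi> + 2 * of_real pi * \<i> * of_int m"
      by (simp only: f_def distrib_left)
    show "Re (f \<xi>) \<le> 0" unfolding Ref[OF \<xi>] using W[OF \<xi>] by simp
  qed (use holf in blast)+
  have m1: "m = 1" using r(4) by (auto simp: m_def split: if_splits)
  define R where "R = min r r0"
  have R: "0 < R" "R \<le> 1" "R \<le> r" "R \<le> r0" using r r0 by (auto simp: R_def)
  define p where "p z = 1 + z * deriv h z" for z
  have holp: "p holomorphic_on ball 0 R" unfolding p_def
    using r(3) R by (intro holomorphic_intros) (auto intro: holomorphic_on_subset)
  have eq: "(\<psi> \<xi>)\<^sup>2 * p (exp \<xi>) = exp (of_real \<kappa> * \<xi>) * (c * X (exp \<xi>))" if \<xi>: "exp \<xi> \<in> ball 0 R" for \<xi>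
  proof -
    have H: "\<xi> \<in> half_plane" by (rule exp_in_small_ball[OF \<xi> R(2)])
    have z: "exp \<xi> \<in> ball 0 r" "exp \<xi> \<in> ball 0 r0" using \<xi> R by auto
    have "((\<lambda>\<xi>. \<xi> + h (exp \<xi>)) has_field_derivative p (exp \<xi>)) (at \<xi>)"
    proof -
      have "(h has_field_derivative deriv h (exp \<xi>)) (at (exp \<xi>))"
        by (rule holomorphic_derivI[OF r(3) open_ball z(1)])
      from DERIV_chain2[OF this DERIV_exp]
      show ?thesis by (auto intro!: derivative_eq_intros simp: p_def)
    qed
    then have d1: "(f has_field_derivative p (exp \<xi>)) (at \<xi>)"
      by (rule has_field_derivative_transform_within_open[where S="{\<xi>. exp \<xi> \<in> ball 0 r}"])
        (use exp_preimage_ball[OF r(1)] z(1) r(5) m1 in auto)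
    have d: "(\<psi> has_field_derivative deriv \<psi> \<xi>) (at \<xi>)" "(\<eta> has_field_derivative deriv \<eta> \<xi>) (at \<xi>)"
      using holomorphic_derivI[OF hol(1) open_half_plane H] holomorphic_derivI[OF hol(2) open_half_plane H] .
    have "(f has_field_derivative c * ((deriv \<eta> \<xi> * \<psi> \<xi> - \<eta> \<xi> * deriv \<psi> \<xi>) / (\<psi> \<xi> * \<psi> \<xi>))) (at \<xi>)"
      unfolding f_def by (intro DERIV_cmult DERIV_divide d nz H)
    from DERIV_unique[OF d1 this] show ?thesis
      unfolding wronskian[OF z(2)] using nz[OF H] by (simp add: power2_eq_square)
  qed
  \<comment> \<open>At \<open>0\<close> this holds by definition, and elsewhere the Wronskian has no zeros.\<close>
  have pnz: "p z \<noteq> 0" if "z \<in> ball 0 R" for z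
  proof (cases "z = 0")
    case False
    then show ?thesis using eq[of "Ln z"] that c X(2)[of z] R by auto
  qed (simp add: p_def)
  define u where "u z = c * X z / p z" for z
  have u: "u holomorphic_on ball 0 R" unfolding u_def
    using pnz R by (intro holomorphic_intros holp holomorphic_on_subset[OF X(1)]) auto
  have unz: "u z \<noteq> 0" if "z \<in> ball 0 R" for z
    using that c X(2)[of z] pnz[OF that] R by (simp add: u_def)
  have sq: "(\<psi> \<xi>)\<^sup>2 = exp (of_real \<kappa> * \<xi>) * u (exp \<xi>)" if \<xi>: "exp \<xi> \<in> ball 0 R" for \<xi>
    using eq[OF \<xi>] pnz[OF \<xi>] by (simp add: u_def field_simps)
  have eps_exp: "of_real \<epsilon> = exp (\<i> * of_real (pi * \<kappa>))"
    by (rule square_root_multiplier[OF hol(1) shift(1) R(1,2) u unz sq])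
  have u0: "u 0 \<noteq> 0" using unz R by simp
  have "((\<lambda>t::real. (norm (\<psi> (of_real t)))\<^sup>2 / exp (\<kappa> * t) *
      ((1 + Re (h (of_real (exp t))) * (1 / t)) / (2 * pi * \<bar>K\<bar>))) \<longlongrightarrow>
     norm (u 0) * ((1 + Re (h 0) * 0) / (2 * pi * \<bar>K\<bar>))) at_bot"
  proof (intro tendsto_intros norm_square_asymptotics[OF R(1) u sq] tendsto_at_0_along_exp
      holomorphic_on_ball_isCont_0[OF r(3,1)])
    show "((\<lambda>t::real. 1 / t) \<longlongrightarrow> 0) at_bot" by real_asymp
  qed (use K in auto)
  then have "((\<lambda>t::real. W (of_real t) / (- t * exp (\<kappa> * t))) \<longlongrightarrow>
     norm (u 0) * ((1 + Re (h 0) * 0) / (2 * pi * \<bar>K\<bar>))) at_bot"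
  proof (rule Lim_transform_eventually)
    have "\<forall>\<^sub>F t::real in at_bot. exp t < R" using R(1) by real_asymp
    moreover have "\<forall>\<^sub>F t::real in at_bot. t < 0" by (rule eventually_gt_at_bot)
    ultimately show "\<forall>\<^sub>F t::real in at_bot. (norm (\<psi> (of_real t)))\<^sup>2 / exp (\<kappa> * t) *
      ((1 + Re (h (of_real (exp t))) * (1 / t)) / (2 * pi * \<bar>K\<bar>)) = W (of_real t) / (- t * exp (\<kappa> * t))"
    proof eventually_elim
      case (elim t)
      have z: "exp (of_real t) \<in> ball (0::complex) R" using elim by simp
      have H: "of_real t \<in> half_plane" using elim by (simp add: half_plane_def)
      have "t + Re (h (of_real (exp t))) = - 2 * pi * (\<bar>K\<bar> * W (of_real t) / (norm (\<psi> (of_real t)))\<^sup>2)"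
        using r(5)[of "of_real t"] z R(3) Ref[OF H] by (simp add: m1 exp_of_real)
      then have "(norm (\<psi> (of_real t)))\<^sup>2 * (t + Re (h (of_real (exp t)))) = - 2 * pi * (\<bar>K\<bar> * W (of_real t))"
        using nz[OF H] by simp
      moreover have "1 + Re (h (of_real (exp t))) * (1 / t) = (t + Re (h (of_real (exp t)))) / t"
        using elim by (simp add: field_simps)
      ultimately show ?case using K elim by (simp add: field_simps)
    qed
  qed
  then show thesis
    using u0 K eps_exp by (intro that[of "norm (u 0) * ((1 + Re (h 0) * 0) / (2 * pi * \<bar>K\<bar>))"]) auto
qed

text \<open>
  The quotient \<open>q = \<eta>/\<psi>\<close> has modulus less than one and is multiplied by a constant, so
  \<open>q = exp (\<nu> \<xi>) u (exp \<xi>)\<close>. The Wronskian equals \<open>q' \<psi>\<^sup>2\<close>, so the expansion of \<open>q'\<close>, which starts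
  with a positive exponent \<open>d\<close>, yields the expansion \<open>\<psi>\<^sup>2 = exp ((\<kappa> - d) \<xi>) y (exp \<xi>)\<close>. It determines
  \<open>l\<close>, and \<open>K W = \<bar>\<psi>\<bar>\<^sup>2 (1 - \<bar>q\<bar>\<^sup>2)\<close> has the same growth as \<open>\<bar>\<psi>\<bar>\<^sup>2\<close> because the limit of \<open>\<bar>q\<bar>\<close> is
  less than one.
\<close>

lemma elliptic_monodromy:
  fixes K \<kappa> :: real
  assumes hol: "\<psi> holomorphic_on half_plane" "\<eta> holomorphic_on half_plane"
    and l: "norm l = 1"
    and shift: "\<And>\<xi>. \<xi> \<in> half_plane \<Longrightarrow> \<psi> (deck \<xi>) = l * \<psi> \<xi>"
      "\<And>\<xi>. \<xi> \<in> half_plane \<Longrightarrow> \<eta> (deck \<xi>) = cnj l * \<eta> \<xi>"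
    and K: "K > 0"
    and area: "\<And>\<xi>. \<xi> \<in> half_plane \<Longrightarrow> (norm (\<psi> \<xi>))\<^sup>2 - (norm (\<eta> \<xi>))\<^sup>2 = K * W \<xi>"
    and W: "\<And>\<xi>. \<xi> \<in> half_plane \<Longrightarrow> W \<xi> > 0"
    and r0: "0 < r0" "r0 \<le> 1" and X: "X holomorphic_on ball 0 r0" "\<And>z. z \<in> ball 0 r0 \<Longrightarrow> X z \<noteq> 0"
    and wronskian: "\<And>\<xi>. exp \<xi> \<in> ball 0 r0 \<Longrightarrow>
      deriv \<eta> \<xi> * \<psi> \<xi> - \<eta> \<xi> * deriv \<psi> \<xi> = exp (of_real \<kappa> * \<xi>) * X (exp \<xi>)"
  obtains A d where "A > 0" "d > 0" "((\<lambda>t::real. W (of_real t) / exp ((\<kappa> - d) * t)) \<longlongrightarrow> A) at_bot"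
    "l = exp (\<i> * of_real (pi * (\<kappa> - d)))"
proof -
  have less: "norm (\<eta> \<xi>) < norm (\<psi> \<xi>)" if "\<xi> \<in> half_plane" for \<xi>
  proof -
    have "0 < K * W \<xi>" using K W[OF that] by simp
    then have "(norm (\<eta> \<xi>))\<^sup>2 < (norm (\<psi> \<xi>))\<^sup>2" using area[OF that] by linarith
    then show ?thesis by (rule power2_less_imp_less) simp
  qed
  have nz: "\<psi> \<xi> \<noteq> 0" if "\<xi> \<in> half_plane" for \<xi>
    using less[OF that] by (auto simp: not_less[symmetric])
  define q where "q \<xi> = \<eta> \<xi> / \<psi> \<xi>" for \<xi>
  have q1: "norm (q \<xi>) < 1" if "\<xi> \<in> half_plane" for \<xi>
    using less[OF that] nz[OF that] by (simp add: q_def norm_divide)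
  have holq: "q holomorphic_on half_plane" unfolding q_def by (intro holomorphic_intros hol nz)
  have dq: "(q has_field_derivative exp (of_real \<kappa> * \<xi>) * X (exp \<xi>) / (\<psi> \<xi>)\<^sup>2) (at \<xi>)"
    if \<xi>: "exp \<xi> \<in> ball 0 r0" for \<xi>
  proof -
    have H: "\<xi> \<in> half_plane" by (rule exp_in_small_ball[OF \<xi> r0(2)])
    have d: "(\<psi> has_field_derivative deriv \<psi> \<xi>) (at \<xi>)" "(\<eta> has_field_derivative deriv \<eta> \<xi>) (at \<xi>)"
      using holomorphic_derivI[OF hol(1) open_half_plane H] holomorphic_derivI[OF hol(2) open_half_plane H] .
    show ?thesis
      unfolding wronskian[OF \<xi>, symmetric] power2_eq_square q_def by (intro DERIV_divide d nz H)
  qed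
  have "\<exists>\<xi>0\<in>half_plane. q \<xi>0 \<noteq> 0"
  proof (rule ccontr)
    assume "\<not> (\<exists>\<xi>0\<in>half_plane. q \<xi>0 \<noteq> 0)"
    then have 0: "q \<xi> = 0" if "\<xi> \<in> half_plane" for \<xi> using that by blast
    obtain \<xi> where \<xi>: "exp \<xi> \<in> ball (0::complex) r0" using exists_exp_in_ball[OF r0(1)] by blast
    have H: "\<xi> \<in> half_plane" by (rule exp_in_small_ball[OF \<xi> r0(2)])
    have "(q has_field_derivative 0) (at \<xi>)"
      by (rule has_field_derivative_transform_within_open[OF DERIV_const open_half_plane H]) (simp add: 0)
    from DERIV_unique[OF this dq[OF \<xi>]] show False using X(2)[OF \<xi>] nz[OF H] by simp
  qed
  then obtain \<xi>0 where \<xi>0: "\<xi>0 \<in> half_plane" "q \<xi>0 \<noteq> 0" by blast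
  define \<mu> where "\<mu> = - Arg l / pi"
  have lne: "l \<noteq> 0" using l by auto
  have lexp: "l = exp (\<i> * of_real (Arg l))" using Arg_eq[OF lne] l by simp
  have cl: "cnj l = 1 / l" using l lne by (simp add: divide_conv_cnj)
  have expmu: "exp (2 * of_real pi * \<i> * of_real \<mu>) = cnj l / l"
  proof -
    have "2 * of_real pi * \<i> * of_real \<mu> = - (\<i> * of_real (Arg l)) - \<i> * of_real (Arg l)"
      by (simp add: \<mu>_def)
    then show ?thesis unfolding cl by (simp only: exp_diff exp_minus lexp[symmetric]) (simp add: field_simps)
  qed
  obtain \<nu> r u where r: "0 < r" "r \<le> 1" "u holomorphic_on ball 0 r" "\<nu> \<ge> 0"
    "\<And>z. z \<in> ball 0 r \<Longrightarrow> u z \<noteq> 0"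
    "\<And>\<xi>. exp \<xi> \<in> ball 0 r \<Longrightarrow> q \<xi> = exp (of_real \<nu> * \<xi>) * u (exp \<xi>)"
  proof (rule bounded_quasi_periodic_expansion[OF holq _ _ \<xi>0, where \<mu>=\<mu> and B=1])
    show "q (deck \<xi>) = exp (2 * of_real pi * \<i> * of_real \<mu>) * q \<xi>" if "\<xi> \<in> half_plane" for \<xi>
      unfolding q_def shift[OF that] expmu by simp
  qed (use q1 in \<open>auto intro: less_imp_le\<close>)
  define R where "R = min r r0"
  have R: "0 < R" "R \<le> 1" "R \<le> r" "R \<le> r0" using r r0 by (auto simp: R_def)
  define p where "p z = of_real \<nu> * u z + z * deriv u z" for z
  have holp: "p holomorphic_on ball 0 R" unfolding p_def
    using r(3) R by (intro holomorphic_intros) (auto intro: holomorphic_on_subset)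
  have eq: "(\<psi> \<xi>)\<^sup>2 * (exp (of_real \<nu> * \<xi>) * p (exp \<xi>)) = exp (of_real \<kappa> * \<xi>) * X (exp \<xi>)"
    if \<xi>: "exp \<xi> \<in> ball 0 R" for \<xi>
  proof -
    have H: "\<xi> \<in> half_plane" by (rule exp_in_small_ball[OF \<xi> R(2)])
    have z: "exp \<xi> \<in> ball 0 r" "exp \<xi> \<in> ball 0 r0" using \<xi> R by auto
    have "((\<lambda>\<xi>. exp (of_real \<nu> * \<xi>) * u (exp \<xi>)) has_field_derivative exp (of_real \<nu> * \<xi>) * p (exp \<xi>)) (at \<xi>)"
    proof -
      have "(u has_field_derivative deriv u (exp \<xi>)) (at (exp \<xi>))"
        by (rule holomorphic_derivI[OF r(3) open_ball z(1)])
      from DERIV_chain2[OF this DERIV_exp]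
      show ?thesis by (auto intro!: derivative_eq_intros simp: p_def algebra_simps)
    qed
    then have d1: "(q has_field_derivative exp (of_real \<nu> * \<xi>) * p (exp \<xi>)) (at \<xi>)"
      by (rule has_field_derivative_transform_within_open[where S="{\<xi>. exp \<xi> \<in> ball 0 r}"])
        (use exp_preimage_ball[OF r(1)] z(1) r(6) in auto)
    from DERIV_unique[OF d1 dq[OF z(2)]] show ?thesis using nz[OF H] by simp
  qed
  \<comment> \<open>The Wronskian has no zeros near the origin.\<close>
  have pnz: "p z \<noteq> 0" if "z \<in> ball 0 R" "z \<noteq> 0" for z
    using eq[of "Ln z"] that X(2)[of z] R by auto
  obtain z1 where z1: "z1 \<in> ball (0::complex) R" "p z1 \<noteq> 0"
    using exists_exp_in_ball[OF R(1)] pnz exp_not_eq_zero by metis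
  obtain n :: nat and s v where s: "0 < s" "s \<le> R" "v holomorphic_on ball 0 s"
    "\<And>z. z \<in> ball 0 s \<Longrightarrow> p z = z ^ n * v z \<and> v z \<noteq> 0"
    using holomorphic_factor_at_0[OF holp z1] by metis
  define d where "d = \<nu> + of_nat n"
  \<comment> \<open>If \<open>\<nu> = 0\<close>, then \<open>p\<close> vanishes at \<open>0\<close>.\<close>
  have d: "d > 0"
  proof (cases "\<nu> = 0")
    case True
    then have "p 0 = 0" by (simp add: p_def)
    then have "n \<noteq> 0" using s(4)[of 0] s(1) by (auto intro: ccontr)
    then show ?thesis using True by (simp add: d_def)
  qed (use r(4) in \<open>simp add: d_def\<close>)
  define y where "y z = X z / v z" for z
  have s1: "s \<le> 1" "s \<le> r0" "s \<le> r" using s R by auto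
  have y: "y holomorphic_on ball 0 s" unfolding y_def
    using s s1 by (intro holomorphic_intros holomorphic_on_subset[OF X(1)]) auto
  have ynz: "y z \<noteq> 0" if "z \<in> ball 0 s" for z
    using that X(2)[of z] s(4)[OF that] s1 by (simp add: y_def)
  have sq: "(\<psi> \<xi>)\<^sup>2 = exp (of_real (\<kappa> - d) * \<xi>) * y (exp \<xi>)" if \<xi>: "exp \<xi> \<in> ball 0 s" for \<xi>
  proof -
    have e: "exp (of_real \<nu> * \<xi>) * p (exp \<xi>) = exp (of_real d * \<xi>) * v (exp \<xi>)"
      using s(4)[OF \<xi>] by (simp add: d_def distrib_right exp_add exp_of_nat_mult)
    have "exp \<xi> \<in> ball 0 R" using \<xi> s by auto
    from eq[OF this] have "(\<psi> \<xi>)\<^sup>2 * (exp (of_real d * \<xi>) * v (exp \<xi>)) = exp (of_real \<kappa> * \<xi>) * X (exp \<xi>)"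
      unfolding e .
    then show ?thesis using s(4)[OF \<xi>] by (simp add: y_def left_diff_distrib exp_diff field_simps)
  qed
  have l_exp: "l = exp (\<i> * of_real (pi * (\<kappa> - d)))"
    by (rule square_root_multiplier[OF hol(1) shift(1) s(1) s1(1) y ynz sq])
  obtain L where L: "L < 1" "((\<lambda>t::real. (norm (q (of_real t)))\<^sup>2) \<longlongrightarrow> L) at_bot"
  proof -
    have lim_u: "((\<lambda>t::real. u (of_real (exp t))) \<longlongrightarrow> u 0) at_bot"
      by (intro tendsto_at_0_along_exp holomorphic_on_ball_isCont_0[OF r(3,1)])
    have ev: "\<forall>\<^sub>F t::real in at_bot. exp (\<nu> * t) * norm (u (of_real (exp t))) = norm (q (of_real t))"
    proof -
      have "\<forall>\<^sub>F t::real in at_bot. exp t < r" using r(1) by real_asymp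
      then show ?thesis
      proof eventually_elim
        case (elim t)
        have "exp (of_real t) \<in> ball (0::complex) r" using elim by simp
        from r(6)[OF this] show ?case by (simp add: norm_mult exp_of_real)
      qed
    qed
    show thesis
    proof (cases "\<nu> = 0")
      case True
      have u1: "norm (u z) < 1" if "z \<in> ball 0 r" "z \<noteq> 0" for z
        using r(6)[of "Ln z"] q1[of "Ln z"] exp_in_small_ball[of "Ln z" r] that r(2) True by simp
      have "norm (u 0) < 1"
      proof (rule ccontr)
        assume not: "\<not> norm (u 0) < 1"
        \<comment> \<open>On the ball \<open>\<bar>u\<bar>\<close> is then maximal at the interior point \<open>0\<close>.\<close>
        have "u constant_on ball 0 r"
        proof (rule maximum_modulus_principle[OF r(3) open_ball connected_ball open_ball subset_refl])
          show "0 \<in> ball (0::complex) r" using r(1) by simp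
          show "norm (u z) \<le> norm (u 0)" if "z \<in> ball 0 r" for z
            using u1[OF that] not by (cases "z = 0") auto
        qed
        moreover obtain z :: complex where z: "z \<in> ball 0 r" "z \<noteq> 0"
          using exists_exp_in_ball[OF r(1)] exp_not_eq_zero by blast
        ultimately have "u z = u 0" using r(1) by (auto simp: constant_on_def)
        then show False using u1[OF z] not by simp
      qed
      moreover have "((\<lambda>t::real. norm (q (of_real t))) \<longlongrightarrow> norm (u 0)) at_bot"
        by (rule Lim_transform_eventually[OF tendsto_norm[OF lim_u]]) (use ev True in simp)
      ultimately show thesis
        by (intro that[of "(norm (u 0))\<^sup>2"] tendsto_power) (auto simp: power_less_one_iff abs_square_less_1)
    next
      case False
      then have "\<nu> > 0" using r(4) by simp
      then have "((\<lambda>t::real. exp (\<nu> * t)) \<longlongrightarrow> 0) at_bot" by real_asymp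
      from tendsto_mult[OF this tendsto_norm[OF lim_u]]
      have "((\<lambda>t::real. norm (q (of_real t))) \<longlongrightarrow> 0) at_bot"
        using Lim_transform_eventually[OF _ ev] by simp
      from tendsto_power[OF this, of 2] show thesis by (intro that[of 0]) auto
    qed
  qed
  have "((\<lambda>t::real. (norm (\<psi> (of_real t)))\<^sup>2 / exp ((\<kappa> - d) * t) * ((1 - (norm (q (of_real t)))\<^sup>2) / K))
     \<longlongrightarrow> norm (y 0) * ((1 - L) / K)) at_bot"
    by (intro tendsto_intros norm_square_asymptotics[OF s(1) y sq] L(2)) (use K in auto)
  then have "((\<lambda>t::real. W (of_real t) / exp ((\<kappa> - d) * t)) \<longlongrightarrow> norm (y 0) * ((1 - L) / K)) at_bot"
  proof (rule Lim_transform_eventually)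
    have "\<forall>\<^sub>F t::real in at_bot. t < 0" by (rule eventually_gt_at_bot)
    then show "\<forall>\<^sub>F t::real in at_bot. (norm (\<psi> (of_real t)))\<^sup>2 / exp ((\<kappa> - d) * t) * ((1 - (norm (q (of_real t)))\<^sup>2) / K)
        = W (of_real t) / exp ((\<kappa> - d) * t)"
    proof eventually_elim
      case (elim t)
      have H: "of_real t \<in> half_plane" using elim by (simp add: half_plane_def)
      have "(norm (\<psi> (of_real t)))\<^sup>2 * (1 - (norm (q (of_real t)))\<^sup>2) = K * W (of_real t)"
        unfolding area[OF H, symmetric] using nz[OF H] by (simp add: q_def norm_divide power_divide field_simps)
      then show ?case using K by (simp only: times_divide_times_eq) simp
    qed
  qed
  moreover have "norm (y 0) * ((1 - L) / K) > 0" using ynz[of 0] s(1) L(1) K by simp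
  ultimately show thesis using d l_exp by (intro that)
qed

section \<open>The trace of the monodromy\<close>

text \<open>
  Growth at the puncture in the variable \<open>t = ln \<bar>z\<bar>\<close>, with \<open>\<kappa>\<close> in the role of \<open>N + 1\<close>: either like
  \<open>\<bar>z\<bar> powr \<beta>\<close> with \<open>\<beta> < \<kappa>\<close>, or like \<open>- \<bar>z\<bar> powr \<kappa> ln \<bar>z\<bar>\<close>.
\<close>

definition has_growth :: "(real \<Rightarrow> real) \<Rightarrow> real \<Rightarrow> real \<Rightarrow> bool" where
  "has_growth f \<beta> \<kappa> \<longleftrightarrow> (\<exists>C>0.
     (\<beta> < \<kappa> \<and> ((\<lambda>t. f t / exp (\<beta> * t)) \<longlongrightarrow> C) at_bot) \<or>
     (\<beta> = \<kappa> \<and> ((\<lambda>t. f t / (- t * exp (\<kappa> * t))) \<longlongrightarrow> C) at_bot))"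

lemma has_growth_power_unique:
  assumes "has_growth f \<beta> \<kappa>" and lim: "((\<lambda>t. f t / exp ((\<kappa> - d) * t)) \<longlongrightarrow> A) at_bot"
    and "A > 0" "d > 0"
  shows "\<beta> = \<kappa> - d"
proof -
  obtain C where "C > 0" and C: "(\<beta> < \<kappa> \<and> ((\<lambda>t. f t / exp (\<beta> * t)) \<longlongrightarrow> C) at_bot) \<or>
     (\<beta> = \<kappa> \<and> ((\<lambda>t. f t / (- t * exp (\<kappa> * t))) \<longlongrightarrow> C) at_bot)"
    using assms(1) by (auto simp: has_growth_def)
  from C show ?thesis
  proof
    assume "\<beta> = \<kappa> \<and> ((\<lambda>t. f t / (- t * exp (\<kappa> * t))) \<longlongrightarrow> C) at_bot"
    then have "((\<lambda>t. f t / (- t * exp (\<kappa> * t))) \<longlongrightarrow> C) at_bot" by simp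
    moreover have "((\<lambda>t::real. - t * exp (d * t)) \<longlongrightarrow> 0) at_bot" using \<open>d > 0\<close> by real_asymp
    ultimately have "((\<lambda>t. f t / (- t * exp (\<kappa> * t)) * (- t * exp (d * t))) \<longlongrightarrow> C * 0) at_bot"
      by (rule tendsto_mult)
    moreover have "\<forall>\<^sub>F t in at_bot. f t / (- t * exp (\<kappa> * t)) * (- t * exp (d * t)) = f t / exp ((\<kappa> - d) * t)"
      using eventually_gt_at_bot[of 0]
      by eventually_elim (simp add: left_diff_distrib exp_diff field_simps mult_exp_exp)
    ultimately have "((\<lambda>t. f t / exp ((\<kappa> - d) * t)) \<longlongrightarrow> C * 0) at_bot"
      by (rule Lim_transform_eventually)
    from tendsto_unique[OF _ this lim] show ?thesis using \<open>A > 0\<close> by simp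
  next
    assume *: "\<beta> < \<kappa> \<and> ((\<lambda>t. f t / exp (\<beta> * t)) \<longlongrightarrow> C) at_bot"
    define s where "s = \<beta> - (\<kappa> - d)"
    have eq: "f t / exp ((\<kappa> - d) * t) = f t / exp (\<beta> * t) * exp (s * t)" for t
      by (simp add: s_def left_diff_distrib exp_diff field_simps mult_exp_exp)
    consider "s = 0" | "s > 0" | "s < 0" by linarith
    then show ?thesis
    proof cases
      case 2
      then have "((\<lambda>t::real. exp (s * t)) \<longlongrightarrow> 0) at_bot" by real_asymp
      from tendsto_mult[OF conjunct2[OF *] this]
      have "((\<lambda>t. f t / exp ((\<kappa> - d) * t)) \<longlongrightarrow> C * 0) at_bot" unfolding eq .
      from tendsto_unique[OF _ this lim] show ?thesis using \<open>A > 0\<close> by simp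
    next
      case 3
      then have "filterlim (\<lambda>t::real. exp (s * t)) at_top at_bot" by real_asymp
      from filterlim_tendsto_pos_mult_at_top[OF conjunct2[OF *] \<open>C > 0\<close> this]
      have "filterlim (\<lambda>t. f t / exp ((\<kappa> - d) * t)) at_top at_bot" unfolding eq .
      then show ?thesis using lim not_tendsto_and_filterlim_at_infinity[OF _ lim] filterlim_at_top_imp_at_infinity
        by (metis trivial_limit_at_bot_linorder)
    qed (simp add: s_def)
  qed
qed

lemma has_growth_log_unique:
  assumes "has_growth f \<beta> \<kappa>" and lim: "((\<lambda>t. f t / (- t * exp (\<kappa> * t))) \<longlongrightarrow> A) at_bot"
  shows "\<beta> = \<kappa>"
proof (rule ccontr)
  assume "\<beta> \<noteq> \<kappa>"
  then obtain C where "C > 0" "\<beta> < \<kappa>" and C: "((\<lambda>t. f t / exp (\<beta> * t)) \<longlongrightarrow> C) at_bot"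
    using assms(1) by (auto simp: has_growth_def)
  have "((\<lambda>t::real. - t * exp ((\<kappa> - \<beta>) * t)) \<longlongrightarrow> 0) at_bot" using \<open>\<beta> < \<kappa>\<close> by real_asymp
  from tendsto_mult[OF lim this]
  have "((\<lambda>t. f t / (- t * exp (\<kappa> * t)) * (- t * exp ((\<kappa> - \<beta>) * t))) \<longlongrightarrow> A * 0) at_bot" .
  moreover have "\<forall>\<^sub>F t in at_bot. f t / (- t * exp (\<kappa> * t)) * (- t * exp ((\<kappa> - \<beta>) * t)) = f t / exp (\<beta> * t)"
    using eventually_gt_at_bot[of 0]
    by eventually_elim (simp add: left_diff_distrib exp_diff field_simps mult_exp_exp)
  ultimately have "((\<lambda>t. f t / exp (\<beta> * t)) \<longlongrightarrow> A * 0) at_bot"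
    by (rule Lim_transform_eventually)
  from tendsto_unique[OF _ this C] show False using \<open>C > 0\<close> by simp
qed

lemma wronskian_of_combinations:
  assumes "(\<phi> has_field_derivative \<phi>') (at \<xi>)" "(\<psi> has_field_derivative \<psi>') (at \<xi>)"
  shows "deriv (\<lambda>\<xi>. \<psi> \<xi> - q * \<phi> \<xi>) \<xi> * (\<psi> \<xi> - p * \<phi> \<xi>) - (\<psi> \<xi> - q * \<phi> \<xi>) * deriv (\<lambda>\<xi>. \<psi> \<xi> - p * \<phi> \<xi>) \<xi>
    = (q - p) * (\<phi> \<xi> * \<psi>' - \<psi> \<xi> * \<phi>')"
proof -
  have d: "deriv (\<lambda>\<xi>. \<psi> \<xi> - k * \<phi> \<xi>) \<xi> = \<psi>' - k * \<phi>'" for k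
    by (rule DERIV_imp_deriv) (intro DERIV_diff DERIV_cmult assms)
  show ?thesis unfolding d by (simp add: algebra_simps)
qed

text \<open>
  As a function of \<open>(x, y)\<close> the area \<open>Im (cnj x y)\<close> is a hermitian form of signature \<open>(1, 1)\<close>; this is
  its diagonal form.
\<close>

lemma norm_square_difference:
  "(norm (y - cnj l * x))\<^sup>2 - (norm (y - l * x))\<^sup>2 = 4 * Im l * Im (cnj x * y)"
  unfolding cmod_power2 by (simp add: power2_eq_square algebra_simps)

text \<open>
  The functions \<open>\<psi> - cnj k \<phi>\<close> and \<open>\<psi> - k \<phi>\<close> are the denominator and the numerator of a Cayley transform
  of \<open>\<psi>/\<phi>\<close>, centred at the fixed point \<open>k\<close> of the monodromy.
\<close>

lemma elliptic_trace:
  fixes c \<kappa> \<beta> :: real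
  assumes hol: "\<phi> holomorphic_on half_plane" "\<psi> holomorphic_on half_plane"
    and l: "norm l = 1" and c: "Im k * c > 0"
    and shift: "\<And>\<xi>. \<xi> \<in> half_plane \<Longrightarrow> \<psi> (deck \<xi>) - cnj k * \<phi> (deck \<xi>)
          = l * (\<psi> \<xi> - cnj k * \<phi> \<xi>)"
      "\<And>\<xi>. \<xi> \<in> half_plane \<Longrightarrow> \<psi> (deck \<xi>) - k * \<phi> (deck \<xi>)
          = cnj l * (\<psi> \<xi> - k * \<phi> \<xi>)"
    and area: "\<And>\<xi>. \<xi> \<in> half_plane \<Longrightarrow> Im (cnj (\<phi> \<xi>) * \<psi> \<xi>) = c * W \<xi>"
    and W: "\<And>\<xi>. \<xi> \<in> half_plane \<Longrightarrow> W \<xi> > 0"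
    and r0: "0 < r0" "r0 \<le> 1" and X: "X holomorphic_on ball 0 r0" "\<And>z. z \<in> ball 0 r0 \<Longrightarrow> X z \<noteq> 0"
    and wronskian: "\<And>\<xi>. exp \<xi> \<in> ball 0 r0 \<Longrightarrow>
      \<phi> \<xi> * deriv \<psi> \<xi> - \<psi> \<xi> * deriv \<phi> \<xi> = exp (of_real \<kappa> * \<xi>) * X (exp \<xi>)"
    and growth: "has_growth (\<lambda>t. W (of_real t)) \<beta> \<kappa>"
  shows "Re l = cos (pi * \<beta>)"
proof -
  have k0: "k - cnj k \<noteq> 0" using c by (auto simp: complex_eq_iff)
  obtain A d where *: "A > 0" "d > 0" "((\<lambda>t::real. W (of_real t) / exp ((\<kappa> - d) * t)) \<longlongrightarrow> A) at_bot"
    "l = exp (\<i> * of_real (pi * (\<kappa> - d)))"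
  proof (rule elliptic_monodromy[where \<psi>="\<lambda>\<xi>. \<psi> \<xi> - cnj k * \<phi> \<xi>" and \<eta>="\<lambda>\<xi>. \<psi> \<xi> - k * \<phi> \<xi>" and l=l
        and K="4 * (Im k * c)" and W=W and ?r0.0=r0 and X="\<lambda>z. (k - cnj k) * X z" and \<kappa>=\<kappa>])
    show "(\<lambda>\<xi>. \<psi> \<xi> - cnj k * \<phi> \<xi>) holomorphic_on half_plane"
      "(\<lambda>\<xi>. \<psi> \<xi> - k * \<phi> \<xi>) holomorphic_on half_plane"
      by (intro holomorphic_intros hol)+
    show "0 < 4 * (Im k * c)" using c by simp
    show "(norm (\<psi> \<xi> - cnj k * \<phi> \<xi>))\<^sup>2 - (norm (\<psi> \<xi> - k * \<phi> \<xi>))\<^sup>2 = 4 * (Im k * c) * W \<xi>"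
      if "\<xi> \<in> half_plane" for \<xi>
      unfolding norm_square_difference area[OF that] by simp
    show "(\<lambda>z. (k - cnj k) * X z) holomorphic_on ball 0 r0" by (intro holomorphic_intros X)
    show "(k - cnj k) * X z \<noteq> 0" if "z \<in> ball 0 r0" for z using k0 X(2)[OF that] by simp
    fix \<xi> :: complex assume \<xi>: "exp \<xi> \<in> ball 0 r0"
    have H: "\<xi> \<in> half_plane" by (rule exp_in_small_ball[OF \<xi> r0(2)])
    show "deriv (\<lambda>\<xi>. \<psi> \<xi> - k * \<phi> \<xi>) \<xi> * (\<psi> \<xi> - cnj k * \<phi> \<xi>) - (\<psi> \<xi> - k * \<phi> \<xi>) * deriv (\<lambda>\<xi>. \<psi> \<xi> - cnj k * \<phi> \<xi>) \<xi>
       = exp (of_real \<kappa> * \<xi>) * ((k - cnj k) * X (exp \<xi>))"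
      unfolding wronskian_of_combinations[OF holomorphic_derivI[OF hol(1) open_half_plane H]
          holomorphic_derivI[OF hol(2) open_half_plane H]] wronskian[OF \<xi>] by simp
  qed (use l shift W r0 in auto)
  have "\<beta> = \<kappa> - d" by (rule has_growth_power_unique[OF growth *(3,1,2)])
  then have "l = exp (\<i> * of_real (pi * \<beta>))" using *(4) by simp
  then show ?thesis by (simp add: Re_exp)
qed

text \<open>
  In a basis that consists of a cyclic vector and its image the monodromy is the companion matrix
  of \<open>x\<^sup>2 - t x + 1\<close>, and \<open>\<psi> - \<phi>/r\<close> is an eigenvector for each root \<open>r\<close>. The cases are
  distinguished by the discriminant \<open>t\<^sup>2 - 4\<close>.
\<close>

lemma companion_monodromy_trace:
  fixes c t \<kappa> \<beta> :: real
  assumes hol: "\<phi> holomorphic_on half_plane" "\<psi> holomorphic_on half_plane"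
    and shift: "\<And>\<xi>. \<xi> \<in> half_plane \<Longrightarrow> \<phi> (deck \<xi>) = \<psi> \<xi>"
      "\<And>\<xi>. \<xi> \<in> half_plane \<Longrightarrow> \<psi> (deck \<xi>) = of_real t * \<psi> \<xi> - \<phi> \<xi>"
    and c: "c \<noteq> 0"
    and area: "\<And>\<xi>. \<xi> \<in> half_plane \<Longrightarrow> Im (cnj (\<phi> \<xi>) * \<psi> \<xi>) = c * W \<xi>"
    and W: "\<And>\<xi>. \<xi> \<in> half_plane \<Longrightarrow> W \<xi> > 0"
    and r0: "0 < r0" "r0 \<le> 1" and X: "X holomorphic_on ball 0 r0" "\<And>z. z \<in> ball 0 r0 \<Longrightarrow> X z \<noteq> 0"
    and wronskian: "\<And>\<xi>. exp \<xi> \<in> ball 0 r0 \<Longrightarrow>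
      \<phi> \<xi> * deriv \<psi> \<xi> - \<psi> \<xi> * deriv \<phi> \<xi> = exp (of_real \<kappa> * \<xi>) * X (exp \<xi>)"
    and growth: "has_growth (\<lambda>t. W (of_real t)) \<beta> \<kappa>"
  shows "t = 2 * cos (pi * \<beta>)"
proof -
  consider "t\<^sup>2 < 4" | "t\<^sup>2 = 4" | "t\<^sup>2 > 4" by linarith
  then show ?thesis
  proof cases
    case 1
    \<comment> \<open>The sign of the imaginary part selects the fixed point in the half-plane where \<open>w\<close> is positive.\<close>
    define l where "l = Complex (t / 2) (sgn c * sqrt (1 - (t / 2)\<^sup>2))"
    have pos: "1 - (t / 2)\<^sup>2 > 0" using 1 by (simp add: power_divide)
    have "(norm l)\<^sup>2 = 1"
      using pos c by (simp add: l_def cmod_power2 power_mult_distrib sgn_if)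
    then have nl: "norm l = 1" by (simp add: power2_eq_1_iff) (use norm_ge_zero[of l] in linarith)
    have lc: "l * cnj l = 1" using nl by (simp add: complex_norm_square[symmetric])
    have tl: "of_real t = l + cnj l" by (simp add: complex_add_cnj l_def)
    have imc: "Im l * c > 0"
    proof -
      have "Im l * c = \<bar>c\<bar> * sqrt (1 - (t / 2)\<^sup>2)" by (simp add: l_def abs_sgn)
      also have "\<dots> > 0" using c pos by simp
      finally show ?thesis .
    qed
    have "Re l = cos (pi * \<beta>)"
    proof (rule elliptic_trace[OF hol nl imc _ _ area W r0 X wronskian growth])
      fix \<xi> assume H: "\<xi> \<in> half_plane"
      have e: "of_real t * x - y - k * x = m * (x - k * y)" if "of_real t = m + k" "m * k = 1" for x y k m :: complex
      proof -
        have "m * (x - k * y) = m * x - m * k * y" by (simp add: right_diff_distrib)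
        then show ?thesis using that by (simp add: algebra_simps)
      qed
      show "\<psi> (deck \<xi>) - cnj l * \<phi> (deck \<xi>) = l * (\<psi> \<xi> - cnj l * \<phi> \<xi>)"
        unfolding shift[OF H] by (rule e[OF tl lc])
      show "\<psi> (deck \<xi>) - l * \<phi> (deck \<xi>) = cnj l * (\<psi> \<xi> - l * \<phi> \<xi>)"
        unfolding shift[OF H] by (rule e) (use tl lc in \<open>simp_all add: add.commute mult.commute\<close>)
    qed
    then show ?thesis by (simp add: l_def)
  next
    case 2
    define \<epsilon> where "\<epsilon> = t / 2"
    have "\<epsilon>\<^sup>2 = 1" using 2 by (simp add: \<epsilon>_def power_divide)
    then have eps: "\<epsilon> = 1 \<or> \<epsilon> = -1" by (simp add: power2_eq_1_iff)
    obtain A where A: "((\<lambda>t::real. W (of_real t) / (- t * exp (\<kappa> * t))) \<longlongrightarrow> A) at_bot"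
      and e: "of_real \<epsilon> = exp (\<i> * of_real (pi * \<kappa>))"
    proof (rule parabolic_monodromy[where \<psi>="\<lambda>\<xi>. \<psi> \<xi> - of_real \<epsilon> * \<phi> \<xi>" and \<eta>=\<phi> and \<epsilon>=\<epsilon>
          and K="- c" and W=W and ?r0.0=r0 and X="\<lambda>z. - X z" and \<kappa>=\<kappa>])
      show "(\<lambda>\<xi>. \<psi> \<xi> - of_real \<epsilon> * \<phi> \<xi>) holomorphic_on half_plane" by (intro holomorphic_intros hol)
      show "\<psi> (deck \<xi>) - of_real \<epsilon> * \<phi> (deck \<xi>) = of_real \<epsilon> * (\<psi> \<xi> - of_real \<epsilon> * \<phi> \<xi>)"
        "\<phi> (deck \<xi>) = of_real \<epsilon> * \<phi> \<xi> + (\<psi> \<xi> - of_real \<epsilon> * \<phi> \<xi>)"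
        if "\<xi> \<in> half_plane" for \<xi>
        unfolding shift[OF that] using eps by (auto simp: \<epsilon>_def algebra_simps)
      have im: "Im (cnj (y - of_real e * x) * x) = - Im (cnj x * y)" for x y e
        by (simp add: algebra_simps)
      show "Im (cnj (\<psi> \<xi> - of_real \<epsilon> * \<phi> \<xi>) * \<phi> \<xi>) = - c * W \<xi>" if "\<xi> \<in> half_plane" for \<xi>
        unfolding im area[OF that] by simp
      show "(\<lambda>z. - X z) holomorphic_on ball 0 r0" by (intro holomorphic_intros X)
      fix \<xi> :: complex assume \<xi>: "exp \<xi> \<in> ball 0 r0"
      have H: "\<xi> \<in> half_plane" by (rule exp_in_small_ball[OF \<xi> r0(2)])
      have d: "deriv (\<lambda>\<xi>. \<psi> \<xi> - of_real \<epsilon> * \<phi> \<xi>) \<xi> = deriv \<psi> \<xi> - of_real \<epsilon> * deriv \<phi> \<xi>"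
        by (rule DERIV_imp_deriv) (intro DERIV_diff DERIV_cmult holomorphic_derivI[OF _ open_half_plane H] hol)
      have "deriv \<phi> \<xi> * (\<psi> \<xi> - of_real \<epsilon> * \<phi> \<xi>) - \<phi> \<xi> * deriv (\<lambda>\<xi>. \<psi> \<xi> - of_real \<epsilon> * \<phi> \<xi>) \<xi>
         = - (\<phi> \<xi> * deriv \<psi> \<xi> - \<psi> \<xi> * deriv \<phi> \<xi>)"
        unfolding d by (simp add: algebra_simps)
      then show "deriv \<phi> \<xi> * (\<psi> \<xi> - of_real \<epsilon> * \<phi> \<xi>) - \<phi> \<xi> * deriv (\<lambda>\<xi>. \<psi> \<xi> - of_real \<epsilon> * \<phi> \<xi>) \<xi>
         = exp (of_real \<kappa> * \<xi>) * - X (exp \<xi>)" unfolding wronskian[OF \<xi>] by simp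
    qed (use hol eps c W r0 X in auto)
    have "\<beta> = \<kappa>" by (rule has_growth_log_unique[OF growth A])
    then have "\<epsilon> = cos (pi * \<beta>)" using arg_cong[OF e, of Re] by (simp add: Re_exp)
    then show ?thesis by (simp add: \<epsilon>_def)
  next
    case 3
    define r where "r = (t + sqrt (t\<^sup>2 - 4)) / 2"
    have "r * r - t * r + 1 = 0"
      using 3 real_sqrt_pow2[of "t\<^sup>2 - 4"] unfolding r_def power2_eq_square by (simp add: field_simps)
    then have rr: "r * (t - r) = 1" by (simp add: algebra_simps)
    have r: "r \<noteq> 0" using rr by auto
    have tr: "t = r + 1 / r" using rr r by (simp add: field_simps)
    have r1: "\<bar>r\<bar> \<noteq> 1"
    proof
      assume "\<bar>r\<bar> = 1"
      then have "t = 2 \<or> t = -2" using tr by (auto simp: abs_if split: if_splits)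
      then show False using 3 by auto
    qed
    have False
    proof (rule hyperbolic_monodromy_impossible[where \<psi>="\<lambda>\<xi>. \<psi> \<xi> - of_real (1 / r) * \<phi> \<xi>"
          and \<eta>="\<lambda>\<xi>. \<psi> \<xi> - of_real r * \<phi> \<xi>" and r=r and K="(r - 1 / r) * c" and W=W])
      show "(\<lambda>\<xi>. \<psi> \<xi> - of_real (1 / r) * \<phi> \<xi>) holomorphic_on half_plane"
        "(\<lambda>\<xi>. \<psi> \<xi> - of_real r * \<phi> \<xi>) holomorphic_on half_plane" by (intro holomorphic_intros hol)+
      show "\<psi> (deck \<xi>) - of_real (1 / r) * \<phi> (deck \<xi>) = of_real r * (\<psi> \<xi> - of_real (1 / r) * \<phi> \<xi>)"
        "\<psi> (deck \<xi>) - of_real r * \<phi> (deck \<xi>) = (\<psi> \<xi> - of_real r * \<phi> \<xi>) / of_real r"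
        if "\<xi> \<in> half_plane" for \<xi>
        unfolding shift[OF that] tr using r by (simp_all add: field_simps)
      have im: "Im (cnj (y - of_real p * x) * (y - of_real q * x)) = (q - p) * Im (cnj x * y)" for x y p q
        by (simp add: algebra_simps)
      show "Im (cnj (\<psi> \<xi> - of_real (1 / r) * \<phi> \<xi>) * (\<psi> \<xi> - of_real r * \<phi> \<xi>)) = (r - 1 / r) * c * W \<xi>"
        if "\<xi> \<in> half_plane" for \<xi>
        unfolding im area[OF that] by simp
      have "r\<^sup>2 \<noteq> 1" using r1 by (auto simp: power2_eq_1_iff)
      then show "(r - 1 / r) * c \<noteq> 0" using c r by (simp add: field_simps power2_eq_square)
    qed (use r r1 W in auto)
    then show ?thesis ..
  qed
qed

text \<open>
  The asymptotic expansion of \<open>w\<close> is read along \<open>z = exp t\<close> with \<open>t\<close> real.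
\<close>

lemma has_growth_along_negative_axis:
  fixes w :: "complex \<Rightarrow> real" and N :: int
  assumes "C > 0"
    and asymptotics:
      "(\<beta> < of_int N + 1 \<and>
        (\<exists>e. e \<in> o[at 0](\<lambda>_. 1) \<and>
          (\<forall>z\<in>punctured_disc. w z = norm z powr \<beta> * (C + e z)))) \<or>
       (\<beta> = of_int N + 1 \<and>
        (\<exists>e. e \<in> o[at 0](\<lambda>_. 1) \<and>
          (\<forall>z\<in>punctured_disc. w z = - (norm z powi (N + 1)) * ln (norm z) * (C + e z))))"
  shows "has_growth (\<lambda>t. w (exp (of_real t))) \<beta> (of_int N + 1)"
proof -
  have lim: "((\<lambda>t::real. C + e (exp (complex_of_real t))) \<longlongrightarrow> C) at_bot" if "e \<in> o[at 0](\<lambda>_. 1)" for e :: "complex \<Rightarrow> real"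
  proof -
    have "(e \<longlongrightarrow> 0) (at 0)" using smalloD_tendsto[OF that] by simp
    moreover have "filterlim (\<lambda>t::real. exp (complex_of_real t)) (at 0) at_bot"
    proof (rule filterlim_atI)
      have "((\<lambda>t::real. exp t) \<longlongrightarrow> 0) at_bot" by real_asymp
      from tendsto_of_real[OF this, where 'a=complex]
      show "((\<lambda>t::real. exp (complex_of_real t)) \<longlongrightarrow> 0) at_bot" by (simp add: exp_of_real)
    qed simp
    ultimately have "((\<lambda>t::real. e (exp (complex_of_real t))) \<longlongrightarrow> 0) at_bot" by (rule filterlim_compose)
    from tendsto_add[OF tendsto_const[of C] this] show ?thesis by simp
  qed
  have mem: "exp (complex_of_real t) \<in> punctured_disc" "norm (exp (complex_of_real t)) = exp t" if "t < 0" for t :: real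
    using that by (simp_all add: punctured_disc_def)
  have neg: "\<forall>\<^sub>F t::real in at_bot. t < 0" by (rule eventually_gt_at_bot)
  from asymptotics show ?thesis
  proof
    assume "\<beta> < of_int N + 1 \<and> (\<exists>e. e \<in> o[at 0](\<lambda>_. 1) \<and> (\<forall>z\<in>punctured_disc. w z = norm z powr \<beta> * (C + e z)))"
    then obtain e where \<beta>: "\<beta> < of_int N + 1" and e: "e \<in> o[at 0](\<lambda>_. 1)"
      and w: "\<And>z. z \<in> punctured_disc \<Longrightarrow> w z = norm z powr \<beta> * (C + e z)" by blast
    have "((\<lambda>t. w (exp (of_real t)) / exp (\<beta> * t)) \<longlongrightarrow> C) at_bot"
    proof (rule Lim_transform_eventually[OF lim[OF e]])
      show "\<forall>\<^sub>F t in at_bot. C + e (exp (complex_of_real t)) = w (exp (of_real t)) / exp (\<beta> * t)"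
        using neg by eventually_elim (simp add: w mem powr_def)
    qed
    then show ?thesis using \<beta> \<open>C > 0\<close> by (auto simp: has_growth_def)
  next
    assume "\<beta> = of_int N + 1 \<and> (\<exists>e. e \<in> o[at 0](\<lambda>_. 1) \<and>
          (\<forall>z\<in>punctured_disc. w z = - (norm z powi (N + 1)) * ln (norm z) * (C + e z)))"
    then obtain e where \<beta>: "\<beta> = of_int N + 1" and e: "e \<in> o[at 0](\<lambda>_. 1)"
      and w: "\<And>z. z \<in> punctured_disc \<Longrightarrow> w z = - (norm z powi (N + 1)) * ln (norm z) * (C + e z)" by blast
    have "((\<lambda>t. w (exp (of_real t)) / (- t * exp ((of_int N + 1) * t))) \<longlongrightarrow> C) at_bot"
    proof (rule Lim_transform_eventually[OF lim[OF e]])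
      show "\<forall>\<^sub>F t in at_bot. C + e (exp (complex_of_real t)) = w (exp (of_real t)) / (- t * exp ((of_int N + 1) * t))"
        using neg
      proof eventually_elim
        case (elim t)
        have "exp t powi (N + 1) = exp ((of_int N + 1) * t)" using exp_power_int[of t "N + 1"] by simp
        then show ?case using elim unfolding w[OF mem(1)[OF elim]] mem(2)[OF elim] by simp
      qed
    qed
    then show ?thesis using \<beta> \<open>C > 0\<close> by (auto simp: has_growth_def)
  qed
qed

lemma flat_form_holomorphic:
  assumes "flat_form a b \<phi>"
  shows "\<phi> holomorphic_on half_plane"
proof (rule holomorphic_onI)
  fix \<xi> assume "\<xi> \<in> half_plane"
  then have "\<phi> field_differentiable (at \<xi>)"
    using assms unfolding flat_form_def field_differentiable_def by blast
  then show "\<phi> field_differentiable (at \<xi> within half_plane)"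
    by (rule field_differentiable_at_within)
qed

text \<open>
  The terms with \<open>a\<close> cancel, and \<open>\<phi> cnj \<psi> - \<psi> cnj \<phi>\<close> is \<open>- 2 i\<close> times the area.
\<close>

lemma flat_form_wronskian:
  assumes flat: "flat_form a b \<phi>" "flat_form a b \<psi>" and \<xi>: "\<xi> \<in> half_plane"
    and area: "Im (cnj (\<phi> \<xi>) * \<psi> \<xi>) = c * v"
  shows "\<phi> \<xi> * deriv \<psi> \<xi> - \<psi> \<xi> * deriv \<phi> \<xi> = of_real (4 * c) * (exp \<xi> * (- (\<i> / 2) * of_real v * b (exp \<xi>)))"
proof -
  have d: "deriv \<phi> \<xi> = exp \<xi> * (a (exp \<xi>) * \<phi> \<xi> + b (exp \<xi>) * cnj (\<phi> \<xi>))"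
    "deriv \<psi> \<xi> = exp \<xi> * (a (exp \<xi>) * \<psi> \<xi> + b (exp \<xi>) * cnj (\<psi> \<xi>))"
    using flat \<xi> unfolding flat_form_def by (auto intro: DERIV_imp_deriv)
  have "\<phi> \<xi> * cnj (\<psi> \<xi>) - \<psi> \<xi> * cnj (\<phi> \<xi>) = - 2 * \<i> * of_real (Im (cnj (\<phi> \<xi>) * \<psi> \<xi>))"
    by (simp add: complex_eq_iff)
  then have e: "\<phi> \<xi> * cnj (\<psi> \<xi>) - \<psi> \<xi> * cnj (\<phi> \<xi>) = - 2 * \<i> * (of_real c * of_real v)"
    unfolding area by simp
  have "\<phi> \<xi> * deriv \<psi> \<xi> - \<psi> \<xi> * deriv \<phi> \<xi> = exp \<xi> * b (exp \<xi>) * (\<phi> \<xi> * cnj (\<psi> \<xi>) - \<psi> \<xi> * cnj (\<phi> \<xi>))"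
    unfolding d by (simp add: algebra_simps)
  then show ?thesis unfolding e by simp
qed

lemma area_bilinear:
  "Im (cnj (of_real p * x + of_real q * y) * (of_real r * x + of_real s * y)) = (p * s - q * r) * Im (cnj x * y)"
  by (simp add: algebra_simps)

text \<open>
  The determinant is one because \<open>w\<close> is single-valued. A matrix of size two either has a cyclic
  vector or is scalar; for a scalar matrix every point of the half-plane is fixed, and
  the Cayley transform can be centred at \<open>i\<close>.
\<close>

lemma flat_coframe_monodromy:
  fixes m11 m12 m21 m22 \<beta> :: real and N :: int
  assumes w: "\<And>z. z \<in> punctured_disc \<Longrightarrow> w z > 0"
    and flat: "flat_form a b \<phi>" "flat_form a b \<psi>"
    and area: "\<And>\<xi>. \<xi> \<in> half_plane \<Longrightarrow> Im (cnj (\<phi> \<xi>) * \<psi> \<xi>) = w (exp \<xi>)"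
    and shift: "\<And>\<xi>. \<xi> \<in> half_plane \<Longrightarrow> \<phi> (deck \<xi>) = of_real m11 * \<phi> \<xi> + of_real m12 * \<psi> \<xi>"
      "\<And>\<xi>. \<xi> \<in> half_plane \<Longrightarrow> \<psi> (deck \<xi>) = of_real m21 * \<phi> \<xi> + of_real m22 * \<psi> \<xi>"
    and r0: "0 < r0" "r0 \<le> 1" and X: "X holomorphic_on ball 0 r0" "\<And>z. z \<in> ball 0 r0 \<Longrightarrow> X z \<noteq> 0"
    and cubic: "\<And>\<xi>. exp \<xi> \<in> ball 0 r0 \<Longrightarrow>
      - (\<i> / 2) * of_real (w (exp \<xi>)) * b (exp \<xi>) = exp (of_int N * \<xi>) * X (exp \<xi>)"
    and growth: "has_growth (\<lambda>t. w (exp (of_real t))) \<beta> (of_int N + 1)"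
  shows "m11 * m22 - m12 * m21 = 1" "m11 + m22 = 2 * cos (pi * \<beta>)"
proof -
  define W where "W \<xi> = w (exp \<xi>)" for \<xi>
  have W: "W \<xi> > 0" if "\<xi> \<in> half_plane" for \<xi>
    using w that by (simp add: W_def exp_in_punctured_disc)
  have areaW: "Im (cnj (\<phi> \<xi>) * \<psi> \<xi>) = 1 * W \<xi>" if "\<xi> \<in> half_plane" for \<xi>
    using area[OF that] by (simp add: W_def)
  note hol = flat[THEN flat_form_holomorphic]
  show det: "m11 * m22 - m12 * m21 = 1"
  proof -
    have H: "-1 \<in> half_plane" by (simp add: half_plane_def)
    then have H': "deck (-1) \<in> half_plane" by (simp only: shift_in_half_plane)
    have "W (-1) = (m11 * m22 - m12 * m21) * W (-1)"
      using area[OF H'] unfolding shift[OF H] area_bilinear area[OF H] exp_shift W_def by simp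
    then show ?thesis using W[OF H] by simp
  qed
  have wronskian: "\<phi>' \<xi> * deriv \<psi>' \<xi> - \<psi>' \<xi> * deriv \<phi>' \<xi> = exp (of_real (of_int N + 1) * \<xi>) * (of_real (4 * c) * X (exp \<xi>))"
    if f: "flat_form a b \<phi>'" "flat_form a b \<psi>'" and ar: "\<And>\<xi>. \<xi> \<in> half_plane \<Longrightarrow> Im (cnj (\<phi>' \<xi>) * \<psi>' \<xi>) = c * W \<xi>"
      and \<xi>: "exp \<xi> \<in> ball 0 r0" for \<phi>' \<psi>' \<xi> c
  proof -
    have H: "\<xi> \<in> half_plane" by (rule exp_in_small_ball[OF \<xi> r0(2)])
    show ?thesis
      unfolding flat_form_wronskian[OF f H ar[OF H]] W_def cubic[OF \<xi>]
      by (simp add: distrib_right exp_add)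
  qed
  have growthW: "has_growth (\<lambda>t. W (of_real t)) \<beta> (of_int N + 1)" using growth by (simp add: W_def)
  have X4: "(\<lambda>z. of_real (4 * c) * X z) holomorphic_on ball 0 r0" for c
    by (intro holomorphic_intros X)
  define t where "t = m11 + m22"
  have cyclic: "t = 2 * cos (pi * \<beta>)" if c: "(x * (x * m12 + y * m22) - y * (x * m11 + y * m21)) \<noteq> 0" for x y :: real
  proof -
    define \<phi>1 where "\<phi>1 \<xi> = of_real x * \<phi> \<xi> + of_real y * \<psi> \<xi>" for \<xi>
    define \<psi>1 where "\<psi>1 \<xi> = of_real (x * m11 + y * m21) * \<phi> \<xi> + of_real (x * m12 + y * m22) * \<psi> \<xi>" for \<xi>
    have f: "flat_form a b \<phi>1" "flat_form a b \<psi>1"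
      unfolding \<phi>1_def[abs_def] \<psi>1_def[abs_def] by (rule flat_form_combination[OF flat])+
    have ar: "Im (cnj (\<phi>1 \<xi>) * \<psi>1 \<xi>) = (x * (x * m12 + y * m22) - y * (x * m11 + y * m21)) * W \<xi>" if "\<xi> \<in> half_plane" for \<xi>
      unfolding \<phi>1_def \<psi>1_def area_bilinear areaW[OF that] by simp
    show ?thesis
    proof (rule companion_monodromy_trace[OF flat_form_holomorphic[OF f(1)] flat_form_holomorphic[OF f(2)] _ _ c ar W r0 X4 _ wronskian[OF f ar] growthW])
      fix \<xi> assume H: "\<xi> \<in> half_plane"
      show "\<phi>1 (deck \<xi>) = \<psi>1 \<xi>"
        unfolding \<phi>1_def \<psi>1_def shift[OF H] by (simp add: algebra_simps)
      have S: "\<psi>1 (deck \<xi>) = of_real ((x * m11 + y * m21) * m11 + (x * m12 + y * m22) * m21) * \<phi> \<xi>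
          + of_real ((x * m11 + y * m21) * m12 + (x * m12 + y * m22) * m22) * \<psi> \<xi>"
        unfolding \<psi>1_def shift[OF H] by (simp add: algebra_simps)
      have C: "(x * m11 + y * m21) * m11 + (x * m12 + y * m22) * m21 = t * (x * m11 + y * m21) - x * (m11 * m22 - m12 * m21)"
        "(x * m11 + y * m21) * m12 + (x * m12 + y * m22) * m22 = t * (x * m12 + y * m22) - y * (m11 * m22 - m12 * m21)"
        by (simp_all add: t_def algebra_simps)
      show "\<psi>1 (deck \<xi>) = of_real t * \<psi>1 \<xi> - \<phi>1 \<xi>"
        unfolding S C det by (simp add: \<phi>1_def \<psi>1_def algebra_simps)
    next
      show "of_real (4 * (x * (x * m12 + y * m22) - y * (x * m11 + y * m21))) * X z \<noteq> 0" if "z \<in> ball 0 r0" for z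
        using c X(2)[OF that] by (simp only: mult_eq_0_iff of_real_eq_0_iff) simp
    qed
  qed
  show "m11 + m22 = 2 * cos (pi * \<beta>)"
  proof (cases "m12 = 0 \<and> m21 = 0 \<and> m11 = m22")
    case False
    \<comment> \<open>One of \<open>\<phi>\<close>, \<open>\<psi>\<close> and \<open>\<phi> + \<psi>\<close> is cyclic.\<close>
    then consider "m12 \<noteq> 0" | "m21 \<noteq> 0" | "m12 = 0" "m21 = 0" "m11 \<noteq> m22" by blast
    then show ?thesis
      using cyclic[of 1 0] cyclic[of 0 1] cyclic[of 1 1] by cases (auto simp: t_def)
  next
    case True
    have "Re (of_real m11) = cos (pi * \<beta>)"
    proof (rule elliptic_trace[where k=\<i> and c=1, OF hol _ _ _ _ areaW W r0 X4 _ wronskian[OF flat areaW] growthW])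
      have "m11\<^sup>2 = 1" using det True by (simp add: power2_eq_square)
      then show "norm (complex_of_real m11) = 1" by (simp add: power2_eq_1_iff) auto
      show "of_real (4 * 1) * X z \<noteq> 0" if "z \<in> ball 0 r0" for z
        using X(2)[OF that] by simp
    next
      fix \<xi> assume H: "\<xi> \<in> half_plane"
      show "\<psi> (deck \<xi>) - cnj \<i> * \<phi> (deck \<xi>) = of_real m11 * (\<psi> \<xi> - cnj \<i> * \<phi> \<xi>)"
        "\<psi> (deck \<xi>) - \<i> * \<phi> (deck \<xi>) = cnj (of_real m11) * (\<psi> \<xi> - \<i> * \<phi> \<xi>)"
        unfolding shift[OF H] using True by (simp_all add: algebra_simps)
    qed simp_all
    then show ?thesis using True by simp
  qed
qed

section \<open>Conjugacy classes determined by the trace\<close>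

lemma complex_basis_map:
  assumes "Im (cnj e * f) \<noteq> 0"
  shows "linear (\<lambda>x :: real^2. of_real (x $ 1) * e + of_real (x $ 2) * f)"
    "bij (\<lambda>x :: real^2. of_real (x $ 1) * e + of_real (x $ 2) * f)"
proof -
  show lin: "linear (\<lambda>x :: real^2. of_real (x $ 1) * e + of_real (x $ 2) * f)"
    by (rule linearI) (simp_all add: algebra_simps, simp add: scaleR_conv_of_real mult_ac)
  have "x = 0" if "of_real (x $ 1) * e + of_real (x $ 2) * f = 0" for x :: "real^2"
  proof -
    have "x $ 2 * Im (cnj e * f) = Im (cnj e * (of_real (x $ 1) * e + of_real (x $ 2) * f))"
      "x $ 1 * Im (cnj e * f) = - Im (cnj f * (of_real (x $ 1) * e + of_real (x $ 2) * f))"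
      by (simp_all add: algebra_simps)
    then have "x $ 2 = 0" "x $ 1 = 0" using assms unfolding that by simp_all
    then show ?thesis by (simp add: vec_eq_iff forall_2)
  qed
  then have "inj (\<lambda>x :: real^2. of_real (x $ 1) * e + of_real (x $ 2) * f)"
    using linear_injective_0[OF lin] by blast
  moreover have "surj (\<lambda>x :: real^2. of_real (x $ 1) * e + of_real (x $ 2) * f)"
  proof -
    have "\<exists>x :: real^2. u = of_real (x $ 1) * e + of_real (x $ 2) * f" for u
    proof
      define D where "D = Im (cnj e * f)"
      define p where "p = Im (cnj u * f)"
      define q where "q = Im (cnj u * e)"
      let ?x = "vector [p / D, - q / D] :: real^2"
      have D: "D \<noteq> 0" using assms by (simp only: D_def not_False_eq_True)
      have "of_real D * u = of_real p * e - of_real q * f"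
        unfolding D_def p_def q_def by (rule complex_dual_basis_form)
      then show "u = of_real (?x $ 1) * e + of_real (?x $ 2) * f"
        using D by (simp add: field_simps)
    qed
    then show ?thesis by (auto simp: surj_def)
  qed
  ultimately show "bij (\<lambda>x :: real^2. of_real (x $ 1) * e + of_real (x $ 2) * f)"
    by (simp add: bij_def)
qed

lemma conjugate_to_matrixI:
  assumes T: "linear T" and ef: "Im (cnj e * f) \<noteq> 0"
    and "T e = of_real a * e + of_real c * f" "T f = of_real b * e + of_real d * f"
  shows "conjugate_to_matrix T (vector [vector [a, b], vector [c, d]])"
proof -
  let ?P = "\<lambda>x :: real^2. of_real (x $ 1) * e + of_real (x $ 2) * f"
  have "T (?P x) = ?P (vector [vector [a, b], vector [c, d]] *v x)" for x
  proof -
    have "T (?P x) = T (x $ 1 *\<^sub>R e + x $ 2 *\<^sub>R f)" by (simp add: scaleR_conv_of_real)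
    also have "\<dots> = of_real (x $ 1) * T e + of_real (x $ 2) * T f"
      by (simp only: linear_add[OF T] linear_cmul[OF T]) (simp only: scaleR_conv_of_real)
    also have "\<dots> = ?P (vector [vector [a, b], vector [c, d]] *v x)"
      by (simp add: assms(3,4) matrix_vector_mult_def sum_2 algebra_simps)
    finally show ?thesis .
  qed
  then show ?thesis
    unfolding conjugate_to_matrix_def using complex_basis_map[OF ef] by (intro exI[of _ ?P]) auto
qed

text \<open>
  The basis is \<open>1\<close> and \<open>f\<close>, where \<open>f\<close> is chosen so that the first column of the matrix is right; it is a
  basis because \<open>1\<close> is no eigenvector: its eigenvalue \<open>x\<close> would satisfy \<open>(x - cos \<theta>)\<^sup>2 + (sin \<theta>)\<^sup>2 = 0\<close>.
\<close>

lemma rotation_normal_form: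
  assumes T: "linear T" and sq: "\<And>v. T (T v) = of_real (2 * cos \<theta>) * T v - v" and s: "sin \<theta> \<noteq> 0"
  shows "conjugate_to_matrix T (vector [vector [cos \<theta>, - sin \<theta>], vector [sin \<theta>, cos \<theta>]])"
proof -
  define f where "f = (T 1 - of_real (cos \<theta>)) / of_real (sin \<theta>)"
  have T1: "T 1 = of_real (cos \<theta>) * 1 + of_real (sin \<theta>) * f" using s by (simp add: f_def)
  have Tr: "T (of_real x) = of_real x * T 1" for x :: real
    using linear_cmul[OF T, of x 1] by (simp add: scaleR_conv_of_real)
  have Tm: "T (of_real x * v) = of_real x * T v" for x :: real and v
    using linear_cmul[OF T, of x v] by (simp add: scaleR_conv_of_real)
  have "Im (T 1) \<noteq> 0"
  proof
    assume "Im (T 1) = 0"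
    then obtain x :: real where x: "T 1 = of_real x" by (metis complex_is_Real_iff Reals_cases)
    have "complex_of_real (x * x) = of_real (2 * cos \<theta> * x - 1)"
      using sq[of 1] Tr[of x] unfolding x by simp
    then have "x * x = 2 * cos \<theta> * x - 1" by (simp only: of_real_eq_iff)
    then have "(x - cos \<theta>)\<^sup>2 + (sin \<theta>)\<^sup>2 = 0"
      using sin_cos_squared_add[of \<theta>] by (simp add: power2_eq_square algebra_simps)
    then show False using s by (simp add: sum_power2_eq_zero_iff)
  qed
  then have ef: "Im (cnj 1 * f) \<noteq> 0" using s by (simp add: f_def)
  have "T f = of_real (- sin \<theta>) * 1 + of_real (cos \<theta>) * f"
  proof -
    have "f = of_real (1 / sin \<theta>) * (T 1 - of_real (cos \<theta>) * 1)" by (simp add: f_def)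
    then have "T f = of_real (1 / sin \<theta>) * T (T 1 - of_real (cos \<theta>) * 1)" using Tm by metis
    also have "T (T 1 - of_real (cos \<theta>) * 1) = T (T 1) - of_real (cos \<theta>) * T 1"
      by (simp only: linear_diff[OF T] Tm)
    also have "\<dots> = of_real (cos \<theta>) * T 1 - 1" unfolding sq by (simp add: algebra_simps)
    also have "\<dots> = of_real ((cos \<theta>)\<^sup>2 - 1) + of_real (sin \<theta>) * (of_real (cos \<theta>) * f)"
      unfolding T1 by (simp add: algebra_simps power2_eq_square)
    also have "(cos \<theta>)\<^sup>2 - 1 = - ((sin \<theta>)\<^sup>2)" by (simp add: cos_squared_eq)
    finally have "T f = of_real (1 / sin \<theta>) * (of_real (- (sin \<theta>)\<^sup>2) + of_real (sin \<theta>) * (of_real (cos \<theta>) * f))" .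
    moreover have "complex_of_real (1 / sin \<theta>) * (of_real (- (sin \<theta>)\<^sup>2) + of_real (sin \<theta>) * y) = of_real (- sin \<theta>) * 1 + y" for y
      using s by (simp add: field_simps power2_eq_square)
    ultimately show ?thesis by (simp only:)
  qed
  from conjugate_to_matrixI[OF T ef T1 this] show ?thesis .
qed

text \<open>
  The hypothesis says \<open>(T - \<epsilon>)\<^sup>2 = 0\<close>. If \<open>T f \<noteq> \<epsilon> f\<close>, then \<open>(T - \<epsilon>) f\<close> and \<open>f\<close> form a Jordan basis.
\<close>

lemma jordan_normal_form:
  fixes \<epsilon> :: real
  assumes T: "linear T" and sq: "\<And>v. T (T v) = of_real (2 * \<epsilon>) * T v - v" and eps: "\<epsilon>\<^sup>2 = 1"
  shows "(\<forall>v. T v = of_real \<epsilon> * v) \<or> conjugate_to_matrix T (vector [vector [\<epsilon>, 1], vector [0, \<epsilon>]])"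
proof (rule disjCI)
  assume "\<not> conjugate_to_matrix T (vector [vector [\<epsilon>, 1], vector [0, \<epsilon>]])"
  have Tm: "T (of_real x * v) = of_real x * T v" for x :: real and v
    using linear_cmul[OF T, of x v] by (simp add: scaleR_conv_of_real)
  show "\<forall>v. T v = of_real \<epsilon> * v"
  proof (rule ccontr)
    assume "\<not> (\<forall>v. T v = of_real \<epsilon> * v)"
    then obtain f where f: "T f \<noteq> of_real \<epsilon> * f" by blast
    define e where "e = T f - of_real \<epsilon> * f"
    have Te: "T e = of_real \<epsilon> * e + of_real 0 * f"
    proof -
      have "T e = T (T f) - of_real \<epsilon> * T f" unfolding e_def by (simp only: linear_diff[OF T] Tm)
      also have "\<dots> = of_real \<epsilon> * T f - of_real (\<epsilon>\<^sup>2) * f" unfolding sq eps by (simp add: algebra_simps)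
      finally show ?thesis by (simp add: e_def algebra_simps power2_eq_square)
    qed
    have Tf: "T f = of_real 1 * e + of_real \<epsilon> * f" by (simp add: e_def)
    have "Im (cnj e * f) \<noteq> 0"
    proof
      assume 0: "Im (cnj e * f) = 0"
      have e: "e \<noteq> 0" using f by (simp add: e_def)
      define k where "k = Re (cnj e * f)"
      define n where "n = (norm e)\<^sup>2"
      define x where "x = k / n"
      have n: "n \<noteq> 0" "complex_of_real n = e * cnj e"
        using e by (simp_all add: n_def complex_norm_square[symmetric])
      have "cnj e * f = of_real k" using 0 by (simp add: k_def complex_eq_iff)
      then have "of_real n * f = of_real k * e" unfolding n(2) by (simp only: mult_ac)
      then have fx: "f = of_real x * e" using n(1) by (simp add: x_def field_simps)
      have "T f = of_real x * T e" using arg_cong[OF fx, of T] by (simp only: Tm)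
      also have "\<dots> = of_real \<epsilon> * f" unfolding Te by (subst (2) fx) simp
      finally show False using f by simp
    qed
    from conjugate_to_matrixI[OF T this Te Tf] show False
      using \<open>\<not> conjugate_to_matrix _ _\<close> by simp
  qed
qed

text \<open>
  In the coordinates \<open>v \<mapsto> (Re (x v), Re (y v))\<close> the map \<open>T\<close> is given by the matrix \<open>n\<close> of determinant
  one, and the claim is its characteristic equation.
\<close>

lemma cayley_hamilton_dual:
  fixes n11 n12 n21 n22 :: real
  assumes xy: "Im (cnj x * y) \<noteq> 0" and det: "n11 * n22 - n12 * n21 = 1"
    and P: "\<And>v. Re (x * T v) = n11 * Re (x * v) + n12 * Re (y * v)"
    and Q: "\<And>v. Re (y * T v) = n21 * Re (x * v) + n22 * Re (y * v)"
  shows "linear T" "T (T v) = of_real (n11 + n22) * T v - v"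
proof -
  have Re_lin: "Re (u * (p + q)) = Re (u * p) + Re (u * q)" "Re (u * (p - q)) = Re (u * p) - Re (u * q)"
     "Re (u * (of_real k * p)) = k * Re (u * p)" "Re (u * (k *\<^sub>R p)) = k * Re (u * p)" for u p q :: complex and k :: real
    by (simp_all add: algebra_simps)
  show "linear T"
    by (rule linearI; rule complex_dual_basis_eqI[OF xy]; simp only: P Q Re_lin; simp add: algebra_simps)
  have alg: "n11 * (n11 * X + n12 * Y) + n12 * (n21 * X + n22 * Y) = (n11 + n22) * (n11 * X + n12 * Y) - X"
    "n21 * (n11 * X + n12 * Y) + n22 * (n21 * X + n22 * Y) = (n11 + n22) * (n21 * X + n22 * Y) - Y" for X Y
    using det by algebra+
  show "T (T v) = of_real (n11 + n22) * T v - v"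
  proof (rule complex_dual_basis_eqI[OF xy])
    show "Re (x * T (T v)) = Re (x * (of_real (n11 + n22) * T v - v))"
      unfolding Re_lin P Q by (rule alg)
    show "Re (y * T (T v)) = Re (y * (of_real (n11 + n22) * T v - v))"
      unfolding Re_lin P Q by (rule alg)
  qed
qed

text \<open>
  A real matrix of determinant one and trace \<open>2 cos (\<pi> \<beta>)\<close> has no real eigenvalue when
  \<open>\<beta>\<close> is not an integer, and has the double eigenvalue \<open>1\<close> or \<open>- 1\<close> according to the parity of \<open>\<beta>\<close> otherwise.
  The hypothesis is its characteristic equation.
\<close>

lemma conjugacy_class_from_trace:
  fixes \<beta> :: real
  assumes T: "linear T" and sq: "\<And>v. T (T v) = of_real (2 * cos (pi * \<beta>)) * T v - v"
  shows "(\<beta> \<notin> \<int> \<longrightarrow>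
           conjugate_to_matrix T
             (vector [vector [cos (pi * \<beta>), - sin (pi * \<beta>)],
                      vector [sin (pi * \<beta>), cos (pi * \<beta>)]])) \<and>
         ((\<exists>k::int. \<beta> = 2 * of_int k) \<longrightarrow>
           (\<forall>v. T v = v) \<or>
           conjugate_to_matrix T (vector [vector [1, 1], vector [0, 1]])) \<and>
         ((\<exists>k::int. \<beta> = 2 * of_int k + 1) \<longrightarrow>
           (\<forall>v. T v = - v) \<or>
           conjugate_to_matrix T (vector [vector [-1, 1], vector [0, -1]]))"
proof (intro conjI impI)
  assume "\<beta> \<notin> \<int>"
  then have "sin (pi * \<beta>) \<noteq> 0" by (auto simp: sin_zero_iff_int2)
  then show "conjugate_to_matrix T (vector [vector [cos (pi * \<beta>), - sin (pi * \<beta>)],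
                      vector [sin (pi * \<beta>), cos (pi * \<beta>)]])"
    by (rule rotation_normal_form[OF T sq])
next
  assume "\<exists>k::int. \<beta> = 2 * of_int k"
  then obtain k :: int where k: "\<beta> = 2 * of_int k" by blast
  have "pi * \<beta> = 2 * pi * of_int k" by (simp add: k)
  then have "cos (pi * \<beta>) = 1" by (simp only: cos_int_2pin)
  then show "(\<forall>v. T v = v) \<or> conjugate_to_matrix T (vector [vector [1, 1], vector [0, 1]])"
    using jordan_normal_form[OF T, of 1] sq by simp
next
  assume "\<exists>k::int. \<beta> = 2 * of_int k + 1"
  then obtain k :: int where k: "\<beta> = 2 * of_int k + 1" by blast
  have "pi * \<beta> = 2 * pi * of_int k + pi" by (simp add: k algebra_simps)
  then have "cos (pi * \<beta>) = - cos (2 * pi * of_int k)" by (simp only: cos_periodic_pi)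
  then have "cos (pi * \<beta>) = -1" by (simp only: cos_int_2pin)
  then show "(\<forall>v. T v = - v) \<or> conjugate_to_matrix T (vector [vector [-1, 1], vector [0, -1]])"
    using jordan_normal_form[OF T, of "-1"] sq by simp
qed

section \<open>The monodromy theorem\<close>

theorem theorem2p7:
  fixes g :: metric and \<Gamma> :: connection and w :: "complex \<Rightarrow> real"
    and N :: int and \<beta> C :: real and \<gamma> :: "real \<Rightarrow> complex"
  assumes special: "special_kaehler_on punctured_disc g \<Gamma>"
    and conformal: "\<And>z u v. z \<in> punctured_disc \<Longrightarrow> g z u v = w z * (u \<bullet> v)"
    and order: "cubic_form_order punctured_disc g \<Gamma> N"
    and C_pos: "C > 0"
    and asymptotics:
      "(\<beta> < of_int N + 1 \<and>
        (\<exists>e. e \<in> o[at 0](\<lambda>_. 1) \<and>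
          (\<forall>z\<in>punctured_disc. w z = norm z powr \<beta> * (C + e z)))) \<or>
       (\<beta> = of_int N + 1 \<and>
        (\<exists>e. e \<in> o[at 0](\<lambda>_. 1) \<and>
          (\<forall>z\<in>punctured_disc. w z = - (norm z powi (N + 1)) * ln (norm z) * (C + e z))))"
    and loop: "valid_path \<gamma>" "path_image \<gamma> \<subseteq> punctured_disc" "pathfinish \<gamma> = pathstart \<gamma>"
    and once: "winding_number \<gamma> 0 \<in> {1, -1}"
  shows "(\<beta> \<notin> \<int> \<longrightarrow>
           conjugate_to_matrix (parallel_transport \<Gamma> \<gamma>)
             (vector [vector [cos (pi * \<beta>), - sin (pi * \<beta>)],
                      vector [sin (pi * \<beta>), cos (pi * \<beta>)]])) \<and>
         ((\<exists>k::int. \<beta> = 2 * of_int k) \<longrightarrow>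
           (\<forall>v. parallel_transport \<Gamma> \<gamma> v = v) \<or>
           conjugate_to_matrix (parallel_transport \<Gamma> \<gamma>)
             (vector [vector [1, 1], vector [0, 1]])) \<and>
         ((\<exists>k::int. \<beta> = 2 * of_int k + 1) \<longrightarrow>
           (\<forall>v. parallel_transport \<Gamma> \<gamma> v = - v) \<or>
           conjugate_to_matrix (parallel_transport \<Gamma> \<gamma>)
             (vector [vector [-1, 1], vector [0, -1]]))"
proof -
  obtain a b a1 b1 where
    \<Gamma>: "\<And>z u v. z \<in> punctured_disc \<Longrightarrow> \<Gamma> z u v = a z * u * v + cnj (b z * u * v)"
    and da: "\<And>z. z \<in> punctured_disc \<Longrightarrow> (a has_derivative (\<lambda>h. a1 z * h + - (b z * cnj (b z)) * cnj h)) (at z)"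
    and db: "\<And>z. z \<in> punctured_disc \<Longrightarrow> (b has_derivative (\<lambda>h. b1 z * h + - (b z * cnj (a z)) * cnj h)) (at z)"
    and cont: "continuous_on punctured_disc a1" "continuous_on punctured_disc b1"
    and dw: "\<And>z. z \<in> punctured_disc \<Longrightarrow> (w has_derivative (\<lambda>h. 2 * w z * Re (a z * h))) (at z)"
    and w: "\<And>z. z \<in> punctured_disc \<Longrightarrow> w z > 0"
    and cubic: "\<And>z. z \<in> punctured_disc \<Longrightarrow> cubic_form g \<Gamma> z 1 1 1 = - (\<i> / 2) * w z * b z"
    using special_kaehler_local_form[OF open_punctured_disc special conformal] by blast

  have p: "-1 \<in> half_plane" by (simp add: half_plane_def)
  obtain \<phi> where \<phi>: "\<phi> (-1) = 1" "flat_form a b \<phi>"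
    using flat_form_exists[OF da db cont p] by blast
  obtain \<psi> where \<psi>: "\<psi> (-1) = \<i> * of_real (w (exp (-1)))" "flat_form a b \<psi>"
    using flat_form_exists[OF da db cont p] by blast
  have area: "Im (cnj (\<phi> \<xi>) * \<psi> \<xi>) = w (exp \<xi>)" if "\<xi> \<in> half_plane" for \<xi>
  proof -
    obtain c where c: "\<And>\<xi>. \<xi> \<in> half_plane \<Longrightarrow> Im (cnj (\<phi> \<xi>) * \<psi> \<xi>) = c * w (exp \<xi>)"
      using flat_forms_area_constant[OF dw w \<phi>(2) \<psi>(2)] by blast
    have "w (exp (-1)) > 0" using p by (intro w) (simp only: exp_in_punctured_disc)
    then have "c = 1" using c[OF p] \<phi>(1) \<psi>(1) by simp
    then show ?thesis using c[OF that] by simp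
  qed
  \<comment> \<open>Translates of parallel one-forms are parallel, hence real combinations of \<open>\<phi>\<close> and \<open>\<psi>\<close>.\<close>
  obtain m11 m12 where m1: "\<And>\<xi>. \<xi> \<in> half_plane \<Longrightarrow>
      \<phi> (deck \<xi>) = of_real m11 * \<phi> \<xi> + of_real m12 * \<psi> \<xi>"
    using flat_form_in_span[OF dw w \<phi>(2) \<psi>(2) flat_form_shift[OF \<phi>(2)] area] by blast
  obtain m21 m22 where m2: "\<And>\<xi>. \<xi> \<in> half_plane \<Longrightarrow>
      \<psi> (deck \<xi>) = of_real m21 * \<phi> \<xi> + of_real m22 * \<psi> \<xi>"
    using flat_form_in_span[OF dw w \<phi>(2) \<psi>(2) flat_form_shift[OF \<psi>(2)] area] by blast

  obtain \<Xi> where \<Xi>: "\<And>z u v t. z \<in> punctured_disc \<Longrightarrow> cubic_form g \<Gamma> z u v t = \<Xi> z * u * v * t"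
    "isolated_singularity_at \<Xi> 0" "not_essential \<Xi> 0" "\<exists>\<^sub>F z in at 0. \<Xi> z \<noteq> 0" "zorder \<Xi> 0 = N"
    using order unfolding cubic_form_order_def by blast
  define X where "X = zor_poly \<Xi> 0"
  obtain r where X0: "X 0 \<noteq> 0" and r: "r > 0" "X holomorphic_on cball 0 r"
    "\<And>z. z \<in> cball 0 r - {0} \<Longrightarrow> \<Xi> z = X z * z powi N \<and> X z \<noteq> 0"
    using zorder_exist[OF \<Xi>(2-4)] unfolding \<Xi>(5) X_def by auto
  define r0 where "r0 = min r 1"
  have r0: "0 < r0" "r0 \<le> 1" "ball 0 r0 \<subseteq> cball (0::complex) r" using r(1) by (auto simp: r0_def)
  have X: "X holomorphic_on ball 0 r0" by (rule holomorphic_on_subset[OF r(2) r0(3)])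
  have X_nz: "X z \<noteq> 0" if "z \<in> ball 0 r0" for z
    using X0 r(3)[of z] r0(3) that by (cases "z = 0") auto
  have cubic_X: "- (\<i> / 2) * of_real (w (exp \<xi>)) * b (exp \<xi>) = exp (of_int N * \<xi>) * X (exp \<xi>)"
    if \<xi>: "exp \<xi> \<in> ball 0 r0" for \<xi>
  proof -
    have z: "exp \<xi> \<in> punctured_disc" using exp_in_small_ball[OF \<xi> r0(2)] by (simp only: exp_in_punctured_disc)
    have "exp \<xi> \<in> cball 0 r - {0}" using subsetD[OF r0(3) \<xi>] by simp
    then have "\<Xi> (exp \<xi>) = X (exp \<xi>) * exp (of_int N * \<xi>)" using r(3) by (simp add: exp_power_int)
    then show ?thesis using \<Xi>(1)[OF z, of 1 1 1] cubic[OF z] by (simp add: mult.commute)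
  qed

  note growth = has_growth_along_negative_axis[OF C_pos asymptotics]
  have det: "m11 * m22 - m12 * m21 = 1" and trace: "m11 + m22 = 2 * cos (pi * \<beta>)"
    using flat_coframe_monodromy[OF w \<phi>(2) \<psi>(2) area m1 m2 r0(1,2) X X_nz cubic_X growth] by blast+

  define T where "T = parallel_transport \<Gamma> \<gamma>"
  have \<gamma>0: "0 \<notin> path_image \<gamma>" using loop(2) by (auto simp: punctured_disc_def)
  obtain q where q: "path q" "pathfinish q - pathstart q = 2 * of_real pi * \<i> * winding_number \<gamma> 0"
    "\<And>t. t \<in> {0..1} \<Longrightarrow> \<gamma> t = 0 + exp (q t)"
    using winding_number_as_continuous_log[OF valid_path_imp_path[OF loop(1)] \<gamma>0] by blast
  have q': "\<And>t. t \<in> {0..1} \<Longrightarrow> \<gamma> t = exp (q t)" using q(3) by simp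
  have H: "q 0 \<in> half_plane" "q 1 \<in> half_plane"
  proof -
    have "\<gamma> 0 \<in> punctured_disc" "\<gamma> 1 \<in> punctured_disc" using loop(2) by (auto simp: path_image_def)
    then show "q 0 \<in> half_plane" "q 1 \<in> half_plane"
      using q'[of 0] q'[of 1] by (simp_all add: exp_in_punctured_disc)
  qed
  have T: "Re (\<phi> (q 1) * T v) = Re (\<phi> (q 0) * v)" "Re (\<psi> (q 1) * T v) = Re (\<psi> (q 0) * v)" for v
    unfolding T_def
    using parallel_transport_preserves_flat_forms[OF \<Gamma> dw w \<phi>(2) \<psi>(2) area loop(1,2) q(1) q'] by blast+
  have nz: "Im (cnj (\<phi> \<xi>) * \<psi> \<xi>) \<noteq> 0" if "\<xi> \<in> half_plane" for \<xi>
    using w[of "exp \<xi>"] that unfolding area[OF that] by (simp add: exp_in_punctured_disc)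
  have Re_comb: "Re ((of_real k * x + of_real l * y) * u) = k * Re (x * u) + l * Re (y * u)" for k l :: real and x y u
    by (simp add: algebra_simps)
  have T_eq: "linear T \<and> (\<forall>v. T (T v) = of_real (2 * cos (pi * \<beta>)) * T v - v)"
  proof (cases "winding_number \<gamma> 0 = 1")
    case True
    then have "q 1 = deck (q 0)" using q(2) by (simp add: pathfinish_def pathstart_def algebra_simps)
    then have eqs: "m11 * Re (\<phi> (q 0) * T v) + m12 * Re (\<psi> (q 0) * T v) = Re (\<phi> (q 0) * v)"
      "m21 * Re (\<phi> (q 0) * T v) + m22 * Re (\<psi> (q 0) * T v) = Re (\<psi> (q 0) * v)" for v
      using T[of v] unfolding \<open>q 1 = _\<close> m1[OF H(1)] m2[OF H(1)] Re_comb by auto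
    \<comment> \<open>Positive orientation: \<open>T\<close> acts by the inverse matrix.\<close>
    have cramer: "p = m22 * x + - m12 * y" "s = - m21 * x + m11 * y" if "m11 * p + m12 * s = x" "m21 * p + m22 * s = y" for p s x y
    proof -
      have "m22 * x + - m12 * y = (m11 * m22 - m12 * m21) * p" "- m21 * x + m11 * y = (m11 * m22 - m12 * m21) * s"
        unfolding that[symmetric] by (simp_all add: algebra_simps)
      then show "p = m22 * x + - m12 * y" "s = - m21 * x + m11 * y" unfolding det by simp_all
    qed
    have tr: "m22 + m11 = 2 * cos (pi * \<beta>)" using trace by simp
    show ?thesis
      using cayley_hamilton_dual[OF nz[OF H(1)], of m22 m11 "- m12" "- m21" T, OF _ cramer[OF eqs] ] det
      unfolding tr by (simp add: mult.commute)
  next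
    case False
    \<comment> \<open>Negative orientation: \<open>T\<close> acts by the matrix itself.\<close>
    then have "winding_number \<gamma> 0 = - 1" using once by simp
    then have "q 0 = deck (q 1)" using q(2) by (simp add: pathfinish_def pathstart_def algebra_simps)
    then have eqs: "Re (\<phi> (q 1) * T v) = m11 * Re (\<phi> (q 1) * v) + m12 * Re (\<psi> (q 1) * v)"
      "Re (\<psi> (q 1) * T v) = m21 * Re (\<phi> (q 1) * v) + m22 * Re (\<psi> (q 1) * v)" for v
      using T[of v] unfolding \<open>q 0 = _\<close> m1[OF H(2)] m2[OF H(2)] Re_comb by auto
    show ?thesis
      using cayley_hamilton_dual[OF nz[OF H(2)] det eqs] unfolding trace by blast
  qed
  show ?thesis
    unfolding T_def[symmetric]
    by (rule conjugacy_class_from_trace[OF conjunct1[OF T_eq] spec[OF conjunct2[OF T_eq]]])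
qed

end
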